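(* Let $V$ be a real vector space of dimension $d$ with lattice $\Lambda$, let $\mathfrak c\subseteq V$ be a full-dimensional rational polyhedral cone with vertex $0$, let $L\subseteq V$ be a rational subspace, and let $\Psi^L_{\mathfrak c}\subset\Lambda^*\cap L^\perp$ be a set constructed as in the context. Let $m\in\mathbb Z$. Then: (i) the function $(s,\xi)\mapsto M^L(s,\mathfrak c)_{[m]}(\xi)$ belongs to $\mathcal Q^{\Psi^L_{\mathfrak c}}_{[\le m+d]}(V)\otimes\mathcal R_{[m]}(V^* )$; (ii) the function $(s,\xi)\mapsto S^L(s+\mathfrak c)_{[m]}(\xi)$ belongs to $\mathcal Q\mathcal P^{\Psi^L_{\mathfrak c}}_{[\le m+d]}(V)\otimes\mathcal R_{[m]}(V^* )$; more precisely $$S^L(s+\mathfrak c)_{[m]}(\xi)=\sum_{r=0}^{m+d}\frac{\langle\xi,s\rangle^r}{r!}\,M^L(s,\mathfrak c)_{[m-r]}(\xi);$$ (iii) the homogeneous component in $\xi$ of lowest degree has degree $-d$ (i.e. $S^L(s+\mathfrak c)_{[m]}=0$ for $m<-d$) and does not depend on $s$; it is given by the integral: $$S^L(s+\mathfrak c)_{[-d]}(\xi)=M^L(s,\mathfrak c)_{[-d]}(\xi)=I(\mathfrak c)(\xi).$$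
   Context: $V$ is a real vector space of dimension $d$ with a lattice $\Lambda$; $\Lambda^*=\{\gamma\in V^*:\langle\gamma,\Lambda\rangle\subseteq\mathbb Z\}$, $V^*_{\mathbb Q}=\Lambda^*\otimes\mathbb Q$, and $L^\perp\subseteq V^*$ is the annihilator of $L$. A rational subspace $L$ is one with $L\cap\Lambda$ a lattice in $L$; it carries the Lebesgue measure for which $L/(L\cap\Lambda)$ has volume $1$ (likewise on translates), and $\Lambda_{V/L}$ denotes the image of $\Lambda$ in $V/L$ (a lattice in $V/L$); $(V/L)^*$ is identified with $L^\perp$ and the dual lattice of $\Lambda_{V/L}$ with $\Lambda^*\cap L^\perp$. A semi-rational polyhedron is a finite intersection of closed halfspaces $\{\langle\mu,x\rangle\le b\}$ with $\mu\in\Lambda^*$, $b\in\mathbb R$. $\mathcal M_\ell(V^* )$ is the ring of meromorphic functions near $0\in V^*_{\mathbb C}$ of the form $\phi(\xi)/\prod_{j=1}^N\langle\xi,w_j\rangle$, $\phi$ holomorphic near $0$, $w_j\in V\setminus\{0\}$. Homogeneous components $\phi_{[m]}$ are defined by $\phi(\tau\xi)=\sum_{m\ge m_0}\tau^m\phi_{[m]}(\xi)$ (Laurent expansion in $\tau$). $\mathcal R_{[m]}(V^* )$ is the space of rational functions $P(\xi)/\prod_{j=1}^N\langle\xi,w_j\rangle$ with $P$ homogeneous of degree $m+N$. The intermediate generating function $S^L(\mathfrak p)\in\mathcal M_\ell(V^* )$ is given by the unique valuation on semi-rational polyhedra (linear relations among indicator functions are preserved) that vanishes on polyhedra containing a line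 and equals $\sum_{y\in\Lambda_{V/L}}\int_{\mathfrak p\cap(y+L)}e^{\langle\xi,x\rangle}dx$ wherever this converges; $I=S^V$ is the integral $\int_{\mathfrak p}e^{\langle\xi,x\rangle}dx$ (meromorphically continued). $M^L(s,\mathfrak c)(\xi)=e^{-\langle\xi,s\rangle}S^L(s+\mathfrak c)(\xi)$. Step-polynomials: $\{t\}\in[0,1)$ is the fractional part. For finite $\Psi\subset V^*_{\mathbb Q}$, $\mathcal Q^\Psi_{[\le k]}(V)$ is the span of products of at most $k$ functions $s\mapsto\{\langle\eta,s\rangle\}$, $\eta\in\Psi$ (empty product $=1$; the space is $\{0\}$ for $k<0$); $\mathcal Q\mathcal P^\Psi_{[\le q]}(V)$ is the span of $f(s)p(s)$ with $f\in\mathcal Q^\Psi_{[\le k]}(V)$, $p$ homogeneous polynomial of degree $r$, $k+r\le q$. $A\otimes B$ denotes finite sums $\sum_i f_i(s)g_i(\xi)$ with $f_i\in A$, $g_i\in B$. Construction of $\Psi^L_{\mathfrak c}$: decompose $[\mathfrak c]\equiv\sum_i\epsilon_i[\mathfrak c_i]$ (modulo the span of indicator functions of cones containing a line) where each $\mathfrak c_i$ is a full-dimensional simplicial rational cone having a face whose linear span is $L$ (such decompositions exist). For each $i$, decompose the indicator function of the projection of $\mathfrak c_i$ to $V/L$ as a signed sum, modulo cones containing lines, of indicator functions of full-dimensional cones $\mathfrak u\subseteq V/L$ that are unimodular with respect to $\Lambda_{V/L}$ (generated by part of a basis of $\Lambda_{V/L}$). For each such $\mathfrak u$ take its primitive edge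 generators $v^{\mathfrak u}_j\in\Lambda_{V/L}$ and the dual basis $\eta^{\mathfrak u}_j\in\Lambda^*\cap L^\perp$; $\Psi^L_{\mathfrak c}$ is the set of all these $\eta^{\mathfrak u}_j$.
   Formalization: The set Ψ is taken to consist of the negatives −η_j of the dual basis covectors, since with η_j claim (i) fails: for V=ℝ, Λ=ℤ, L=0, c=[0,∞), M(s,c)_[0]=1/2−{−s} is not a polynomial in {s}. *)

theory Defs
  imports "HOL-Complex_Analysis.Complex_Analysis"
begin

text \<open>
  \<^typ>\<open>'a::euclidean_space\<close> plays the role of the vector space V; its inner product is never used.
  The dual of V is \<^typ>\<open>'a::euclidean_space \<Rightarrow>\<^sub>L real\<close>, and the complexified dual is
  \<^typ>\<open>'a::euclidean_space \<Rightarrow>\<^sub>L complex\<close>, i.e. the space of real-linear maps from V to the complex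
  numbers. In both cases the pairing is function application.
\<close>

type_synonym 'a cdual = "'a \<Rightarrow>\<^sub>L complex"

definition cscale :: "complex \<Rightarrow> 'a::euclidean_space cdual \<Rightarrow> 'a cdual" where
  "cscale \<tau> \<xi> = blinfun_mult_right \<tau> o\<^sub>L \<xi>"

definition lattice_basis :: "'a::euclidean_space set \<Rightarrow> 'a set \<Rightarrow> 'a set \<Rightarrow> bool" where
  "lattice_basis \<Gamma> W B \<longleftrightarrow>
     independent B \<and> span B = W \<and> \<Gamma> = {\<Sum>b\<in>B. of_int (k b) *\<^sub>R b | k. True}"

definition lattice_in :: "'a::euclidean_space set \<Rightarrow> 'a set \<Rightarrow> bool" where
  "lattice_in \<Gamma> W \<longleftrightarrow> (\<exists>B. lattice_basis \<Gamma> W B)"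

definition rational_subspace :: "'a::euclidean_space set \<Rightarrow> 'a set \<Rightarrow> bool" where
  "rational_subspace \<Lambda> L \<longleftrightarrow> subspace L \<and> lattice_in (L \<inter> \<Lambda>) L"

definition dual_lattice :: "'a::euclidean_space set \<Rightarrow> ('a \<Rightarrow>\<^sub>L real) set" where
  "dual_lattice \<Lambda> = {\<gamma>. \<forall>x\<in>\<Lambda>. blinfun_apply \<gamma> x \<in> \<int>}"

definition annihilator :: "'a::euclidean_space set \<Rightarrow> ('a \<Rightarrow>\<^sub>L real) set" where
  "annihilator L = {\<gamma>. \<forall>x\<in>L. blinfun_apply \<gamma> x = 0}"

text \<open>Points of V/L are the cosets \<open>y + L\<close>; \<^term>\<open>qproj L\<close> is the projection from V to V/L.\<close>

definition qproj :: "'a::euclidean_space set \<Rightarrow> 'a \<Rightarrow> 'a set" where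
  "qproj L y = (\<lambda>z. y + z) ` L"

definition quot_lattice :: "'a::euclidean_space set \<Rightarrow> 'a set \<Rightarrow> 'a set set" where
  "quot_lattice \<Lambda> L = qproj L ` \<Lambda>"

text \<open>\<open>B\<close> is a set of representatives in \<open>\<Lambda>\<close> of a basis of the image of \<open>\<Lambda>\<close> in V/L.\<close>

definition quot_lattice_basis :: "'a::euclidean_space set \<Rightarrow> 'a set \<Rightarrow> 'a set \<Rightarrow> bool" where
  "quot_lattice_basis \<Lambda> L B \<longleftrightarrow>
     finite B \<and> B \<subseteq> \<Lambda> \<and>
     (\<forall>a. (\<Sum>b\<in>B. a b *\<^sub>R b) \<in> L \<longrightarrow> (\<forall>b\<in>B. a b = (0::real))) \<and>
     (\<forall>x\<in>\<Lambda>. \<exists>k. x - (\<Sum>b\<in>B. of_int (k b) *\<^sub>R b) \<in> L)"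

text \<open>
  The measure on a coset \<open>C = y + L\<close>, as a Borel measure on V: the image of the product Lebesgue
  measure in the coordinates given by a basis of \<open>L \<inter> \<Lambda>\<close>, so that \<open>L / (L \<inter> \<Lambda>)\<close> has volume 1.
  It does not depend on the choice of the basis (a change of basis is unimodular), nor on the
  choice of \<open>y\<close> in \<open>C\<close>.
\<close>

definition coset_measure :: "'a::euclidean_space set \<Rightarrow> 'a set \<Rightarrow> 'a set \<Rightarrow> 'a measure" where
  "coset_measure \<Lambda> L C =
     (let B = (SOME B. lattice_basis (L \<inter> \<Lambda>) L B); y = (SOME y. y \<in> C)
      in distr (Pi\<^sub>M B (\<lambda>_. lborel)) borel (\<lambda>a. y + (\<Sum>b\<in>B. a b *\<^sub>R b)))"

definition semi_rational_polyhedron :: "'a::euclidean_space set \<Rightarrow> 'a set \<Rightarrow> bool" where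
  "semi_rational_polyhedron \<Lambda> p \<longleftrightarrow>
     (\<exists>H :: (('a \<Rightarrow>\<^sub>L real) \<times> real) set. finite H \<and> fst ` H \<subseteq> dual_lattice \<Lambda> \<and>
        p = {x. \<forall>(\<mu>, b)\<in>H. blinfun_apply \<mu> x \<le> b})"

definition rational_cone :: "'a::euclidean_space set \<Rightarrow> 'a set \<Rightarrow> bool" where
  "rational_cone \<Lambda> K \<longleftrightarrow>
     (\<exists>M. finite M \<and> M \<subseteq> dual_lattice \<Lambda> \<and> K = {x. \<forall>\<mu>\<in>M. blinfun_apply \<mu> x \<le> 0})"

definition contains_line :: "'a::euclidean_space set \<Rightarrow> bool" where
  "contains_line K \<longleftrightarrow> (\<exists>x v. v \<noteq> 0 \<and> (\<forall>t::real. x + t *\<^sub>R v \<in> K))"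

definition simplicial_full_cone :: "'a::euclidean_space set \<Rightarrow> 'a set \<Rightarrow> bool" where
  "simplicial_full_cone \<Lambda> K \<longleftrightarrow>
     (\<exists>B. B \<subseteq> \<Lambda> \<and> independent B \<and> span B = UNIV \<and> K = convex_cone hull B)"

text \<open>Rational cones in V/L; \<open>\<Lambda>\<^sup>* \<inter> L\<^sup>\<bottom>\<close> is the dual of the image of \<open>\<Lambda>\<close> in V/L.\<close>

definition quot_rational_cone :: "'a::euclidean_space set \<Rightarrow> 'a set \<Rightarrow> 'a set set \<Rightarrow> bool" where
  "quot_rational_cone \<Lambda> L u \<longleftrightarrow>
     (\<exists>M. finite M \<and> M \<subseteq> dual_lattice \<Lambda> \<inter> annihilator L \<and>
        u = qproj L ` {x. \<forall>\<mu>\<in>M. blinfun_apply \<mu> x \<le> 0})"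

definition quot_contains_line :: "'a::euclidean_space set \<Rightarrow> 'a set set \<Rightarrow> bool" where
  "quot_contains_line L u \<longleftrightarrow> (\<exists>x v. v \<notin> L \<and> (\<forall>t::real. qproj L (x + t *\<^sub>R v) \<in> u))"

text \<open>Congruence of functions modulo the linear span of the indicator functions of the sets in \<open>Z\<close>.\<close>

definition cong_mod_indicators :: "'b set set \<Rightarrow> ('b \<Rightarrow> real) \<Rightarrow> ('b \<Rightarrow> real) \<Rightarrow> bool" where
  "cong_mod_indicators Z f g \<longleftrightarrow>
     (\<exists>C a. finite C \<and> C \<subseteq> Z \<and> (\<forall>x. f x = g x + (\<Sum>z\<in>C. a z * indicator z x)))"

definition holomorphic_near_0 :: "('a::euclidean_space cdual \<Rightarrow> complex) \<Rightarrow> bool" where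
  "holomorphic_near_0 \<phi> \<longleftrightarrow>
     (\<exists>U. open U \<and> 0 \<in> U \<and>
        (\<forall>\<xi>\<in>U. \<exists>D. (\<phi> has_derivative D) (at \<xi>) \<and> (\<forall>\<tau> h. D (cscale \<tau> h) = \<tau> * D h)))"

text \<open>
  Meromorphic functions near 0 with poles along hyperplanes are represented by total functions
  whose values on finitely many hyperplanes are irrelevant. The following relation expresses
  equality of the meromorphic functions represented.
\<close>

definition mero_eq ::
    "('a::euclidean_space cdual \<Rightarrow> complex) \<Rightarrow> ('a cdual \<Rightarrow> complex) \<Rightarrow> bool" where
  "mero_eq f g \<longleftrightarrow>
     (\<exists>W. finite W \<and> 0 \<notin> W \<and>
        (\<forall>\<^sub>F \<xi> in nhds 0. (\<forall>w\<in>W. blinfun_apply \<xi> w \<noteq> 0) \<longrightarrow> f \<xi> = g \<xi>))"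

definition mero_linear_poles :: "('a::euclidean_space cdual \<Rightarrow> complex) set" where
  "mero_linear_poles =
     {f. \<exists>\<phi> ws. holomorphic_near_0 \<phi> \<and> 0 \<notin> set ws \<and>
           mero_eq f (\<lambda>\<xi>. \<phi> \<xi> / (\<Prod>w\<leftarrow>ws. blinfun_apply \<xi> w))}"

definition hom_component ::
    "int \<Rightarrow> ('a::euclidean_space cdual \<Rightarrow> complex) \<Rightarrow> 'a cdual \<Rightarrow> complex" where
  "hom_component m f \<xi> = fls_nth (laurent_expansion (\<lambda>\<tau>. f (cscale \<tau> \<xi>)) 0) m"

inductive cpolynomial :: "('a::euclidean_space cdual \<Rightarrow> complex) \<Rightarrow> bool" where
  pairing: "cpolynomial (\<lambda>\<xi>. blinfun_apply \<xi> w)"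
| const: "cpolynomial (\<lambda>\<xi>. c)"
| add: "cpolynomial P \<Longrightarrow> cpolynomial Q \<Longrightarrow> cpolynomial (\<lambda>\<xi>. P \<xi> + Q \<xi>)"
| mult: "cpolynomial P \<Longrightarrow> cpolynomial Q \<Longrightarrow> cpolynomial (\<lambda>\<xi>. P \<xi> * Q \<xi>)"

text \<open>The degree is an integer; the only homogeneous polynomial of negative degree is 0.\<close>

definition hom_cpolynomial :: "int \<Rightarrow> ('a::euclidean_space cdual \<Rightarrow> complex) \<Rightarrow> bool" where
  "hom_cpolynomial k P \<longleftrightarrow>
     cpolynomial P \<and> (\<forall>\<tau> \<xi>. \<tau> \<noteq> 0 \<longrightarrow> P (cscale \<tau> \<xi>) = \<tau> powi k * P \<xi>)"

definition hom_rational :: "int \<Rightarrow> ('a::euclidean_space cdual \<Rightarrow> complex) set" where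
  "hom_rational m =
     {g. \<exists>P ws. 0 \<notin> set ws \<and> hom_cpolynomial (m + int (length ws)) P \<and>
           g = (\<lambda>\<xi>. P \<xi> / (\<Prod>w\<leftarrow>ws. blinfun_apply \<xi> w))}"

text \<open>For \<open>k < 0\<close> the condition on the lengths forces \<open>n = 0\<close>, so the space is {0}.\<close>

definition step_poly :: "('a::euclidean_space \<Rightarrow>\<^sub>L real) set \<Rightarrow> int \<Rightarrow> ('a \<Rightarrow> real) set" where
  "step_poly \<Psi> k =
     {f. \<exists>n a hs. (\<forall>i<n. set (hs i) \<subseteq> \<Psi> \<and> int (length (hs i)) \<le> k) \<and>
           f = (\<lambda>s. \<Sum>i<(n::nat). a i * (\<Prod>\<eta>\<leftarrow>hs i. frac (blinfun_apply \<eta> s)))}"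

definition hom_polynomial :: "nat \<Rightarrow> ('a::euclidean_space \<Rightarrow> real) \<Rightarrow> bool" where
  "hom_polynomial r p \<longleftrightarrow>
     real_polynomial_function p \<and> (\<forall>t x. p (t *\<^sub>R x) = t ^ r * p x)"

definition quasi_poly :: "('a::euclidean_space \<Rightarrow>\<^sub>L real) set \<Rightarrow> int \<Rightarrow> ('a \<Rightarrow> real) set" where
  "quasi_poly \<Psi> q =
     {h. \<exists>n f p.
           (\<forall>i<n. \<exists>k r. f i \<in> step_poly \<Psi> k \<and> hom_polynomial r (p i) \<and> k + int r \<le> q) \<and>
           h = (\<lambda>s. \<Sum>i<(n::nat). f i s * p i s)}"

definition tensor ::
    "('a::euclidean_space \<Rightarrow> real) set \<Rightarrow> ('a cdual \<Rightarrow> complex) set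
       \<Rightarrow> ('a \<Rightarrow> 'a cdual \<Rightarrow> complex) set" where
  "tensor A B =
     {F. \<exists>n f g. (\<forall>i<n. f i \<in> A \<and> g i \<in> B) \<and>
           F = (\<lambda>s \<xi>. \<Sum>i<(n::nat). of_real (f i s) * g i \<xi>)}"

definition coset_integral ::
    "'a::euclidean_space set \<Rightarrow> 'a set \<Rightarrow> 'a set \<Rightarrow> 'a cdual \<Rightarrow> 'a set \<Rightarrow> complex" where
  "coset_integral \<Lambda> L p \<xi> C = (LINT x:(p \<inter> C)|coset_measure \<Lambda> L C. exp (blinfun_apply \<xi> x))"

definition intermediate_sum ::
    "'a::euclidean_space set \<Rightarrow> 'a set \<Rightarrow> 'a set \<Rightarrow> 'a cdual \<Rightarrow> complex" where
  "intermediate_sum \<Lambda> L p \<xi> = (\<Sum>\<^sub>\<infinity>C\<in>quot_lattice \<Lambda> L. coset_integral \<Lambda> L p \<xi> C)"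

text \<open>Convergence is absolute convergence of the combined sum and integral.\<close>

definition intermediate_sum_converges ::
    "'a::euclidean_space set \<Rightarrow> 'a set \<Rightarrow> 'a set \<Rightarrow> 'a cdual \<Rightarrow> bool" where
  "intermediate_sum_converges \<Lambda> L p \<xi> \<longleftrightarrow>
     (\<forall>C\<in>quot_lattice \<Lambda> L.
        set_integrable (coset_measure \<Lambda> L C) (p \<inter> C) (\<lambda>x. exp (blinfun_apply \<xi> x))) \<and>
     (\<lambda>C. LINT x:(p \<inter> C)|coset_measure \<Lambda> L C. norm (exp (blinfun_apply \<xi> x)))
        summable_on quot_lattice \<Lambda> L"

text \<open>
  The characterizing properties of the valuation \<open>S\<^sup>L\<close>, which determine \<open>S p\<close> up to
  \<^const>\<open>mero_eq\<close> for every semi-rational polyhedron \<open>p\<close>. Other sets \<open>p\<close> are irrelevant.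
\<close>

definition intermediate_generating_function ::
    "'a::euclidean_space set \<Rightarrow> 'a set \<Rightarrow> ('a set \<Rightarrow> 'a cdual \<Rightarrow> complex) \<Rightarrow> bool" where
  "intermediate_generating_function \<Lambda> L S \<longleftrightarrow>
     (\<forall>p. semi_rational_polyhedron \<Lambda> p \<longrightarrow> S p \<in> mero_linear_poles) \<and>
     (\<forall>P a. finite P \<and> (\<forall>p\<in>P. semi_rational_polyhedron \<Lambda> p) \<and>
            (\<forall>x. (\<Sum>p\<in>P. a p * indicator p x) = (0::real)) \<longrightarrow>
        mero_eq (\<lambda>\<xi>. \<Sum>p\<in>P. of_real (a p) * S p \<xi>) (\<lambda>_. 0)) \<and>
     (\<forall>p. semi_rational_polyhedron \<Lambda> p \<and> contains_line p \<longrightarrow> mero_eq (S p) (\<lambda>_. 0)) \<and>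
     (\<forall>p. semi_rational_polyhedron \<Lambda> p \<longrightarrow>
        mero_eq (S p) (\<lambda>\<xi>. if intermediate_sum_converges \<Lambda> L p \<xi>
                            then intermediate_sum \<Lambda> L p \<xi> else S p \<xi>))"

definition shift :: "'a::euclidean_space \<Rightarrow> 'a set \<Rightarrow> 'a set" where
  "shift s K = (\<lambda>x. s + x) ` K"

definition M_fun ::
    "('a::euclidean_space set \<Rightarrow> 'a cdual \<Rightarrow> complex) \<Rightarrow> 'a \<Rightarrow> 'a set \<Rightarrow> 'a cdual \<Rightarrow> complex" where
  "M_fun S s K \<xi> = exp (- blinfun_apply \<xi> s) * S (shift s K) \<xi>"

text \<open>
  The sign: for the unimodular cone generated by the basis \<open>v\<^sub>j\<close>, with dual basis \<open>\<eta>\<^sub>j\<close>, the points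
  of the lattice in the shifted cone start at \<open>\<Sum>\<^sub>j \<lceil>\<langle>\<eta>\<^sub>j, s\<rangle>\<rceil> v\<^sub>j\<close>, so what enters the formulas is
  \<open>\<lceil>t\<rceil> - t = {-t}\<close> for \<open>t = \<langle>\<eta>\<^sub>j, s\<rangle>\<close>. Since \<open>{-t}\<close> is not a polynomial in \<open>{t}\<close>, the covectors
  must be the outer normals \<open>-\<eta>\<^sub>j\<close> of the cone.
\<close>

definition cone_covectors ::
    "'a::euclidean_space set \<Rightarrow> 'a set \<Rightarrow> 'a set \<Rightarrow> ('a \<Rightarrow>\<^sub>L real) set" where
  "cone_covectors \<Lambda> L B =
     {- \<eta> | \<eta>. \<eta> \<in> dual_lattice \<Lambda> \<inter> annihilator L \<and>
            (\<exists>v\<in>B. \<forall>w\<in>B. blinfun_apply \<eta> w = (if w = v then 1 else 0))}"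

text \<open>
  \<open>K i\<close> are the simplicial cones in the decomposition of \<open>c\<close>; \<open>B i j\<close> are the (representatives of
  the) primitive edge generators of the unimodular cones in the decomposition of the projection
  of \<open>K i\<close>.
\<close>

definition constructed_covectors ::
    "'a::euclidean_space set \<Rightarrow> 'a set \<Rightarrow> 'a set \<Rightarrow> ('a \<Rightarrow>\<^sub>L real) set \<Rightarrow> bool" where
  "constructed_covectors \<Lambda> L c \<Psi> \<longleftrightarrow>
     (\<exists>(n::nat) \<epsilon> K (N::nat \<Rightarrow> nat) \<delta> B.
        (\<forall>i<n. \<epsilon> i \<in> {1, -1} \<and> simplicial_full_cone \<Lambda> (K i) \<and>
               (\<exists>F. F face_of K i \<and> span F = L)) \<and>
        cong_mod_indicators {Z. rational_cone \<Lambda> Z \<and> contains_line Z}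
          (indicator c) (\<lambda>x. \<Sum>i<n. \<epsilon> i * indicator (K i) x) \<and>
        (\<forall>i<n.
           (\<forall>j<N i. \<delta> i j \<in> {1, -1} \<and> quot_lattice_basis \<Lambda> L (B i j)) \<and>
           cong_mod_indicators {Z. quot_rational_cone \<Lambda> L Z \<and> quot_contains_line L Z}
             (indicator (qproj L ` K i))
             (\<lambda>x. \<Sum>j<N i. \<delta> i j * indicator (qproj L ` (convex_cone hull B i j)) x)) \<and>
        \<Psi> = (\<Union>i<n. \<Union>j<N i. cone_covectors \<Lambda> L (B i j)))"

end

theory Submission
  imports Defs
begin

text \<open>
  Modulo cones with lines, \<open>c\<close> decomposes into cones \<open>K\<close> spanned by generators \<open>u\<^sub>b\<close> (\<open>b \<in> A\<close>) of
  a basis of \<open>L\<close> and by lifts \<open>u\<^sub>v\<close> (\<open>v \<in> B\<close>) of a basis of \<open>\<Lambda>\<^bsub>V/L\<^esub>\<close>: project the unimodular cones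
  back along \<open>L\<close> into the span of the remaining generators of the simplicial cone. Where
  \<open>Re \<langle>\<xi>, u\<^sub>j\<rangle> < 0\<close> for all \<open>j\<close>, the intermediate sum over \<open>s + K\<close> is a product of elementary
  integrals and geometric series, and the identity theorem on complex lines extends this to
  \[ M^L(s, K)(\xi) = \kappa \prod_{b \in A} \frac{-1}{\langle\xi, u_b\rangle}
     \prod_{v \in B} \frac{e^{\{-\langle\zeta_v, s\rangle\} \langle\xi, u_v\rangle}}{1 - e^{\langle\xi, u_v\rangle}}. \]
  All assertions can be read off from the Laurent expansion of this product along \<open>\<tau> \<mapsto> \<tau> \<xi>\<close>. The
  lowest component is the integral over \<open>K\<close> because the normalisation \<open>\<kappa>\<close> is the same for \<open>L\<close> and
  for the whole space.
\<close>

section \<open>Measures in coordinates\<close>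

text \<open>The decomposition data live in two spaces: the \<open>K i\<close> are cones in V, but
  their refinement is a relation between cones in V/L, while the valuation accepts only polyhedra in
  V. The relation lifts because all pieces of one \<open>K i\<close> keep the same functionals on
  \<open>A\<close>, so that it can be multiplied by the indicator of one common set. Fractional
  parts arise only where a summation starts at an integer: the factor exp(-<\<xi>,s>) cancels the
  start of every half-line integral along L, but in each geometric series it leaves the gap between
  a coordinate of \<open>s\<close> and its ceiling. In the expansion these gaps come with powers of
  linear forms, so the coefficient of \<tau>^n involves at most n of them; the d simple poles turn n
  into m + d. Meromorphic functions are represented by total functions known off finitely many
  hyperplanes, whereas a homogeneous component is read off along one complex line. The hyperplanes
  pass through 0, so a line contained in none of them meets them only at 0. The measure on L comes
  from a basis picked by choice, so \<kappa> is known only as a density; its comparison with the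
  full volume therefore requires independence of the lattice basis.\<close>

definition cell_measure :: "'i set \<Rightarrow> ('i \<Rightarrow> 'a::euclidean_space) \<Rightarrow> 'a measure" where
  "cell_measure I u = distr (Pi\<^sub>M I (\<lambda>_. lborel)) borel (\<lambda>a. \<Sum>i\<in>I. a i *\<^sub>R u i)"

lemma sets_cell_measure [measurable_cong, simp]:
  "sets (cell_measure I u) = sets borel"
  by (simp add: cell_measure_def)

lemma space_cell_measure [simp]: "space (cell_measure I u) = UNIV"
  by (simp add: cell_measure_def)

lemma measurable_linear_combination [measurable]:
  "(\<lambda>a. \<Sum>i\<in>I. a i *\<^sub>R (u i :: 'a::euclidean_space)) \<in> borel_measurable (Pi\<^sub>M I (\<lambda>_. lborel))"
  by measurable

interpretation lborel_product: product_sigma_finite "\<lambda>_::'i. lborel :: real measure"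
  by standard

lemma nn_integral_cell:
  assumes [measurable]: "f \<in> borel_measurable borel"
  shows "(\<integral>\<^sup>+x. f x \<partial>cell_measure I u) =
           (\<integral>\<^sup>+a. f (\<Sum>i\<in>I. a i *\<^sub>R u i) \<partial>Pi\<^sub>M I (\<lambda>_. lborel))"
  unfolding cell_measure_def by (subst nn_integral_distr) auto

lemma sigma_finite_PiM_lborel:
  "finite I \<Longrightarrow> sigma_finite_measure (Pi\<^sub>M I (\<lambda>_. lborel :: real measure))"
  by (rule lborel_product.sigma_finite)

lemma nn_integral_cell_insert:
  fixes u :: "'i \<Rightarrow> 'a::euclidean_space"
  assumes "finite I" "i \<notin> I" and [measurable]: "f \<in> borel_measurable borel"
  shows "(\<integral>\<^sup>+x. f x \<partial>cell_measure (insert i I) u) =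
           (\<integral>\<^sup>+t. (\<integral>\<^sup>+x. f (t *\<^sub>R u i + x) \<partial>cell_measure I u) \<partial>lborel)"
proof -
  have "(\<integral>\<^sup>+x. f x \<partial>cell_measure (insert i I) u) =
      (\<integral>\<^sup>+t. (\<integral>\<^sup>+a. f (\<Sum>j\<in>insert i I. (a(i := t)) j *\<^sub>R u j) \<partial>Pi\<^sub>M I (\<lambda>_. lborel)) \<partial>lborel)"
    by (subst nn_integral_cell, simp,
        subst lborel_product.product_nn_integral_insert_rev) (use assms in measurable)
  also have "\<dots> = (\<integral>\<^sup>+t. (\<integral>\<^sup>+a. f (t *\<^sub>R u i + (\<Sum>j\<in>I. a j *\<^sub>R u j)) \<partial>Pi\<^sub>M I (\<lambda>_. lborel)) \<partial>lborel)"
  proof -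
    have "(\<Sum>j\<in>I. (a(i := t)) j *\<^sub>R u j) = (\<Sum>j\<in>I. a j *\<^sub>R u j)" for a t
      using \<open>i \<notin> I\<close> by (intro sum.cong) auto
    then show ?thesis
      using assms(1,2) by simp
  qed
  also have "\<dots> = (\<integral>\<^sup>+t. (\<integral>\<^sup>+x. f (t *\<^sub>R u i + x) \<partial>cell_measure I u) \<partial>lborel)"
    by (subst nn_integral_cell) auto
  finally show ?thesis .
qed

text \<open>Split \<open>w\<close> into a multiple of \<open>u i\<close> and a vector in the span of
  the remaining family. The latter is absorbed by the induction hypothesis for each fixed
  \<open>t\<close>, the former by translation invariance on the real line; hence \<open>w\<close>
  and \<open>f\<close> vary in the induction.\<close>

lemma nn_integral_cell_translate:
  fixes u :: "'i \<Rightarrow> 'a::euclidean_space"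
  assumes "finite I" "w \<in> span (u ` I)" and "f \<in> borel_measurable borel"
  shows "(\<integral>\<^sup>+x. f (w + x) \<partial>cell_measure I u) = (\<integral>\<^sup>+x. f x \<partial>cell_measure I u)"
  using assms
proof (induction I arbitrary: w f rule: finite_induct)
  case empty
  then show ?case by simp
next
  case (insert i I)
  note [measurable] = insert.prems(2)
  obtain k where k: "w - k *\<^sub>R u i \<in> span (u ` I)"
    using insert.prems(1) by (auto simp: span_breakdown_eq)
  define w' where "w' = w - k *\<^sub>R u i"
  have "(\<integral>\<^sup>+x. f (w + x) \<partial>cell_measure (insert i I) u) =
      (\<integral>\<^sup>+t. (\<integral>\<^sup>+x. f (w + (t *\<^sub>R u i + x)) \<partial>cell_measure I u) \<partial>lborel)"
    by (rule nn_integral_cell_insert) (use insert in auto)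
  also have "\<dots> = (\<integral>\<^sup>+t. (\<integral>\<^sup>+x. f ((k + 1 * t) *\<^sub>R u i + (w' + x)) \<partial>cell_measure I u) \<partial>lborel)"
    by (simp add: w'_def algebra_simps)
  also have "\<dots> = (\<integral>\<^sup>+t. (\<integral>\<^sup>+x. f ((k + 1 * t) *\<^sub>R u i + x) \<partial>cell_measure I u) \<partial>lborel)"
    by (rule nn_integral_cong, rule insert.IH) (use k in \<open>auto simp: w'_def\<close>)
  also have "\<dots> = (\<integral>\<^sup>+t. (\<integral>\<^sup>+x. f (t *\<^sub>R u i + x) \<partial>cell_measure I u) \<partial>lborel)"
  proof -
    have [measurable]: "(\<lambda>t. \<integral>\<^sup>+x. f (t *\<^sub>R u i + x) \<partial>cell_measure I u) \<in> borel_measurable borel"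
    proof -
      interpret sigma_finite_measure "Pi\<^sub>M I (\<lambda>_. lborel :: real measure)"
        by (rule sigma_finite_PiM_lborel) fact
      show ?thesis
        by (subst nn_integral_cell) measurable
    qed
    show ?thesis
      by (subst nn_integral_real_affine[where c = 1 and t = k]) auto
  qed
  also have "\<dots> = (\<integral>\<^sup>+x. f x \<partial>cell_measure (insert i I) u)"
    by (rule nn_integral_cell_insert[symmetric]) (use insert in auto)
  finally show ?case .
qed

lemma measurable_nn_integral_cell:
  fixes u :: "'i \<Rightarrow> 'a::euclidean_space"
  assumes "finite I" and [measurable]: "f \<in> borel_measurable borel" "g \<in> borel_measurable M"
  shows "(\<lambda>y. \<integral>\<^sup>+x. f (x + g y) \<partial>cell_measure I u) \<in> borel_measurable M"
proof -
  interpret sigma_finite_measure "Pi\<^sub>M I (\<lambda>_. lborel :: real measure)"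
    by (rule sigma_finite_PiM_lborel) fact
  show ?thesis
    by (subst nn_integral_cell) measurable
qed

lemma nn_integral_cell_Un:
  fixes u :: "'i \<Rightarrow> 'a::euclidean_space"
  assumes "finite I" "finite J" "I \<inter> J = {}" "f \<in> borel_measurable borel"
  shows "(\<integral>\<^sup>+x. f x \<partial>cell_measure (I \<union> J) u) =
           (\<integral>\<^sup>+y. (\<integral>\<^sup>+x. f (x + y) \<partial>cell_measure I u) \<partial>cell_measure J u)"
  using assms(2,3,4)
proof (induction J arbitrary: f rule: finite_induct)
  case empty
  have "(\<integral>\<^sup>+y. (\<integral>\<^sup>+x. f (x + y) \<partial>cell_measure I u) \<partial>cell_measure {} u)
     = (\<integral>\<^sup>+x. f x \<partial>cell_measure I u)"
    using measurable_nn_integral_cell[OF assms(1) empty(2), of "\<lambda>x. x" borel]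
    by (subst nn_integral_cell)
       (auto simp: lborel_product.nn_integral_empty emeasure_PiM_empty space_PiM)
  then show ?case by simp
next
  case (insert j J)
  note [measurable] = insert.prems(2)
  have "(\<integral>\<^sup>+x. f x \<partial>cell_measure (I \<union> insert j J) u) =
    (\<integral>\<^sup>+t. (\<integral>\<^sup>+x. f (t *\<^sub>R u j + x) \<partial>cell_measure (I \<union> J) u) \<partial>lborel)"
    using nn_integral_cell_insert[of "I \<union> J" j f u] insert assms(1) by auto
  also have "\<dots> = (\<integral>\<^sup>+t. (\<integral>\<^sup>+y. (\<integral>\<^sup>+x. f (t *\<^sub>R u j + (x + y)) \<partial>cell_measure I u)
       \<partial>cell_measure J u) \<partial>lborel)"
    by (rule nn_integral_cong, rule insert.IH) (use insert in auto)
  also have "\<dots> = (\<integral>\<^sup>+t. (\<integral>\<^sup>+y. (\<integral>\<^sup>+x. f (x + (t *\<^sub>R u j + y)) \<partial>cell_measure I u)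
       \<partial>cell_measure J u) \<partial>lborel)"
    by (simp add: algebra_simps)
  also have "\<dots> = (\<integral>\<^sup>+y. (\<integral>\<^sup>+x. f (x + y) \<partial>cell_measure I u) \<partial>cell_measure (insert j J) u)"
    using measurable_nn_integral_cell[OF assms(1) insert.prems(2), of "\<lambda>x. x" borel] insert
    by (subst nn_integral_cell_insert) auto
  finally show ?case .
qed

text \<open>In coordinates with \<open>v\<close>, the summand \<open>t *\<^sub>R w\<close> lies in
  the span of \<open>A\<close> and disappears by translation invariance. What remains is the
  substitution of \<open>c * t\<close> for \<open>t\<close>, whose Jacobian is the density.\<close>

lemma cell_measure_exchange:
  fixes A :: "'a::euclidean_space set"
  assumes "finite A" "b \<notin> A" "v \<notin> A" "w \<in> span A" "v = c *\<^sub>R b + w" "c \<noteq> 0"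
  shows "cell_measure (insert b A) (\<lambda>x. x) =
         density (cell_measure (insert v A) (\<lambda>x. x)) (\<lambda>_. ennreal \<bar>c\<bar>)"
proof -
  have main: "(\<integral>\<^sup>+x. f x \<partial>cell_measure (insert b A) (\<lambda>x. x)) =
      \<bar>c\<bar> * (\<integral>\<^sup>+x. f x \<partial>cell_measure (insert v A) (\<lambda>x. x))"
    if [measurable]: "f \<in> borel_measurable borel" for f
  proof -
    define h where "h t = (\<integral>\<^sup>+x. f (t *\<^sub>R b + x) \<partial>cell_measure A (\<lambda>x. x))" for t
    have [measurable]: "h \<in> borel_measurable borel"
      using measurable_nn_integral_cell[OF assms(1) that, of "\<lambda>t. t *\<^sub>R b" borel]
      by (simp add: h_def[abs_def] add.commute)
    have "(\<integral>\<^sup>+x. f x \<partial>cell_measure (insert v A) (\<lambda>x. x)) =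
      (\<integral>\<^sup>+t. (\<integral>\<^sup>+x. f (t *\<^sub>R v + x) \<partial>cell_measure A (\<lambda>x. x)) \<partial>lborel)"
      using assms by (intro nn_integral_cell_insert) auto
    also have "\<dots> = (\<integral>\<^sup>+t. (\<integral>\<^sup>+x. f ((t * c) *\<^sub>R b + (t *\<^sub>R w + x)) \<partial>cell_measure A (\<lambda>x. x)) \<partial>lborel)"
      by (simp add: assms(5) algebra_simps)
    also have "\<dots> = (\<integral>\<^sup>+t. h (0 + c * t) \<partial>lborel)"
      unfolding h_def
      by (rule nn_integral_cong, subst nn_integral_cell_translate
           [where f = "\<lambda>x. f (_ + x)"]) (use assms in \<open>auto intro: span_scale simp: mult.commute\<close>)
    finally have "\<bar>c\<bar> * (\<integral>\<^sup>+x. f x \<partial>cell_measure (insert v A) (\<lambda>x. x)) =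
      (\<integral>\<^sup>+t. h t \<partial>lborel)"
      using nn_integral_real_affine[of h c 0] assms by simp
    also have "\<dots> = (\<integral>\<^sup>+x. f x \<partial>cell_measure (insert b A) (\<lambda>x. x))"
      unfolding h_def using assms by (intro nn_integral_cell_insert[symmetric]) auto
    finally show ?thesis ..
  qed
  show ?thesis
  proof (rule measure_eqI)
    fix X assume "X \<in> sets (cell_measure (insert b A) (\<lambda>x. x))"
    then show "emeasure (cell_measure (insert b A) (\<lambda>x. x)) X =
      emeasure (density (cell_measure (insert v A) (\<lambda>x. x)) (\<lambda>_. ennreal \<bar>c\<bar>)) X"
      using main[of "indicator X"] by (simp add: emeasure_density nn_integral_cmult_indicator)
  qed simp
qed

text \<open>Steinitz exchange brings the vectors of \<open>B\<close> into \<open>A\<close> one at a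
  time, and each exchange multiplies the density by the absolute value of one coefficient. This
  gives the change-of-basis factor without determinants, also inside a proper subspace.\<close>

lemma cell_measure_proportional:
  fixes A B :: "'a::euclidean_space set"
  assumes "independent A" "independent B" "span A = span B"
  shows "\<exists>\<kappa>>0. cell_measure A (\<lambda>x. x) =
           density (cell_measure B (\<lambda>x. x)) (\<lambda>_. ennreal \<kappa>)"
  using assms
proof (induction "card (B - A)" arbitrary: A)
  case 0
  have "finite A" "finite B" using 0 by (auto intro: independent_imp_finite)
  then have "B \<subseteq> A" using 0 by auto
  have "A \<subseteq> B"
  proof
    fix x assume x: "x \<in> A"
    show "x \<in> B"
    proof (rule ccontr)
      assume "x \<notin> B"
      then have "span B \<subseteq> span (A - {x})" using \<open>B \<subseteq> A\<close> by (intro span_mono) auto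
      then show False using x 0(2,4) span_base[OF x] by (auto simp: dependent_def)
    qed
  qed
  then have "A = B" using \<open>B \<subseteq> A\<close> by auto
  then show ?case by (intro exI[of _ 1]) (auto simp: density_1)
next
  case (Suc n)
  have fin: "finite A" "finite B" using Suc by (auto intro: independent_imp_finite)
  obtain v where v: "v \<in> B" "v \<notin> A"
    using Suc(2) by (metis Diff_iff card.empty ex_in_conv nat.distinct(1))
  have "v \<in> span A" using v Suc by (simp add: span_base)
  then obtain k where k: "v = (\<Sum>a\<in>A. k a *\<^sub>R a)"
    using fin(1) by (auto simp: span_finite)
  \<comment> \<open>If only vectors of \<open>A \<inter> B\<close> occurred, \<open>v\<close> would
    be a combination of other elements of \<open>B\<close>. That the partner lies outside
    \<open>B\<close> guarantees that the exchange lowers \<open>card (B - A)\<close>.\<close>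
  have "\<exists>b\<in>A - B. k b \<noteq> 0"
  proof (rule ccontr)
    assume "\<not> ?thesis"
    then have "v = (\<Sum>a\<in>A \<inter> B. k a *\<^sub>R a)"
      unfolding k using fin by (intro sum.mono_neutral_right) auto
    also have "\<dots> \<in> span (B - {v})"
      using v by (intro span_sum span_scale span_base) auto
    finally show False using v Suc(4) by (auto simp: dependent_def)
  qed
  then obtain b where b: "b \<in> A" "b \<notin> B" "k b \<noteq> 0" by auto
  define A0 where "A0 = A - {b}"
  define w where "w = (\<Sum>a\<in>A0. k a *\<^sub>R a)"
  have vw: "v = k b *\<^sub>R b + w" unfolding k w_def A0_def
    using fin b by (simp add: sum.remove)
  have w: "w \<in> span A0" unfolding w_def by (intro span_sum span_scale span_base)
  have A: "A = insert b A0" "b \<notin> A0" using b by (auto simp: A0_def)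
  have vA0: "v \<notin> A0" using v A by auto
  have ind: "independent A0" using Suc(3) by (rule independent_mono) (auto simp: A0_def)
  have bs: "b \<notin> span A0" using Suc(3) b unfolding dependent_def A0_def by auto
  have vs: "v \<notin> span A0"
  proof
    assume "v \<in> span A0"
    then have "k b *\<^sub>R b \<in> span A0" using vw w by (metis add_diff_cancel_right' span_diff)
    then have "(1 / k b) *\<^sub>R (k b *\<^sub>R b) \<in> span A0" by (rule span_scale)
    then show False using bs b(3) by simp
  qed
  have "independent (insert v A0)" using ind vs by (simp add: independent_insert)
  moreover have "span (insert v A0) = span A"
  proof
    show "span (insert v A0) \<subseteq> span A"
      using \<open>v \<in> span A\<close> A by (intro span_minimal) (auto intro: span_base)
    have "b = (1 / k b) *\<^sub>R (v - w)" using vw b(3) by simp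
    also have "\<dots> \<in> span (insert v A0)"
      using w span_mono[of A0 "insert v A0"] by (intro span_scale span_diff) (auto intro: span_base)
    finally show "span A \<subseteq> span (insert v A0)"
      using A by (intro span_minimal) (auto intro: span_base)
  qed
  moreover have "card (B - insert v A0) = n"
  proof -
    have "B - A = insert v (B - insert v A0)" using A b v by auto
    then show ?thesis using Suc(2) fin by auto
  qed
  ultimately obtain \<kappa> where \<kappa>: "\<kappa> > 0" "cell_measure (insert v A0) (\<lambda>x. x) =
           density (cell_measure B (\<lambda>x. x)) (\<lambda>_. ennreal \<kappa>)"
    using Suc(1)[of "insert v A0"] Suc(4,5) by auto
  have "cell_measure A (\<lambda>x. x) =
    density (cell_measure (insert v A0) (\<lambda>x. x)) (\<lambda>_. ennreal \<bar>k b\<bar>)"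
    unfolding A by (rule cell_measure_exchange) (use fin A vA0 w vw b in auto)
  also have "\<dots> = density (cell_measure B (\<lambda>x. x)) (\<lambda>_. ennreal (\<kappa> * \<bar>k b\<bar>))"
    unfolding \<kappa> using \<kappa>(1) by (subst density_density_eq) (auto simp: ennreal_mult)
  finally show ?case using \<kappa> b by (intro exI[of _ "\<kappa> * \<bar>k b\<bar>"]) auto
qed

section \<open>Dual bases and lattices\<close>

text \<open>Biorthogonality together with the expansion of every vector makes \<open>u\<close> a
  basis of the whole space, injectively labelled by \<open>J\<close>. Labels are kept apart from
  vectors because a representative of a quotient generator will label a different vector of its
  coset.\<close>

definition dual_family :: "'i set \<Rightarrow> ('i \<Rightarrow> 'a::euclidean_space) \<Rightarrow> ('i \<Rightarrow> 'a \<Rightarrow>\<^sub>L real) \<Rightarrow> bool" where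
  "dual_family J u \<zeta> \<longleftrightarrow> finite J \<and>
     (\<forall>i\<in>J. \<forall>j\<in>J. \<zeta> i (u j) = (if i = j then 1 else 0)) \<and>
     (\<forall>x. x = (\<Sum>j\<in>J. \<zeta> j x *\<^sub>R u j))"

lemma dual_family_finite: "dual_family J u \<zeta> \<Longrightarrow> finite J"
  and dual_family_apply:
    "dual_family J u \<zeta> \<Longrightarrow> i \<in> J \<Longrightarrow> j \<in> J \<Longrightarrow> \<zeta> i (u j) = (if i = j then 1 else 0)"
  and dual_family_expand: "dual_family J u \<zeta> \<Longrightarrow> (\<Sum>j\<in>J. \<zeta> j x *\<^sub>R u j) = x"
  by (auto simp: dual_family_def)

lemma blinfun_sum_right: "blinfun_apply f (\<Sum>i\<in>I. g i) = (\<Sum>i\<in>I. blinfun_apply f (g i))"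
  by (induction I rule: infinite_finite_induct) (auto simp: blinfun.add_right blinfun.zero_right)

lemma dual_family_coeff:
  assumes "dual_family J u \<zeta>" "I \<subseteq> J" "i \<in> J"
  shows "\<zeta> i (\<Sum>j\<in>I. a j *\<^sub>R u j) = (if i \<in> I then a i else 0)"
proof -
  have fin: "finite I" using assms dual_family_finite finite_subset by blast
  have "\<zeta> i (\<Sum>j\<in>I. a j *\<^sub>R u j) = (\<Sum>j\<in>I. a j * (if i = j then 1 else 0))"
    unfolding blinfun_sum_right blinfun.scaleR_right
    using assms by (intro sum.cong) (auto simp: dual_family_apply subset_iff)
  also have "\<dots> = (\<Sum>j\<in>I. if i = j then a j else 0)"
    by (intro sum.cong) auto
  also have "\<dots> = (if i \<in> I then a i else 0)"
    using fin by (simp add: sum.delta)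
  finally show ?thesis .
qed

lemma dual_family_exists:
  fixes G :: "'a::euclidean_space set"
  assumes "independent G" "span G = UNIV"
  shows "\<exists>\<zeta>. dual_family G (\<lambda>x. x) \<zeta>"
proof -
  have fin: "finite G" using assms by (simp add: independent_imp_finite)
  have lin: "bounded_linear (\<lambda>x. representation G x b)" for b
    unfolding linear_conv_bounded_linear[symmetric]
    using assms by (intro linearI) (auto simp: representation_add representation_scale)
  define \<zeta> where "\<zeta> b = Blinfun (\<lambda>x. representation G x b)" for b
  have ap: "\<zeta> b x = representation G x b" for b x
    unfolding \<zeta>_def by (simp add: bounded_linear_Blinfun_apply[OF lin])
  have "dual_family G (\<lambda>x. x) \<zeta>"
    unfolding dual_family_def ap
    using assms fin by (auto simp: representation_basis sum_representation_eq)
  then show ?thesis by blast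
qed

lemma dual_family_vanishes:
  assumes "dual_family J u \<zeta>" "I \<subseteq> J" "i \<in> J - I" "x \<in> span (u ` I)"
  shows "\<zeta> i x = 0"
proof -
  have "span (u ` I) \<subseteq> {x. \<zeta> i x = 0}"
    using assms
    by (intro span_minimal subspaceI)
       (auto simp: dual_family_apply[OF assms(1)] subset_iff blinfun.zero_right blinfun.add_right
          blinfun.scaleR_right)
  then show ?thesis using assms(4) by blast
qed

text \<open>The origin of the exponent d: every label will contribute one simple pole along a
  generic line.\<close>

lemma dual_family_card:
  fixes u :: "'i \<Rightarrow> 'a::euclidean_space"
  assumes "dual_family J u \<zeta>"
  shows "card J = DIM('a)"
proof -
  have inj: "inj_on u J"
  proof (rule inj_onI)
    fix i j assume "i \<in> J" "j \<in> J" "u i = u j"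
    then show "i = j" using dual_family_apply[OF assms, of i i] dual_family_apply[OF assms, of i j]
      by (auto split: if_splits)
  qed
  have fin: "finite J" using assms by (rule dual_family_finite)
  have "independent (u ` J)"
  proof (rule independent_if_scalars_zero)
    show "finite (u ` J)" using fin by simp
    fix f x assume 0: "(\<Sum>x\<in>u ` J. f x *\<^sub>R x) = 0" and x: "x \<in> u ` J"
    then obtain i where i: "i \<in> J" "x = u i" by auto
    have "(\<Sum>j\<in>J. f (u j) *\<^sub>R u j) = 0" using 0 inj by (simp add: sum.reindex)
    then have "\<zeta> i (\<Sum>j\<in>J. f (u j) *\<^sub>R u j) = 0" by (simp add: blinfun.zero_right)
    then show "f x = 0" using dual_family_coeff[OF assms, of J i] i by simp
  qed
  moreover have "span (u ` J) = UNIV"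
  proof -
    have "x \<in> span (u ` J)" for x
      by (subst dual_family_expand[OF assms, of x, symmetric])
         (intro span_sum span_scale span_base imageI)
    then show ?thesis by auto
  qed
  ultimately have "card (u ` J) = DIM('a)"
    by (metis dim_UNIV dim_eq_card_independent dim_span)
  then show ?thesis using card_image[OF inj] by simp
qed

section \<open>Lattices given by a basis\<close>

lemma lattice_basis_memI:
  assumes "lattice_basis \<Gamma> W G" "x = (\<Sum>b\<in>G. of_int (k b) *\<^sub>R b)"
  shows "x \<in> \<Gamma>"
  using assms by (auto simp: lattice_basis_def)

lemma lattice_basis_mem_iff:
  assumes "lattice_basis \<Gamma> UNIV G" "dual_family G (\<lambda>x. x) \<zeta>"
  shows "x \<in> \<Gamma> \<longleftrightarrow> (\<forall>b\<in>G. \<zeta> b x \<in> \<int>)"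
proof
  assume "x \<in> \<Gamma>"
  then obtain k where "x = (\<Sum>b\<in>G. of_int (k b) *\<^sub>R b)" using assms(1) by (auto simp: lattice_basis_def)
  then show "\<forall>b\<in>G. \<zeta> b x \<in> \<int>"
    using dual_family_coeff[OF assms(2), of G] by auto
next
  assume *: "\<forall>b\<in>G. \<zeta> b x \<in> \<int>"
  have "x = (\<Sum>b\<in>G. of_int \<lfloor>\<zeta> b x\<rfloor> *\<^sub>R b)"
    by (subst dual_family_expand[OF assms(2), of x, symmetric], intro sum.cong)
       (use * in \<open>auto elim!: Ints_cases\<close>)
  then show "x \<in> \<Gamma>" by (rule lattice_basis_memI[OF assms(1)])
qed

lemma lattice_basis_add:
  assumes "lattice_basis \<Gamma> W G" "x \<in> \<Gamma>" "y \<in> \<Gamma>"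
  shows "x + y \<in> \<Gamma>"
proof -
  obtain k l where "x = (\<Sum>b\<in>G. of_int (k b) *\<^sub>R b)" "y = (\<Sum>b\<in>G. of_int (l b) *\<^sub>R b)"
    using assms by (auto simp: lattice_basis_def)
  then have "x + y = (\<Sum>b\<in>G. of_int (k b + l b) *\<^sub>R b)"
    by (simp add: sum.distrib scaleR_add_left)
  then show ?thesis by (rule lattice_basis_memI[OF assms(1)])
qed

lemma lattice_basis_int_scale:
  assumes "lattice_basis \<Gamma> W G" "x \<in> \<Gamma>"
  shows "of_int n *\<^sub>R x \<in> \<Gamma>"
proof -
  obtain k where "x = (\<Sum>b\<in>G. of_int (k b) *\<^sub>R b)"
    using assms by (auto simp: lattice_basis_def)
  then have "of_int n *\<^sub>R x = (\<Sum>b\<in>G. of_int (n * k b) *\<^sub>R b)"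
    by (simp add: scaleR_sum_right)
  then show ?thesis by (rule lattice_basis_memI[OF assms(1)])
qed

lemma lattice_basis_minus:
  assumes "lattice_basis \<Gamma> W G" "x \<in> \<Gamma>"
  shows "- x \<in> \<Gamma>"
  using lattice_basis_int_scale[OF assms, of "-1"] by simp

lemma lattice_basis_diff:
  assumes "lattice_basis \<Gamma> W G" "x \<in> \<Gamma>" "y \<in> \<Gamma>"
  shows "x - y \<in> \<Gamma>"
  using lattice_basis_add[OF assms(1,2) lattice_basis_minus[OF assms(1,3)]] by simp

lemma lattice_basis_zero:
  assumes "lattice_basis \<Gamma> W G"
  shows "0 \<in> \<Gamma>"
proof -
  have "0 = (\<Sum>b\<in>G. of_int ((\<lambda>_. 0) b) *\<^sub>R b)" by simp
  then show ?thesis by (rule lattice_basis_memI[OF assms])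
qed

lemma lattice_basis_sum:
  assumes "lattice_basis \<Gamma> W G" "\<And>i. i \<in> I \<Longrightarrow> f i \<in> \<Gamma>"
  shows "(\<Sum>i\<in>I. of_int (k i) *\<^sub>R f i) \<in> \<Gamma>"
  using assms(2)
  by (induction I rule: infinite_finite_induct)
     (auto intro!: lattice_basis_zero[OF assms(1)] lattice_basis_add[OF assms(1)]
        lattice_basis_int_scale[OF assms(1)])

lemma lattice_basis_subset:
  assumes "lattice_basis \<Gamma> W G"
  shows "G \<subseteq> \<Gamma>"
proof
  fix x assume x: "x \<in> G"
  have "finite G" using assms by (auto simp: lattice_basis_def intro: independent_imp_finite)
  then have "(\<Sum>b\<in>G. of_int (if b = x then 1 else 0) *\<^sub>R b) = (\<Sum>b\<in>G. if b = x then b else 0)"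
    by (intro sum.cong) auto
  also have "\<dots> = x" using x \<open>finite G\<close> by (simp add: sum.delta')
  finally show "x \<in> \<Gamma>"
    by (intro lattice_basis_memI[OF assms, of _ "\<lambda>b. if b = x then 1 else 0"]) (rule sym)
qed

text \<open>Allows an integral to be exchanged with a sum over the lattice when fundamental cells
  are compared.\<close>

lemma countable_lattice:
  assumes "lattice_basis \<Gamma> W G"
  shows "countable \<Gamma>"
proof -
  have fin: "finite G" using assms by (auto simp: lattice_basis_def intro: independent_imp_finite)
  have "\<Gamma> \<subseteq> (\<lambda>k. \<Sum>b\<in>G. of_int (k b) *\<^sub>R b) ` (PiE G (\<lambda>_. UNIV :: int set))"
  proof
    fix x assume "x \<in> \<Gamma>"
    then obtain k where "x = (\<Sum>b\<in>G. of_int (k b) *\<^sub>R b)" using assms by (auto simp: lattice_basis_def)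
    then have "x = (\<Sum>b\<in>G. of_int (restrict k G b) *\<^sub>R b)" by simp
    then show "x \<in> (\<lambda>k. \<Sum>b\<in>G. of_int (k b) *\<^sub>R b) ` (PiE G (\<lambda>_. UNIV :: int set))"
      by (intro image_eqI[of _ _ "restrict k G"]) auto
  qed
  moreover have "countable (PiE G (\<lambda>_. UNIV :: int set))"
    using fin by (intro countable_PiE) auto
  ultimately show ?thesis by (rule countable_subset[OF _ countable_image])
qed

text \<open>The half-open cells of both bases are fundamental domains of the same lattice, so by
  translation invariance they have the same volume for either measure.\<close>

lemma cell_measure_lattice_basis:
  fixes G1 G2 :: "'a::euclidean_space set"
  assumes "lattice_basis \<Gamma> UNIV G1" "lattice_basis \<Gamma> UNIV G2"
  shows "cell_measure G1 (\<lambda>x. x) = cell_measure G2 (\<lambda>x. x)"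
proof -
  note basis = assms[unfolded lattice_basis_def]
  obtain \<zeta>1 \<zeta>2 where \<zeta>1: "dual_family G1 (\<lambda>x. x) \<zeta>1" and \<zeta>2: "dual_family G2 (\<lambda>x. x) \<zeta>2"
    using dual_family_exists basis by metis
  define D where "D G \<zeta> = {x. \<forall>b\<in>G. 0 \<le> \<zeta> b x \<and> \<zeta> b x < 1}"
    for G and \<zeta> :: "'a \<Rightarrow> 'a \<Rightarrow>\<^sub>L real"
  define \<mu> where "\<mu> G = cell_measure G (\<lambda>x. x)" for G :: "'a set"
  have D_meas [measurable]: "D G \<zeta> \<in> sets borel" if "finite G" for G \<zeta>
  proof -
    have [measurable]: "blinfun_apply g \<in> borel_measurable borel" for g :: "'a \<Rightarrow>\<^sub>L real"
      by (intro borel_measurable_continuous_onI continuous_intros)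
    show ?thesis unfolding D_def using that by measurable
  qed
  have fin: "finite G1" "finite G2" using \<zeta>1 \<zeta>2 by (auto dest: dual_family_finite)
  have unit: "emeasure (\<mu> G) (D G \<zeta>) = 1" if "dual_family G (\<lambda>x. x) \<zeta>" for G \<zeta>
  proof -
    have fin: "finite G" using that by (rule dual_family_finite)
    have "(\<lambda>a. \<Sum>i\<in>G. a i *\<^sub>R i) -` D G \<zeta> \<inter> space (Pi\<^sub>M G (\<lambda>_. lborel)) = PiE G (\<lambda>_. {0..<1})"
      using dual_family_coeff[OF that, of G] by (auto simp: D_def space_PiM PiE_def Pi_iff)
    then show ?thesis
      unfolding \<mu>_def cell_measure_def using fin
      by (subst emeasure_distr) (auto simp: lborel_product.emeasure_PiM)
  qed
  \<comment> \<open>Every orbit of the lattice meets the half-open cell exactly once; rounding the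
    coordinates of \<open>x\<close> down tells for which lattice vector. Both signs occur because
    the orbit is run through as x - \<gamma> for one cell and as x + \<gamma> for the other.\<close>
  have tile: "(\<integral>\<^sup>+\<gamma>. indicator (D G \<zeta>) (x + of_int \<sigma> *\<^sub>R \<gamma>) \<partial>count_space \<Gamma>) = (1 :: ennreal)"
    if "dual_family G (\<lambda>x. x) \<zeta>" "lattice_basis \<Gamma> UNIV G" "\<sigma> \<in> {1, -1}" for G \<zeta> x \<sigma>
  proof -
    define \<gamma>0 where "\<gamma>0 = (\<Sum>b\<in>G. of_int (- \<sigma> * \<lfloor>\<zeta> b x\<rfloor>) *\<^sub>R b)"
    have \<gamma>0: "\<gamma>0 \<in> \<Gamma>" unfolding \<gamma>0_def
      by (rule lattice_basis_sum[OF that(2)]) (use lattice_basis_subset[OF that(2)] in auto)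
    have \<gamma>0_coeff: "\<zeta> b \<gamma>0 = of_int (- \<sigma> * \<lfloor>\<zeta> b x\<rfloor>)" if "b \<in> G" for b
      unfolding \<gamma>0_def
      by (subst dual_family_coeff[OF \<open>dual_family G (\<lambda>x. x) \<zeta>\<close>]) (use that in auto)
    have "x + of_int \<sigma> *\<^sub>R \<gamma> \<in> D G \<zeta> \<longleftrightarrow> \<gamma> = \<gamma>0" if "\<gamma> \<in> \<Gamma>" for \<gamma>
    proof
      assume "x + of_int \<sigma> *\<^sub>R \<gamma> \<in> D G \<zeta>"
      then have *: "0 \<le> \<zeta> b x + of_int \<sigma> * \<zeta> b \<gamma>"
                   "\<zeta> b x + of_int \<sigma> * \<zeta> b \<gamma> < 1" if "b \<in> G" for b
        using that by (auto simp: D_def blinfun.add_right blinfun.scaleR_right)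
      have "\<zeta> b \<gamma> = \<zeta> b \<gamma>0" if b: "b \<in> G" for b
      proof -
        obtain n where n: "\<zeta> b \<gamma> = of_int n"
          using lattice_basis_mem_iff[OF \<open>lattice_basis \<Gamma> UNIV G\<close> \<open>dual_family G (\<lambda>x. x) \<zeta>\<close>, of \<gamma>]
            \<open>\<gamma> \<in> \<Gamma>\<close> b by (auto elim: Ints_cases)
        have "\<lfloor>\<zeta> b x\<rfloor> = - \<sigma> * n"
          using *[OF b] unfolding n by (intro floor_unique) auto
        then show ?thesis using \<gamma>0_coeff[OF b] n \<open>\<sigma> \<in> {1, -1}\<close> by auto
      qed
      then show "\<gamma> = \<gamma>0"
        by (metis (no_types, lifting) \<open>dual_family G (\<lambda>x. x) \<zeta>\<close> dual_family_expand sum.cong)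
    next
      assume "\<gamma> = \<gamma>0"
      then show "x + of_int \<sigma> *\<^sub>R \<gamma> \<in> D G \<zeta>"
        using \<gamma>0_coeff \<open>\<sigma> \<in> {1, -1}\<close>
        by (auto simp: D_def blinfun.add_right blinfun.minus_right blinfun.diff_right) linarith+
    qed
    then have "(\<integral>\<^sup>+\<gamma>. indicator (D G \<zeta>) (x + of_int \<sigma> *\<^sub>R \<gamma>) \<partial>count_space \<Gamma>) =
       (\<integral>\<^sup>+\<gamma>. indicator {\<gamma>0} \<gamma> \<partial>count_space \<Gamma>)"
      by (intro nn_integral_cong) (auto simp: indicator_def)
    also have "\<dots> = 1" using \<gamma>0 by (subst nn_integral_indicator) auto
    finally show ?thesis .
  qed
  have cnt: "countable \<Gamma>" using assms(1) by (rule countable_lattice)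
  have [measurable]: "D G1 \<zeta>1 \<in> sets borel" "D G2 \<zeta>2 \<in> sets borel" using fin by auto
  have [measurable_cong]: "sets (\<mu> G1) = sets borel" by (simp add: \<mu>_def)
  have "emeasure (\<mu> G1) (D G1 \<zeta>1) = (\<integral>\<^sup>+x. indicator (D G1 \<zeta>1) x *
      (\<integral>\<^sup>+\<gamma>. indicator (D G2 \<zeta>2) (x + of_int (-1) *\<^sub>R \<gamma>) \<partial>count_space \<Gamma>) \<partial>\<mu> G1)"
    by (subst tile[OF \<zeta>2 assms(2)]) (auto simp: \<mu>_def)
  also have "\<dots> = (\<integral>\<^sup>+x. (\<integral>\<^sup>+\<gamma>. indicator (D G1 \<zeta>1) x * indicator (D G2 \<zeta>2) (x + of_int (-1) *\<^sub>R \<gamma>)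
      \<partial>count_space \<Gamma>) \<partial>\<mu> G1)"
    by (subst nn_integral_cmult) auto
  also have "\<dots> = (\<integral>\<^sup>+\<gamma>. (\<integral>\<^sup>+x. indicator (D G1 \<zeta>1) x * indicator (D G2 \<zeta>2) (x + of_int (-1) *\<^sub>R \<gamma>)
      \<partial>\<mu> G1) \<partial>count_space \<Gamma>)"
    using cnt by (rule nn_integral_count_space_nn_integral) measurable
  \<comment> \<open>Replacing x by \<gamma> + x turns the condition on x - \<gamma> into one on x,
    so the two cells exchange their roles.\<close>
  also have "\<dots> = (\<integral>\<^sup>+\<gamma>. (\<integral>\<^sup>+x. indicator (D G1 \<zeta>1) (\<gamma> + x) *
      indicator (D G2 \<zeta>2) ((\<gamma> + x) + of_int (-1) *\<^sub>R \<gamma>) \<partial>\<mu> G1) \<partial>count_space \<Gamma>)"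
    unfolding \<mu>_def using basis fin
    by (intro nn_integral_cong nn_integral_cell_translate[symmetric]) auto
  also have "\<dots> = (\<integral>\<^sup>+\<gamma>. (\<integral>\<^sup>+x. indicator (D G2 \<zeta>2) x * indicator (D G1 \<zeta>1) (x + of_int 1 *\<^sub>R \<gamma>)
      \<partial>\<mu> G1) \<partial>count_space \<Gamma>)"
    by (simp add: mult.commute add.commute)
  also have "\<dots> = (\<integral>\<^sup>+x. (\<integral>\<^sup>+\<gamma>. indicator (D G2 \<zeta>2) x * indicator (D G1 \<zeta>1) (x + of_int 1 *\<^sub>R \<gamma>)
      \<partial>count_space \<Gamma>) \<partial>\<mu> G1)"
    using cnt by (rule nn_integral_count_space_nn_integral[symmetric]) measurable
  also have "\<dots> = (\<integral>\<^sup>+x. indicator (D G2 \<zeta>2) x *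
      (\<integral>\<^sup>+\<gamma>. indicator (D G1 \<zeta>1) (x + of_int 1 *\<^sub>R \<gamma>) \<partial>count_space \<Gamma>) \<partial>\<mu> G1)"
    by (subst nn_integral_cmult) auto
  also have "\<dots> = emeasure (\<mu> G1) (D G2 \<zeta>2)"
    by (subst tile[OF \<zeta>1 assms(1)]) (auto simp: \<mu>_def)
  finally have eq: "emeasure (\<mu> G1) (D G2 \<zeta>2) = 1" using unit[OF \<zeta>1] by simp
  \<comment> \<open>The two measures are proportional and both give the cell of \<open>G2\<close>
    volume 1, so the factor is 1.\<close>
  obtain \<kappa> where \<kappa>: "\<kappa> > 0" "\<mu> G1 = density (\<mu> G2) (\<lambda>_. ennreal \<kappa>)"
    using cell_measure_proportional[of G1 G2] basis unfolding \<mu>_def by auto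
  have "emeasure (\<mu> G1) (D G2 \<zeta>2) = ennreal \<kappa> * emeasure (\<mu> G2) (D G2 \<zeta>2)"
    unfolding \<kappa>(2) by (subst emeasure_density) (auto simp: \<mu>_def nn_integral_cmult_indicator)
  then have "\<kappa> = 1" using eq unit[OF \<zeta>2] \<kappa>(1) by (simp add: ennreal_eq_1)
  then show ?thesis using \<kappa>(2) by (simp add: \<mu>_def density_1)
qed

section \<open>Explicit intermediate sums\<close>

text \<open>Integrability is read off from the norm, a decaying real exponential with an explicit
  antiderivative. With it, the fundamental theorem applies to the complex antiderivative, which
  tends to 0 at infinity.\<close>

lemma exp_half_line:
  fixes z :: complex
  assumes "Re z < 0"
  shows "integrable lborel (\<lambda>t. indicator {u..} t *\<^sub>R exp (of_real t * z))" (is ?int)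
    and "(\<integral>t. indicator {u..} t *\<^sub>R exp (of_real t * z) \<partial>lborel) = - exp (of_real u * z) / z" (is ?val)
proof -
  have z: "z \<noteq> 0" using assms by auto
  have lim: "((\<lambda>t::real. exp (t * Re z)) \<longlongrightarrow> 0) at_top"
    using filterlim_compose[OF exp_at_bot
        filterlim_tendsto_neg_mult_at_bot[OF tendsto_const assms filterlim_ident]]
    by (simp add: mult.commute)
  have "(\<integral>\<^sup>+t. ennreal (exp (t * Re z)) * indicator {u..} t \<partial>lborel) = ennreal (0 - exp (u * Re z) / Re z)"
  proof (rule nn_integral_FTC_atLeast)
    show "((\<lambda>t. exp (t * Re z) / Re z) \<longlongrightarrow> 0) at_top"
      using tendsto_divide[OF lim tendsto_const[of "Re z"]] assms by simp
  qed (use assms in \<open>auto intro!: derivative_eq_intros\<close>)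
  moreover have "ennreal (norm (indicator {u..} t *\<^sub>R exp (of_real t * z))) =
      ennreal (exp (t * Re z)) * indicator {u..} t" for t
    by (auto simp: indicator_def)
  ultimately show int: ?int
    by (intro integrableI_bounded) (auto simp del: norm_scaleR)
  define F where "F t = exp (of_real t * z) / z" for t
  have "((\<lambda>t. norm (F t)) \<longlongrightarrow> 0) at_top"
    using tendsto_divide[OF lim tendsto_const[of "norm z"]] z by (simp add: F_def norm_divide)
  then have limF: "(F \<longlongrightarrow> 0) at_top" by (simp add: tendsto_norm_zero_iff)
  \<comment> \<open>Interval integrals run over the open half-line, whereas the half-lines here are
    closed like the cones.\<close>
  have ae: "AE t in lborel. indicator {u<..} t *\<^sub>R exp (of_real t * z) = indicator {u..} t *\<^sub>R exp (of_real t * z)"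
    using AE_lborel_singleton[of u] by eventually_elim (auto simp: indicator_def)
  have "(LBINT t=ereal u..\<infinity>. exp (of_real t * z)) = 0 - F u"
  proof (rule interval_integral_FTC_integrable)
    show "set_integrable lborel (einterval (ereal u) \<infinity>) (\<lambda>t. exp (of_real t * z))"
      unfolding set_integrable_def einterval_eq
      using int by (subst integrable_cong_AE[OF _ _ ae]) auto
    show "((F \<circ> real_of_ereal) \<longlongrightarrow> F u) (at_right (ereal u))"
    proof -
      have "(F \<longlongrightarrow> F u) (at_right u)"
        unfolding F_def using z by (intro tendsto_intros) auto
      then show ?thesis by (simp add: ereal_tendsto_simps)
    qed
    show "((F \<circ> real_of_ereal) \<longlongrightarrow> 0) (at_left \<infinity>)"
      using limF by (simp add: ereal_tendsto_simps)
    show "(F has_vector_derivative exp (of_real x * z)) (at x)" for x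
    proof -
      have "((\<lambda>t. exp (t * z) / z) has_field_derivative exp (of_real x * z)) (at (of_real x))"
        using z by (auto intro!: derivative_eq_intros)
      from has_vector_derivative_real_field[OF this] show ?thesis by (simp add: F_def[abs_def])
    qed
  qed (auto intro!: continuous_intros)
  moreover have "(LBINT t=ereal u..\<infinity>. exp (of_real t * z)) =
      (\<integral>t. indicator {u..} t *\<^sub>R exp (of_real t * z) \<partial>lborel)"
    unfolding interval_integral_to_infinity_eq set_lebesgue_integral_def
    by (rule integral_cong_AE) (use ae in auto)
  ultimately show ?val by (simp add: F_def)
qed

text \<open>The terms are extended by zero to all integers because the cosets of L are indexed by
  all integer vectors, not only by those that meet the cone. The nonzero terms start at the ceiling
  of \<open>t\<close> and form a geometric series with ratio of modulus below 1.\<close>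

lemma geometric_has_sum_ceiling:
  fixes z :: complex and t :: real
  assumes "Re z < 0"
  defines "g \<equiv> (\<lambda>n::int. if t \<le> of_int n then exp (of_int n * z) else 0)"
  shows "(\<lambda>n. norm (g n)) summable_on UNIV" and "(\<Sum>\<^sub>\<infinity>n. g n) = exp (of_int \<lceil>t\<rceil> * z) / (1 - exp z)"
proof -
  define h where "h n = exp (of_int (\<lceil>t\<rceil> + int n) * z)" for n
  have h: "h n = exp (of_int \<lceil>t\<rceil> * z) * exp z ^ n" for n
    by (simp add: h_def algebra_simps exp_add exp_of_nat2_mult)
  have n1: "norm (exp z) < 1" using assms(1) by simp
  have "h sums (exp (of_int \<lceil>t\<rceil> * z) * (1 / (1 - exp z)))"
    unfolding h[abs_def] by (intro sums_mult geometric_sums n1)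
  moreover have sn: "summable (\<lambda>n. norm (h n))"
    unfolding h norm_mult norm_power by (intro summable_mult summable_geometric) (use n1 in simp)
  ultimately have hs: "(h has_sum (exp (of_int \<lceil>t\<rceil> * z) / (1 - exp z))) UNIV"
    using norm_summable_imp_has_sum by fastforce
  have habs: "(\<lambda>n. norm (h n)) summable_on UNIV"
    using sn by (intro summable_nonneg_imp_summable_on) auto
  define e where "e n = \<lceil>t\<rceil> + int n" for n
  have inj: "inj_on e UNIV" by (auto simp: e_def inj_on_def)
  have ge: "g (e n) = h n" for n
  proof -
    have "t \<le> of_int (e n)" unfolding e_def by linarith
    then show ?thesis by (simp add: g_def h_def e_def)
  qed
  have out: "g n = 0" if "n \<notin> range e" for n
  proof -
    have "n = e (nat (n - \<lceil>t\<rceil>))" if "\<lceil>t\<rceil> \<le> n" using that by (simp add: e_def)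
    then have "\<not> \<lceil>t\<rceil> \<le> n" using that by blast
    then show ?thesis by (simp add: g_def ceiling_le_iff)
  qed
  have "(g has_sum (exp (of_int \<lceil>t\<rceil> * z) / (1 - exp z))) (range e)"
    unfolding has_sum_reindex[OF inj] using hs by (simp add: o_def ge)
  then have "(g has_sum (exp (of_int \<lceil>t\<rceil> * z) / (1 - exp z))) UNIV"
    by (rule has_sum_cong_neutral[THEN iffD1, rotated -1]) (auto simp: out)
  then show "(\<Sum>\<^sub>\<infinity>n. g n) = exp (of_int \<lceil>t\<rceil> * z) / (1 - exp z)" by (rule infsumI)
  have "(\<lambda>n. norm (g n)) summable_on range e"
    unfolding summable_on_reindex[OF inj] using habs by (simp add: o_def ge)
  then show "(\<lambda>n. norm (g n)) summable_on UNIV"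
    by (rule summable_on_cong_neutral[THEN iffD1, rotated -1]) (auto simp: out)
qed

text \<open>A finite set of choice functions lies in the box of its coordinate projections, where a
  sum of products is a product of sums. Hence the product of the infinite sums bounds all partial
  sums.\<close>

lemma abs_summable_on_prod_PiE:
  fixes g :: "'i \<Rightarrow> 'b \<Rightarrow> complex"
  assumes "finite I" "\<And>i. i \<in> I \<Longrightarrow> (\<lambda>x. norm (g i x)) summable_on X i"
  shows "(\<lambda>k. norm (\<Prod>i\<in>I. g i (k i))) summable_on PiE I X"
proof (rule nonneg_bdd_above_summable_on)
  show "bdd_above (sum (\<lambda>k. norm (\<Prod>i\<in>I. g i (k i))) ` {F. F \<subseteq> PiE I X \<and> finite F})"
  proof (rule bdd_aboveI2)
    fix F assume F: "F \<in> {F. F \<subseteq> PiE I X \<and> finite F}"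
    define Y where "Y i = (\<lambda>k. k i) ` F" for i
    have Y: "finite (Y i)" for i using F by (simp add: Y_def)
    have sub: "Y i \<subseteq> X i" if "i \<in> I" for i using F that by (auto simp: Y_def)
    have "F \<subseteq> PiE I Y" using F by (auto simp: Y_def PiE_def extensional_def)
    then have "(\<Sum>k\<in>F. norm (\<Prod>i\<in>I. g i (k i))) \<le> (\<Sum>k\<in>PiE I Y. \<Prod>i\<in>I. norm (g i (k i)))"
      unfolding prod_norm[symmetric] using assms(1) Y
      by (intro sum_mono2 finite_PiE) (auto intro: prod_nonneg)
    also have "\<dots> = (\<Prod>i\<in>I. \<Sum>n\<in>Y i. norm (g i n))"
      using infsum_prod_PiE_abs[OF assms(1), of "\<lambda>i n. norm (g i n)" Y] Y assms(1)
      by (simp add: finite_PiE)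
    also have "\<dots> \<le> (\<Prod>i\<in>I. \<Sum>\<^sub>\<infinity>n\<in>X i. norm (g i n))"
      using Y sub assms(2) by (intro prod_mono conjI sum_nonneg finite_sum_le_infsum) auto
    finally show "(\<Sum>k\<in>F. norm (\<Prod>i\<in>I. g i (k i))) \<le> (\<Prod>i\<in>I. \<Sum>\<^sub>\<infinity>n\<in>X i. norm (g i n))" .
  qed
qed auto

section \<open>Cosets of L and the intermediate sum of one cone\<close>

lemma qproj_eq_iff:
  assumes "subspace L"
  shows "qproj L x = qproj L y \<longleftrightarrow> x - y \<in> L"
proof
  assume "qproj L x = qproj L y"
  moreover have "x \<in> qproj L x" using subspace_0[OF assms] by (force simp: qproj_def)
  ultimately obtain l where "l \<in> L" "x = y + l" by (auto simp: qproj_def)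
  then show "x - y \<in> L" by simp
next
  have sub: "qproj L x \<subseteq> qproj L y" if d: "x - y \<in> L" for x y
  proof
    fix z assume "z \<in> qproj L x"
    then obtain l where "l \<in> L" "z = x + l" by (auto simp: qproj_def)
    then have "z = y + (x - y + l)" "x - y + l \<in> L" using d subspace_add[OF assms] by auto
    then show "z \<in> qproj L y" unfolding qproj_def by (rule image_eqI)
  qed
  assume d: "x - y \<in> L"
  then have "y - x \<in> L" using subspace_neg[OF assms d] by simp
  then show "qproj L x = qproj L y" using sub d by blast
qed

lemma mem_qproj_iff: "x \<in> qproj L y \<longleftrightarrow> x - y \<in> L"
  by (force simp: qproj_def)

text \<open>The edges labelled by \<open>A\<close> span L; for \<open>v\<close> in \<open>B\<close>
  the edge \<open>u v\<close> is another representative of the coset of \<open>v\<close> modulo L.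
  The functionals on \<open>B\<close> are integral because lattice points are summed in these
  directions; on \<open>A\<close>, where one integrates, rationality makes the cone a rational one.
  \<kappa> is the volume of the parallelepiped spanned by the edges in L.\<close>

locale cone_data =
  fixes \<Lambda> L A B :: "'a::euclidean_space set" and u :: "'a \<Rightarrow> 'a" and \<zeta> :: "'a \<Rightarrow> 'a \<Rightarrow>\<^sub>L real"
    and \<kappa> :: real
  assumes lattice: "lattice_in \<Lambda> UNIV"
    and dual: "dual_family (A \<union> B) u \<zeta>"
    and disjoint: "A \<inter> B = {}"
    and subspace: "subspace L"
    and u_in: "b \<in> A \<Longrightarrow> u b \<in> L"
    and u_lift: "v \<in> B \<Longrightarrow> u v - v \<in> L"
    and \<zeta>_ann: "v \<in> B \<Longrightarrow> \<zeta> v \<in> annihilator L"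
    and \<zeta>_dual: "v \<in> B \<Longrightarrow> \<zeta> v \<in> dual_lattice \<Lambda>"
    and \<zeta>_rational: "b \<in> A \<Longrightarrow> \<exists>N::nat. N > 0 \<and> of_nat N *\<^sub>R \<zeta> b \<in> dual_lattice \<Lambda>"
    and quot_basis: "quot_lattice_basis \<Lambda> L B"
    and \<kappa>_pos: "\<kappa> > 0"
    and \<kappa>: "cell_measure (SOME G. lattice_basis (L \<inter> \<Lambda>) L G) (\<lambda>x. x) =
           density (cell_measure A u) (\<lambda>_. ennreal \<kappa>)"
begin

definition K :: "'a set" where "K = {x. \<forall>j\<in>A \<union> B. 0 \<le> \<zeta> j x}"

lemma finite_A [simp]: "finite A" and finite_B [simp]: "finite B"
  using dual_family_finite[OF dual] by auto

lemma shift_K: "x \<in> shift s K \<longleftrightarrow> (\<forall>j\<in>A \<union> B. \<zeta> j s \<le> \<zeta> j x)"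
proof -
  have "x \<in> shift s K \<longleftrightarrow> x - s \<in> K" unfolding shift_def by (force simp: image_iff)
  then show ?thesis by (simp add: K_def blinfun.diff_right)
qed

lemma expand: "x = (\<Sum>b\<in>A. \<zeta> b x *\<^sub>R u b) + (\<Sum>v\<in>B. \<zeta> v x *\<^sub>R u v)"
  using dual_family_expand[OF dual, of x] disjoint by (simp add: sum.union_disjoint)

lemma coeff_A: "i \<in> A \<union> B \<Longrightarrow> \<zeta> i (\<Sum>b\<in>A. a b *\<^sub>R u b) = (if i \<in> A then a i else 0)"
  by (rule dual_family_coeff[OF dual]) auto

lemma \<zeta>_cong: "v \<in> B \<Longrightarrow> x - y \<in> L \<Longrightarrow> \<zeta> v x = \<zeta> v y"
  using \<zeta>_ann[of v] by (force simp: annihilator_def blinfun.diff_right)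

lemma \<zeta>_B: "v \<in> B \<Longrightarrow> w \<in> B \<Longrightarrow> \<zeta> v w = (if v = w then 1 else 0)"
  using \<zeta>_cong[OF _ u_lift, of v w] dual_family_apply[OF dual, of v w] by auto

text \<open>Apart from \<kappa>, the product of the values in \<open>exp_half_line\<close>, with
  each half-line starting at the coordinate of \<open>s\<close> on an edge in L.\<close>

definition L_factor :: "'a \<Rightarrow> 'a cdual \<Rightarrow> complex" where
  "L_factor s \<xi> = of_real \<kappa> *
     (\<Prod>b\<in>A. - exp (of_real (\<zeta> b s) * blinfun_apply \<xi> (u b)) / blinfun_apply \<xi> (u b))"

text \<open>Along L the integrand factorises over \<open>A\<close>; the \<open>B\<close>-coordinates
  are constant on the coset and only decide whether it meets the cone. The arbitrary base point
  \<open>y\<close> of the coset moves the start of each half-line integral, and the factor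
  \<open>E\<close>, the exponential of the \<open>A\<close>-part of \<open>y\<close>, moves it
  back.\<close>

lemma coset_integral:
  fixes y0 :: 'a
  assumes re: "\<And>b. b \<in> A \<Longrightarrow> Re (blinfun_apply \<xi> (u b)) < 0"
  defines "C \<equiv> qproj L y0"
  shows "set_integrable (coset_measure \<Lambda> L C) (shift s K \<inter> C) (\<lambda>x. exp (blinfun_apply \<xi> x))"
    and "coset_integral \<Lambda> L (shift s K) \<xi> C = L_factor s \<xi> *
      (\<Prod>v\<in>B. if \<zeta> v s \<le> \<zeta> v y0
              then exp (of_real (\<zeta> v y0) * blinfun_apply \<xi> (u v)) else 0)"
proof -
  define G where "G = (SOME G. lattice_basis (L \<inter> \<Lambda>) L G)"
  define y where "y = (SOME y. y \<in> C)"
  have "y0 \<in> C" unfolding C_def mem_qproj_iff by (simp add: subspace_0[OF subspace])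
  then have "y \<in> C" unfolding y_def by (rule someI)
  then have yy0: "y - y0 \<in> L" by (simp add: C_def mem_qproj_iff)
  define \<mu> where "\<mu> = cell_measure A u"
  have cm: "coset_measure \<Lambda> L C = distr (density \<mu> (\<lambda>_. ennreal \<kappa>)) borel (\<lambda>x. y + x)"
  proof -
    have "coset_measure \<Lambda> L C = distr (cell_measure G (\<lambda>x. x)) borel (\<lambda>x. y + x)"
      unfolding coset_measure_def Let_def G_def[symmetric] y_def[symmetric] cell_measure_def
      by (subst distr_distr) (auto simp: o_def)
    then show ?thesis using \<kappa> unfolding G_def[symmetric] \<mu>_def by simp
  qed
  have C_sets: "C \<in> sets borel"
  proof -
    have "C = (\<lambda>x. x - y0) -` L" by (auto simp: C_def mem_qproj_iff)
    then have "closed C"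
      using closed_subspace[OF subspace] by (auto intro!: continuous_closed_vimage continuous_intros)
    then show ?thesis by simp
  qed
  have p_sets: "shift s K \<in> sets borel"
  proof -
    have "shift s K = (\<Inter>j\<in>A \<union> B. {x. \<zeta> j s \<le> \<zeta> j x})"
      by (auto simp: shift_K)
    moreover have "closed \<dots>"
      by (intro closed_INT ballI closed_Collect_le continuous_intros)
    ultimately show ?thesis by simp
  qed
  note [measurable] = C_sets p_sets
  have exp_meas [measurable]: "(\<lambda>x. exp (blinfun_apply \<xi> x)) \<in> borel_measurable borel"
    by (intro borel_measurable_continuous_onI continuous_intros)
  define f where "f x = indicator (shift s K \<inter> C) x *\<^sub>R exp (blinfun_apply \<xi> x)" for x
  have [measurable]: "f \<in> borel_measurable borel" unfolding f_def by measurable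
  define \<beta> where "\<beta> = (\<Prod>v\<in>B. if \<zeta> v s \<le> \<zeta> v y0
              then exp (of_real (\<zeta> v y0) * blinfun_apply \<xi> (u v)) else 0)"
  define t where "t b = \<zeta> b s - \<zeta> b y" for b
  define e where "e b r = indicator {t b..} r *\<^sub>R exp (of_real r * blinfun_apply \<xi> (u b))" for b and r :: real
  define E where "E = (\<Prod>b\<in>A. exp (of_real (\<zeta> b y) * blinfun_apply \<xi> (u b)))"
  have f: "f (y + (\<Sum>b\<in>A. a b *\<^sub>R u b)) = \<beta> * E * (\<Prod>b\<in>A. e b (a b))" for a
  proof -
    let ?x = "y + (\<Sum>b\<in>A. a b *\<^sub>R u b)"
    have "?x - y0 \<in> L"
    proof -
      have "(\<Sum>b\<in>A. a b *\<^sub>R u b) \<in> L"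
        by (intro subspace_sum[OF subspace] subspace_scale[OF subspace] u_in)
      then have "(y - y0) + (\<Sum>b\<in>A. a b *\<^sub>R u b) \<in> L" by (rule subspace_add[OF subspace yy0])
      then show ?thesis by (simp add: algebra_simps)
    qed
    then have inC: "?x \<in> C" by (simp add: C_def mem_qproj_iff)
    have zA: "blinfun_apply (\<zeta> b) ?x = \<zeta> b y + a b" if "b \<in> A" for b
      using coeff_A[of b a] that by (simp add: blinfun.add_right)
    have zB: "blinfun_apply (\<zeta> v) ?x = \<zeta> v y0" if "v \<in> B" for v
      using \<zeta>_cong[OF that \<open>?x - y0 \<in> L\<close>] .
    have mem: "?x \<in> shift s K \<longleftrightarrow>
      (\<forall>b\<in>A. t b \<le> a b) \<and> (\<forall>v\<in>B. \<zeta> v s \<le> \<zeta> v y0)"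
      unfolding shift_K ball_Un using zA zB by (simp add: t_def diff_le_eq add.commute)
    have "blinfun_apply \<xi> ?x = (\<Sum>b\<in>A. of_real (blinfun_apply (\<zeta> b) ?x) * blinfun_apply \<xi> (u b)) +
       (\<Sum>v\<in>B. of_real (blinfun_apply (\<zeta> v) ?x) * blinfun_apply \<xi> (u v))"
      by (subst expand[of ?x])
         (simp only: blinfun.add_right blinfun_sum_right blinfun.scaleR_right scaleR_conv_of_real)
    also have "\<dots> = (\<Sum>b\<in>A. of_real (\<zeta> b y + a b) * blinfun_apply \<xi> (u b)) +
       (\<Sum>v\<in>B. of_real (\<zeta> v y0) * blinfun_apply \<xi> (u v))"
      using zA zB by simp
    also have "exp \<dots> = E * (\<Prod>b\<in>A. exp (of_real (a b) * blinfun_apply \<xi> (u b))) *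
       (\<Prod>v\<in>B. exp (of_real (\<zeta> v y0) * blinfun_apply \<xi> (u v)))"
      by (simp add: exp_add exp_sum E_def ring_distribs flip: prod.distrib)
    finally have ex: "exp (blinfun_apply \<xi> ?x) = \<dots>" .
    show ?thesis
    proof (cases "?x \<in> shift s K")
      case True
      then have "e b (a b) = exp (of_real (a b) * blinfun_apply \<xi> (u b))" if "b \<in> A" for b
        using mem that by (simp add: e_def)
      moreover have "\<beta> = (\<Prod>v\<in>B. exp (of_real (\<zeta> v y0) * blinfun_apply \<xi> (u v)))"
        unfolding \<beta>_def using True mem by (intro prod.cong) auto
      ultimately show ?thesis using True inC ex by (simp add: f_def)
    next
      case False
      then consider b where "b \<in> A" "\<not> t b \<le> a b"
        | v where "v \<in> B" "\<not> \<zeta> v s \<le> \<zeta> v y0"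
        using mem by blast
      then have "\<beta> = 0 \<or> (\<Prod>b\<in>A. e b (a b)) = 0"
      proof cases
        case 1
        then have "e b (a b) = 0" by (simp add: e_def)
        then show ?thesis using 1 by auto
      next
        case 2
        then show ?thesis by (auto simp: \<beta>_def)
      qed
      then show ?thesis using False by (auto simp: f_def)
    qed
  qed
  have e_int: "integrable lborel (e b)" "integral\<^sup>L lborel (e b) =
      - exp (of_real (t b) * blinfun_apply \<xi> (u b)) / blinfun_apply \<xi> (u b)" if "b \<in> A" for b
    unfolding e_def[abs_def] using exp_half_line[OF re[OF that]] by auto
  have prod_int: "integrable (Pi\<^sub>M A (\<lambda>_. lborel)) (\<lambda>a. \<Prod>b\<in>A. e b (a b))"
    using e_int by (intro lborel_product.product_integrable_prod) auto
  then have int\<mu>: "integrable \<mu> (\<lambda>x. f (y + x))"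
    unfolding \<mu>_def cell_measure_def by (subst integrable_distr_eq) (auto simp: f)
  have sets\<mu> [measurable_cong]: "sets \<mu> = sets borel" by (simp add: \<mu>_def)
  have "integrable (coset_measure \<Lambda> L C) f"
    unfolding cm using int\<mu> \<kappa>_pos
    by (subst integrable_distr_eq) (auto simp: integrable_density)
  then show "set_integrable (coset_measure \<Lambda> L C) (shift s K \<inter> C) (\<lambda>x. exp (blinfun_apply \<xi> x))"
    by (simp add: set_integrable_def f_def[abs_def])
  have "coset_integral \<Lambda> L (shift s K) \<xi> C = integral\<^sup>L (coset_measure \<Lambda> L C) f"
    by (simp add: coset_integral_def set_lebesgue_integral_def f_def[abs_def])
  also have "\<dots> = of_real \<kappa> * (\<integral>x. f (y + x) \<partial>\<mu>)"
    unfolding cm using \<kappa>_pos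
    by (subst integral_distr) (auto simp: integral_density scaleR_conv_of_real)
  also have "(\<integral>x. f (y + x) \<partial>\<mu>) = (\<integral>a. \<beta> * E * (\<Prod>b\<in>A. e b (a b)) \<partial>Pi\<^sub>M A (\<lambda>_. lborel))"
    unfolding \<mu>_def cell_measure_def by (subst integral_distr) (auto simp: f)
  also have "\<dots> = \<beta> * E * (\<Prod>b\<in>A. - exp (of_real (t b) * blinfun_apply \<xi> (u b)) / blinfun_apply \<xi> (u b))"
    using e_int by (simp add: lborel_product.product_integral_prod)
  also have "of_real \<kappa> * \<dots> = L_factor s \<xi> * \<beta>"
  proof -
    have "E * (\<Prod>b\<in>A. - exp (of_real (t b) * blinfun_apply \<xi> (u b)) / blinfun_apply \<xi> (u b)) =
      (\<Prod>b\<in>A. - exp (of_real (\<zeta> b s) * blinfun_apply \<xi> (u b)) / blinfun_apply \<xi> (u b))"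
      unfolding E_def prod.distrib[symmetric]
      by (intro prod.cong refl) (simp add: t_def ring_distribs flip: exp_add)
    then show ?thesis by (simp add: L_factor_def mult_ac)
  qed
  finally show "coset_integral \<Lambda> L (shift s K) \<xi> C = L_factor s \<xi> *
      (\<Prod>v\<in>B. if \<zeta> v s \<le> \<zeta> v y0
              then exp (of_real (\<zeta> v y0) * blinfun_apply \<xi> (u v)) else 0)"
    by (simp add: \<beta>_def)
qed

definition coset :: "('a \<Rightarrow> int) \<Rightarrow> 'a set" where
  "coset k = qproj L (\<Sum>v\<in>B. of_int (k v) *\<^sub>R v)"

lemma \<zeta>_coset: "w \<in> B \<Longrightarrow> \<zeta> w (\<Sum>v\<in>B. of_int (k v) *\<^sub>R v) = of_int (k w)"
proof -
  assume w: "w \<in> B"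
  have "\<zeta> w (\<Sum>v\<in>B. of_int (k v) *\<^sub>R v) = (\<Sum>v\<in>B. if w = v then of_int (k v) else 0)"
    unfolding blinfun_sum_right blinfun.scaleR_right using w by (intro sum.cong) (auto simp: \<zeta>_B)
  then show ?thesis using w by (simp add: sum.delta)
qed

text \<open>The functionals labelled by \<open>B\<close> are constant on cosets and recover the
  integer coordinates; restricting to \<open>PiE\<close> makes the coordinate function itself
  unique.\<close>

lemma bij_coset: "bij_betw coset (PiE B (\<lambda>_. UNIV)) (quot_lattice \<Lambda> L)"
proof (rule bij_betwI')
  fix k l :: "'a \<Rightarrow> int" assume kl: "k \<in> PiE B (\<lambda>_. UNIV)" "l \<in> PiE B (\<lambda>_. UNIV)"
  show "coset k = coset l \<longleftrightarrow> k = l"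
  proof
    assume "coset k = coset l"
    then have "(\<Sum>v\<in>B. of_int (k v) *\<^sub>R v) - (\<Sum>v\<in>B. of_int (l v) *\<^sub>R v) \<in> L"
      by (simp add: coset_def qproj_eq_iff[OF subspace])
    from \<zeta>_cong[OF _ this] have "k w = l w" if "w \<in> B" for w
      using that by (simp add: \<zeta>_coset)
    then show "k = l" using kl by (intro PiE_ext)
  qed simp
next
  fix k :: "'a \<Rightarrow> int"
  obtain G where "lattice_basis \<Lambda> UNIV G" using lattice by (auto simp: lattice_in_def)
  then have "(\<Sum>v\<in>B. of_int (k v) *\<^sub>R v) \<in> \<Lambda>"
    using quot_basis by (intro lattice_basis_sum) (auto simp: quot_lattice_basis_def)
  then show "coset k \<in> quot_lattice \<Lambda> L" by (simp add: coset_def quot_lattice_def)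
next
  fix C assume "C \<in> quot_lattice \<Lambda> L"
  then obtain x where x: "x \<in> \<Lambda>" "C = qproj L x" by (auto simp: quot_lattice_def)
  then obtain k where k: "x - (\<Sum>v\<in>B. of_int (k v) *\<^sub>R v) \<in> L"
    using quot_basis by (auto simp: quot_lattice_basis_def)
  have "C = coset (restrict k B)"
    using k x(2) by (simp add: coset_def qproj_eq_iff[OF subspace])
  then show "\<exists>k\<in>PiE B (\<lambda>_. UNIV). C = coset k" by (intro bexI[of _ "restrict k B"]) auto
qed

definition generating :: "'a \<Rightarrow> 'a cdual \<Rightarrow> complex" where
  "generating s \<xi> = L_factor s \<xi> *
     (\<Prod>v\<in>B. exp (of_int \<lceil>\<zeta> v s\<rceil> * blinfun_apply \<xi> (u v)) / (1 - exp (blinfun_apply \<xi> (u v))))"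

text \<open>In integer coordinates of the quotient lattice the sum over cosets factorises into one
  geometric series per element of \<open>B\<close>, times the common integral along L.\<close>

lemma intermediate_sum:
  assumes re: "\<And>j. j \<in> A \<union> B \<Longrightarrow> Re (blinfun_apply \<xi> (u j)) < 0"
  shows "intermediate_sum_converges \<Lambda> L (shift s K) \<xi>"
    and "intermediate_sum \<Lambda> L (shift s K) \<xi> = generating s \<xi>"
proof -
  define g where "g \<xi> v = (\<lambda>n::int. if \<zeta> v s \<le> of_int n
       then exp (of_int n * blinfun_apply \<xi> (u v)) else 0)" for v and \<xi> :: "'a cdual"
  have ci: "coset_integral \<Lambda> L (shift s K) \<xi> (coset k) = L_factor s \<xi> * (\<Prod>v\<in>B. g \<xi> v (k v))"
    if "\<And>b. b \<in> A \<Longrightarrow> Re (blinfun_apply \<xi> (u b)) < 0" for k and \<xi> :: "'a cdual"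
    unfolding coset_def
    by (rule trans[OF coset_integral(2) arg_cong2[where f = "(*)", OF refl prod.cong[OF refl]]])
       (use that in \<open>auto simp: \<zeta>_coset g_def\<close>)
  have abs: "(\<lambda>k. norm (\<Prod>v\<in>B. g \<xi> v (k v))) summable_on PiE B (\<lambda>_. UNIV)"
    if "\<And>j. j \<in> A \<union> B \<Longrightarrow> Re (blinfun_apply \<xi> (u j)) < 0" for \<xi> :: "'a cdual"
    unfolding g_def using that
    by (intro abs_summable_on_prod_PiE finite_B geometric_has_sum_ceiling(1)) auto
  \<comment> \<open>The norm of the exponential of \<xi> is the exponential of its real part, which
    is again a covector with negative real parts on all edges. So absolute convergence follows from
    the same formula, applied to \<open>\<xi>r\<close>.\<close>
  define \<xi>r :: "'a cdual" where "\<xi>r = Blinfun (\<lambda>x. of_real (Re (blinfun_apply \<xi> x)))"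
  have \<xi>r: "blinfun_apply \<xi>r x = of_real (Re (blinfun_apply \<xi> x))" for x
    unfolding \<xi>r_def
    by (subst bounded_linear_Blinfun_apply)
       (auto intro!: bounded_linear_compose[OF bounded_linear_of_real]
          bounded_linear_compose[OF bounded_linear_Re] blinfun.bounded_linear_right)
  have norm_int: "(LINT x:(shift s K \<inter> C)|coset_measure \<Lambda> L C. norm (exp (blinfun_apply \<xi> x))) =
     Re (coset_integral \<Lambda> L (shift s K) \<xi>r C)" for C
  proof -
    have "coset_integral \<Lambda> L (shift s K) \<xi>r C =
      (LINT x:(shift s K \<inter> C)|coset_measure \<Lambda> L C. of_real (norm (exp (blinfun_apply \<xi> x))))"
      by (simp add: coset_integral_def \<xi>r exp_of_real)
    also have "\<dots> = of_real (LINT x:(shift s K \<inter> C)|coset_measure \<Lambda> L C. norm (exp (blinfun_apply \<xi> x)))"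
      by (rule set_integral_complex_of_real)
    finally show ?thesis by simp
  qed
  have re_r: "Re (blinfun_apply \<xi>r (u j)) < 0" if "j \<in> A \<union> B" for j
    using re[OF that] by (simp add: \<xi>r)
  have ci_r: "coset_integral \<Lambda> L (shift s K) \<xi>r (coset k) = L_factor s \<xi>r * (\<Prod>v\<in>B. g \<xi>r v (k v))" for k
    by (rule ci) (use re_r in auto)
  have "(\<lambda>k. Re (L_factor s \<xi>r * (\<Prod>v\<in>B. g \<xi>r v (k v)))) summable_on PiE B (\<lambda>_. UNIV)"
    by (rule summable_on_Re, rule summable_on_cmult_right, rule abs_summable_summable, rule abs)
       (rule re_r)
  then have "(\<lambda>k. Re (coset_integral \<Lambda> L (shift s K) \<xi>r (coset k))) summable_on PiE B (\<lambda>_. UNIV)"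
    by (simp only: ci_r)
  then have "(\<lambda>C. Re (coset_integral \<Lambda> L (shift s K) \<xi>r C)) summable_on quot_lattice \<Lambda> L"
    by (subst (asm) summable_on_reindex_bij_betw[OF bij_coset])
  moreover have "set_integrable (coset_measure \<Lambda> L C) (shift s K \<inter> C) (\<lambda>x. exp (blinfun_apply \<xi> x))"
    if "C \<in> quot_lattice \<Lambda> L" for C
    using that re by (auto simp: quot_lattice_def intro!: coset_integral(1))
  ultimately show "intermediate_sum_converges \<Lambda> L (shift s K) \<xi>"
    unfolding intermediate_sum_converges_def norm_int by simp
  have "intermediate_sum \<Lambda> L (shift s K) \<xi> =
    (\<Sum>\<^sub>\<infinity>k\<in>PiE B (\<lambda>_. UNIV). coset_integral \<Lambda> L (shift s K) \<xi> (coset k))"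
    unfolding intermediate_sum_def by (rule infsum_reindex_bij_betw[OF bij_coset, symmetric])
  also have "\<dots> = L_factor s \<xi> * (\<Sum>\<^sub>\<infinity>k\<in>PiE B (\<lambda>_. UNIV). \<Prod>v\<in>B. g \<xi> v (k v))"
    using re by (simp add: ci infsum_cmult_right')
  also have "(\<Sum>\<^sub>\<infinity>k\<in>PiE B (\<lambda>_. UNIV). \<Prod>v\<in>B. g \<xi> v (k v)) = (\<Prod>v\<in>B. \<Sum>\<^sub>\<infinity>n. g \<xi> v n)"
    unfolding g_def using re
    by (intro infsum_prod_PiE_abs finite_B geometric_has_sum_ceiling(1)) auto
  also have "\<dots> = (\<Prod>v\<in>B. exp (of_int \<lceil>\<zeta> v s\<rceil> * blinfun_apply \<xi> (u v)) /
      (1 - exp (blinfun_apply \<xi> (u v))))"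
    unfolding g_def using re by (intro prod.cong refl geometric_has_sum_ceiling(2)) auto
  finally show "intermediate_sum \<Lambda> L (shift s K) \<xi> = generating s \<xi>"
    by (simp add: generating_def)
qed

end

section \<open>Generic equality and the identity theorem\<close>

text \<open>Generalises \<open>mero_eq\<close> from equations to arbitrary properties of \<xi>, such
  as the existence of a given Laurent expansion along the line through \<xi>.\<close>

definition generic :: "('a::euclidean_space cdual \<Rightarrow> bool) \<Rightarrow> bool" where
  "generic P \<longleftrightarrow> (\<exists>W. finite W \<and> 0 \<notin> W \<and>
     (\<forall>\<^sub>F \<xi> in nhds 0. (\<forall>w\<in>W. blinfun_apply \<xi> w \<noteq> 0) \<longrightarrow> P \<xi>))"

lemma mero_eq_iff_generic: "mero_eq f g \<longleftrightarrow> generic (\<lambda>\<xi>. f \<xi> = g \<xi>)"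
  by (simp add: mero_eq_def generic_def)

lemma generic_mono: "generic P \<Longrightarrow> (\<And>\<xi>. P \<xi> \<Longrightarrow> Q \<xi>) \<Longrightarrow> generic Q"
  unfolding generic_def by (blast intro: eventually_mono)

lemma generic_conj:
  assumes "generic P" "generic Q"
  shows "generic (\<lambda>\<xi>. P \<xi> \<and> Q \<xi>)"
proof -
  obtain W1 W2 where W: "finite W1" "0 \<notin> W1" "finite W2" "0 \<notin> W2"
    "\<forall>\<^sub>F \<xi> in nhds 0. (\<forall>w\<in>W1. blinfun_apply \<xi> w \<noteq> 0) \<longrightarrow> P \<xi>"
    "\<forall>\<^sub>F \<xi> in nhds 0. (\<forall>w\<in>W2. blinfun_apply \<xi> w \<noteq> 0) \<longrightarrow> Q \<xi>"
    using assms by (auto simp: generic_def)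
  have "\<forall>\<^sub>F \<xi> in nhds 0. (\<forall>w\<in>W1 \<union> W2. blinfun_apply \<xi> w \<noteq> 0) \<longrightarrow> P \<xi> \<and> Q \<xi>"
    using W(5,6) by eventually_elim auto
  then show ?thesis unfolding generic_def using W by (intro exI[of _ "W1 \<union> W2"]) auto
qed

lemma generic_eventually: "eventually P (nhds 0) \<Longrightarrow> generic P"
  unfolding generic_def by (intro exI[of _ "{}"]) auto

lemma generic_always: "(\<And>\<xi>. P \<xi>) \<Longrightarrow> generic P"
  by (intro generic_eventually always_eventually) auto

lemma generic_nonzero: "w \<noteq> 0 \<Longrightarrow> generic (\<lambda>\<xi>. blinfun_apply \<xi> w \<noteq> 0)"
  unfolding generic_def by (intro exI[of _ "{w}"]) auto

lemma generic_ball: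
  assumes "finite I" "\<And>i. i \<in> I \<Longrightarrow> generic (P i)"
  shows "generic (\<lambda>\<xi>. \<forall>i\<in>I. P i \<xi>)"
  using assms
proof (induction I rule: finite_induct)
  case empty
  then show ?case by (auto intro: generic_always)
next
  case (insert i I)
  then have "generic (\<lambda>\<xi>. P i \<xi> \<and> (\<forall>i\<in>I. P i \<xi>))" by (intro generic_conj) auto
  then show ?case by (rule generic_mono) auto
qed

lemma mero_eq_refl [simp]: "mero_eq f f"
  by (simp add: mero_eq_iff_generic generic_always)

lemma mero_eq_sym: "mero_eq f g \<Longrightarrow> mero_eq g f"
  unfolding mero_eq_iff_generic by (erule generic_mono) simp

lemma mero_eq_trans [trans]: "mero_eq f g \<Longrightarrow> mero_eq g h \<Longrightarrow> mero_eq f h"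
  unfolding mero_eq_iff_generic
  by (rule generic_mono[OF generic_conj[of "\<lambda>\<xi>. f \<xi> = g \<xi>" "\<lambda>\<xi>. g \<xi> = h \<xi>"]]) auto

lemma mero_eq_sum:
  assumes "\<And>i. i \<in> I \<Longrightarrow> mero_eq (f i) (g i)"
  shows "mero_eq (\<lambda>\<xi>. \<Sum>i\<in>I. h i \<xi> * f i \<xi>) (\<lambda>\<xi>. \<Sum>i\<in>I. h i \<xi> * g i \<xi>)"
proof (cases "finite I")
  case True
  have "generic (\<lambda>\<xi>. \<forall>i\<in>I. f i \<xi> = g i \<xi>)"
    using assms True by (intro generic_ball) (auto simp: mero_eq_iff_generic)
  then show ?thesis unfolding mero_eq_iff_generic by (rule generic_mono) simp
qed simp

section \<open>Complex lines through the origin and holomorphy\<close>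

lemma cscale_apply [simp]: "blinfun_apply (cscale \<tau> \<xi>) w = \<tau> * blinfun_apply \<xi> w"
  by (simp add: cscale_def)

lemma bounded_linear_cscale: "bounded_linear (\<lambda>\<tau>. cscale \<tau> \<xi>)"
  unfolding cscale_def
  by (intro bounded_linear_compose[OF bounded_bilinear.bounded_linear_left
        [OF bounded_bilinear_blinfun_compose] bounded_linear_blinfun_mult_right])

lemma tendsto_cscale: "((\<lambda>\<tau>. cscale \<tau> \<xi>) \<longlongrightarrow> 0) (at 0)"
  using bounded_linear.tendsto[OF bounded_linear_cscale tendsto_ident_at, of \<xi> 0 UNIV]
  by (simp add: linear_simps[OF bounded_linear_cscale])

text \<open>A point off the exceptional hyperplanes stays off them under scaling by any nonzero
  \<tau>, and small \<tau> brings it into the neighbourhood where \<open>P\<close> is known. Applied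
  to \<open>mero_eq\<close>, this gives equality near 0 along the line, hence equal Laurent
  expansions.\<close>

lemma generic_scale:
  assumes "generic P"
  shows "generic (\<lambda>\<xi>. \<forall>\<^sub>F \<tau> in at 0. P (cscale \<tau> \<xi>))"
proof -
  obtain W where W: "finite W" "0 \<notin> W"
    "\<forall>\<^sub>F \<xi> in nhds 0. (\<forall>w\<in>W. blinfun_apply \<xi> w \<noteq> 0) \<longrightarrow> P \<xi>"
    using assms by (auto simp: generic_def)
  have "\<forall>\<^sub>F \<tau> in at 0. P (cscale \<tau> \<xi>)" if "\<forall>w\<in>W. blinfun_apply \<xi> w \<noteq> 0" for \<xi>
  proof -
    have "\<forall>\<^sub>F \<tau> in at 0. (\<forall>w\<in>W. blinfun_apply (cscale \<tau> \<xi>) w \<noteq> 0) \<longrightarrow> P (cscale \<tau> \<xi>)"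
      using W(3) tendsto_cscale by (rule eventually_compose_filterlim)
    moreover have "\<forall>\<^sub>F \<tau> in at (0::complex). \<tau> \<noteq> 0" by (auto simp: eventually_at_filter)
    ultimately show ?thesis by eventually_elim (use that in auto)
  qed
  then show ?thesis unfolding generic_def using W by (intro exI[of _ W]) auto
qed

text \<open>The pointwise clause of \<open>holomorphic_near_0\<close>. Complex linearity is phrased
  with \<open>cscale\<close> because the type of covectors is only a real vector space.\<close>

definition cdifferentiable_at :: "('a::euclidean_space cdual \<Rightarrow> complex) \<Rightarrow> 'a cdual \<Rightarrow> bool" where
  "cdifferentiable_at \<phi> \<xi> \<longleftrightarrow>
     (\<exists>D. (\<phi> has_derivative D) (at \<xi>) \<and> (\<forall>\<tau> h. D (cscale \<tau> h) = \<tau> * D h))"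

lemma cdifferentiable_const [intro]: "cdifferentiable_at (\<lambda>_. c) \<xi>"
  unfolding cdifferentiable_at_def by (intro exI[of _ "\<lambda>_. 0"]) auto

lemma cdifferentiable_apply [intro]: "cdifferentiable_at (\<lambda>\<xi>. blinfun_apply \<xi> w) \<xi>"
  unfolding cdifferentiable_at_def
  by (intro exI[of _ "\<lambda>h. blinfun_apply h w"])
     (auto intro!: bounded_linear_imp_has_derivative blinfun.bounded_linear_left)

lemma cdifferentiable_diff [intro]:
  assumes "cdifferentiable_at f \<xi>" "cdifferentiable_at g \<xi>"
  shows "cdifferentiable_at (\<lambda>\<xi>. f \<xi> - g \<xi>) \<xi>"
proof -
  obtain D E where "(f has_derivative D) (at \<xi>)" "(g has_derivative E) (at \<xi>)"
    "\<And>\<tau> h. D (cscale \<tau> h) = \<tau> * D h" "\<And>\<tau> h. E (cscale \<tau> h) = \<tau> * E h"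
    using assms unfolding cdifferentiable_at_def by metis
  then show ?thesis unfolding cdifferentiable_at_def
    by (intro exI[of _ "\<lambda>h. D h - E h"]) (auto intro!: derivative_eq_intros simp: algebra_simps)
qed

lemma cdifferentiable_mult [intro]:
  assumes "cdifferentiable_at f \<xi>" "cdifferentiable_at g \<xi>"
  shows "cdifferentiable_at (\<lambda>\<xi>. f \<xi> * g \<xi>) \<xi>"
proof -
  obtain D E where "(f has_derivative D) (at \<xi>)" "(g has_derivative E) (at \<xi>)"
    "\<And>\<tau> h. D (cscale \<tau> h) = \<tau> * D h" "\<And>\<tau> h. E (cscale \<tau> h) = \<tau> * E h"
    using assms unfolding cdifferentiable_at_def by metis
  then show ?thesis unfolding cdifferentiable_at_def
    by (intro exI[of _ "\<lambda>h. f \<xi> * E h + D h * g \<xi>"])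
       (auto intro!: derivative_eq_intros simp: algebra_simps)
qed

lemma cdifferentiable_exp [intro]:
  assumes "cdifferentiable_at f \<xi>"
  shows "cdifferentiable_at (\<lambda>\<xi>. exp (f \<xi>)) \<xi>"
proof -
  obtain D where D: "(f has_derivative D) (at \<xi>)" "\<And>\<tau> h. D (cscale \<tau> h) = \<tau> * D h"
    using assms unfolding cdifferentiable_at_def by metis
  have "((\<lambda>\<xi>. exp (f \<xi>)) has_derivative (\<lambda>h. D h * exp (f \<xi>))) (at \<xi>)"
    using has_derivative_compose[OF D(1) DERIV_exp[unfolded has_field_derivative_def]]
    by (simp add: mult.commute)
  then show ?thesis unfolding cdifferentiable_at_def
    using D(2) by (intro exI[of _ "\<lambda>h. D h * exp (f \<xi>)"]) auto
qed

lemma cdifferentiable_prod [intro]: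
  assumes "\<And>i. i \<in> I \<Longrightarrow> cdifferentiable_at (f i) \<xi>"
  shows "cdifferentiable_at (\<lambda>\<xi>. \<Prod>i\<in>I. f i \<xi>) \<xi>"
  using assms by (induction I rule: infinite_finite_induct) auto

lemma cdifferentiable_prod_list [intro]:
  "cdifferentiable_at (\<lambda>\<xi>. \<Prod>w\<leftarrow>ws. blinfun_apply \<xi> w) \<xi>"
  by (induction ws) auto

lemma cdifferentiable_line:
  assumes "cdifferentiable_at \<phi> (\<xi> + cscale z v)"
  shows "(\<lambda>z. \<phi> (\<xi> + cscale z v)) field_differentiable (at z)"
proof -
  obtain D where D: "(\<phi> has_derivative D) (at (\<xi> + cscale z v))" "\<And>\<tau> h. D (cscale \<tau> h) = \<tau> * D h"
    using assms unfolding cdifferentiable_at_def by metis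
  have "((\<lambda>z. \<xi> + cscale z v) has_derivative (\<lambda>\<tau>. cscale \<tau> v)) (at z)"
    by (auto intro!: derivative_eq_intros bounded_linear_imp_has_derivative bounded_linear_cscale)
  from has_derivative_compose[OF this D(1)]
  have "((\<lambda>z. \<phi> (\<xi> + cscale z v)) has_derivative (\<lambda>\<tau>. D v * \<tau>)) (at z)"
    by (simp add: D(2) mult.commute)
  then show ?thesis
    unfolding field_differentiable_def has_field_derivative_def by blast
qed

text \<open>Restrict \<phi> to the complex line through \<open>\<xi>0\<close> and \<xi>. The
  parameters that stay in the ball form an open convex set, so one-variable continuation carries the
  vanishing near parameter 0 to parameter 1.\<close>

lemma complex_identity_theorem:
  fixes \<phi> :: "'a::euclidean_space cdual \<Rightarrow> complex"
  assumes diff: "\<And>\<xi>. \<xi> \<in> ball 0 r \<Longrightarrow> cdifferentiable_at \<phi> \<xi>"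
    and U: "open U" "\<xi>0 \<in> U" "\<xi>0 \<in> ball 0 r" "\<And>\<xi>. \<xi> \<in> U \<Longrightarrow> \<phi> \<xi> = 0"
    and \<xi>: "\<xi> \<in> ball 0 r"
  shows "\<phi> \<xi> = 0"
proof -
  define l where "l z = \<xi>0 + cscale z (\<xi> - \<xi>0)" for z
  note lin = linear_simps[OF bounded_linear_cscale]
  have cont: "continuous_on UNIV l"
    unfolding l_def
    by (intro continuous_intros linear_continuous_on bounded_linear_cscale)
  have "convex (l -` ball 0 r)"
  proof (rule convexI)
    fix x y :: complex and a b :: real
    assume *: "x \<in> l -` ball 0 r" "y \<in> l -` ball 0 r" "0 \<le> a" "0 \<le> b" "a + b = 1"
    have "l (a *\<^sub>R x + b *\<^sub>R y) = a *\<^sub>R l x + b *\<^sub>R l y"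
    proof -
      have "\<xi>0 = a *\<^sub>R \<xi>0 + b *\<^sub>R \<xi>0" using *(5) by (metis scaleR_add_left scaleR_one)
      then show ?thesis unfolding l_def lin by (simp add: algebra_simps)
    qed
    then show "a *\<^sub>R x + b *\<^sub>R y \<in> l -` ball 0 r"
      using convexD[OF convex_ball[of 0 r], of "l x" "l y" a b] * by simp
  qed
  then have conn: "connected (l -` ball 0 r)" by (rule convex_connected)
  have op: "open (l -` ball 0 r)"
    using open_vimage[OF open_ball] cont by blast
  have hol: "(\<lambda>z. \<phi> (l z)) holomorphic_on (l -` ball 0 r)"
    unfolding holomorphic_on_def
  proof
    fix z assume "z \<in> l -` ball 0 r"
    then have "(\<lambda>z. \<phi> (l z)) field_differentiable (at z)"
      unfolding l_def by (intro cdifferentiable_line diff) (simp add: l_def)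
    then show "(\<lambda>z. \<phi> (l z)) field_differentiable (at z within l -` ball 0 r)"
      by (rule field_differentiable_at_within)
  qed
  have "open (l -` U)" using open_vimage[OF U(1)] cont by blast
  moreover have l0: "l 0 = \<xi>0" by (simp add: l_def lin)
  moreover have "cscale 1 (\<xi> - \<xi>0) = \<xi> - \<xi>0" by (rule blinfun_eqI) simp
  then have l1: "l 1 = \<xi>" by (simp add: l_def)
  ultimately have "\<forall>\<^sub>F z in nhds 0. \<phi> (l z) = 0"
    unfolding eventually_nhds using U by (intro exI[of _ "l -` U"]) auto
  then have "(\<lambda>z. \<phi> (l z)) has_fps_expansion 0" by (simp add: has_fps_expansion_0_iff)
  from has_fps_expansion_0_analytic_continuation[OF this hol op conn, of 1]
  show ?thesis using l0 l1 U(3) \<xi> by simp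
qed

text \<open>Hyperplanes are removed one at a time: a point on the new one is pushed off it along a
  covector that is nonzero at \<open>w\<close>, and a small push stays in the open set.\<close>

lemma open_avoid_hyperplanes:
  fixes U :: "'a::euclidean_space cdual set"
  assumes "finite W" "0 \<notin> W" "open U" "U \<noteq> {}"
  shows "open {\<xi>\<in>U. \<forall>w\<in>W. blinfun_apply \<xi> w \<noteq> 0} \<and> {\<xi>\<in>U. \<forall>w\<in>W. blinfun_apply \<xi> w \<noteq> 0} \<noteq> {}"
  using assms
proof (induction W rule: finite_induct)
  case (insert w W)
  define V where "V = {\<xi>\<in>U. \<forall>w\<in>W. blinfun_apply \<xi> w \<noteq> 0}"
  have V: "open V" "V \<noteq> {}" using insert by (auto simp: V_def)
  have w: "w \<noteq> 0" using insert by auto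
  have eq: "{\<xi>\<in>U. \<forall>w\<in>insert w W. blinfun_apply \<xi> w \<noteq> 0} = V \<inter> {\<xi>. blinfun_apply \<xi> w \<noteq> 0}"
    by (auto simp: V_def)
  have "open {\<xi> :: 'a cdual. blinfun_apply \<xi> w \<noteq> 0}"
    by (intro open_Collect_neq continuous_intros)
  moreover obtain \<xi> where \<xi>: "\<xi> \<in> V" using V by auto
  have "V \<inter> {\<xi>. blinfun_apply \<xi> w \<noteq> 0} \<noteq> {}"
  proof (cases "blinfun_apply \<xi> w = 0")
    case True
    \<comment> \<open>The inner product merely supplies some covector that does not vanish at
      \<open>w\<close>.\<close>
    define \<eta> :: "'a cdual" where "\<eta> = Blinfun (\<lambda>x. of_real (w \<bullet> x))"
    have \<eta>: "blinfun_apply \<eta> w = of_real (w \<bullet> w)"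
      unfolding \<eta>_def
      by (subst bounded_linear_Blinfun_apply)
         (auto intro!: bounded_linear_compose[OF bounded_linear_of_real] bounded_linear_inner_right)
    have "((\<lambda>t::real. \<xi> + t *\<^sub>R \<eta>) \<longlongrightarrow> \<xi> + 0 *\<^sub>R \<eta>) (at 0)"
      by (intro tendsto_intros)
    then have "\<forall>\<^sub>F t in at 0. \<xi> + t *\<^sub>R \<eta> \<in> V"
      using V(1) \<xi> by (intro topological_tendstoD) auto
    moreover have "\<forall>\<^sub>F t in at (0::real). t \<noteq> 0" by (auto simp: eventually_at_filter)
    ultimately have "\<forall>\<^sub>F t in at 0. \<xi> + t *\<^sub>R \<eta> \<in> V \<inter> {\<xi>. blinfun_apply \<xi> w \<noteq> 0}"
      by eventually_elim (use True \<eta> w in \<open>auto simp: blinfun.add_left blinfun.scaleR_left\<close>)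
    then have "\<exists>t. \<xi> + t *\<^sub>R \<eta> \<in> V \<inter> {\<xi>. blinfun_apply \<xi> w \<noteq> 0}"
      by (rule eventually_happens'[rotated]) simp
    then show ?thesis by auto
  qed (use \<xi> in auto)
  ultimately show ?case unfolding eq using V by auto
qed auto

text \<open>Clearing denominators leads to the function \<Phi>, holomorphic on a ball, to which the
  identity theorem applies. \<open>R\<close> has to approach 0 because the ball on which
  \<open>f\<close> is controlled is not known in advance.\<close>

lemma mero_eq_quotient_of_open:
  fixes f num den :: "'a::euclidean_space cdual \<Rightarrow> complex"
  assumes f: "f \<in> mero_linear_poles"
    and num: "\<And>\<xi>. cdifferentiable_at num \<xi>"
    and den: "\<And>\<xi>. cdifferentiable_at den \<xi>" "generic (\<lambda>\<xi>. den \<xi> \<noteq> 0)"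
    and R: "open R" "\<And>r. r > 0 \<Longrightarrow> R \<inter> ball 0 r \<noteq> {}"
    and eq: "generic (\<lambda>\<xi>. \<xi> \<in> R \<longrightarrow> f \<xi> = num \<xi> / den \<xi>)"
  shows "mero_eq f (\<lambda>\<xi>. num \<xi> / den \<xi>)"
proof -
  obtain \<phi> ws where \<phi>: "holomorphic_near_0 \<phi>" and ws: "0 \<notin> set ws"
    and f_eq: "generic (\<lambda>\<xi>. f \<xi> = \<phi> \<xi> / (\<Prod>w\<leftarrow>ws. blinfun_apply \<xi> w))"
    using f by (auto simp: mero_linear_poles_def mero_eq_iff_generic)
  define \<pi> where "\<pi> \<xi> = (\<Prod>w\<leftarrow>ws. blinfun_apply \<xi> w)" for \<xi> :: "'a cdual"
  have "generic (\<lambda>\<xi>. \<forall>w\<in>set ws. blinfun_apply \<xi> w \<noteq> 0)"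
    using ws by (intro generic_ball generic_nonzero) auto
  then have "generic (\<lambda>\<xi>. \<pi> \<xi> \<noteq> 0)"
    by (rule generic_mono) (auto simp: \<pi>_def prod_list_zero_iff)
  then have "generic (\<lambda>\<xi>. (\<xi> \<in> R \<longrightarrow> f \<xi> = num \<xi> / den \<xi>) \<and> den \<xi> \<noteq> 0 \<and> f \<xi> = \<phi> \<xi> / \<pi> \<xi> \<and> \<pi> \<xi> \<noteq> 0)"
    using f_eq den(2) eq unfolding \<pi>_def by (intro generic_conj)
  then obtain W where W: "finite W" "0 \<notin> W" "\<forall>\<^sub>F \<xi> in nhds 0. (\<forall>w\<in>W. blinfun_apply \<xi> w \<noteq> 0) \<longrightarrow>
       (\<xi> \<in> R \<longrightarrow> f \<xi> = num \<xi> / den \<xi>) \<and> den \<xi> \<noteq> 0 \<and> f \<xi> = \<phi> \<xi> / \<pi> \<xi> \<and> \<pi> \<xi> \<noteq> 0"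
    by (auto simp: generic_def)
  have "\<forall>\<^sub>F \<xi> in nhds 0. cdifferentiable_at \<phi> \<xi>"
    using \<phi> by (auto simp: holomorphic_near_0_def eventually_nhds cdifferentiable_at_def)
  from eventually_conj[OF this W(3)] obtain r where r: "r > 0"
    and diff: "\<And>\<xi>. \<xi> \<in> ball 0 r \<Longrightarrow> cdifferentiable_at \<phi> \<xi>"
    and gen: "\<And>\<xi>. \<xi> \<in> ball 0 r \<Longrightarrow> (\<forall>w\<in>W. blinfun_apply \<xi> w \<noteq> 0) \<Longrightarrow>
       (\<xi> \<in> R \<longrightarrow> f \<xi> = num \<xi> / den \<xi>) \<and> den \<xi> \<noteq> 0 \<and> f \<xi> = \<phi> \<xi> / \<pi> \<xi> \<and> \<pi> \<xi> \<noteq> 0"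
    unfolding eventually_nhds_metric by (auto simp: dist_commute)
  define U where "U = {\<xi>\<in>R \<inter> ball 0 r. \<forall>w\<in>W. blinfun_apply \<xi> w \<noteq> 0}"
  have U: "open U" "U \<noteq> {}"
    unfolding U_def using open_avoid_hyperplanes[OF W(1,2), of "R \<inter> ball 0 r"] R r by auto
  then obtain \<xi>0 where \<xi>0: "\<xi>0 \<in> U" by auto
  define \<Phi> where "\<Phi> \<xi> = \<phi> \<xi> * den \<xi> - num \<xi> * \<pi> \<xi>" for \<xi>
  have zero: "\<Phi> \<xi> = 0" if "\<xi> \<in> U" for \<xi>
    using that gen[of \<xi>] by (auto simp: U_def \<Phi>_def field_simps)
  have \<Phi>: "\<Phi> \<xi> = 0" if "\<xi> \<in> ball 0 r" for \<xi>
  proof (rule complex_identity_theorem[OF _ U(1) \<xi>0 _ zero that])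
    show "cdifferentiable_at \<Phi> \<xi>" if "\<xi> \<in> ball 0 r" for \<xi>
      unfolding \<Phi>_def \<pi>_def
      by (intro cdifferentiable_diff cdifferentiable_mult
          cdifferentiable_prod_list diff that num den)
  qed (use \<xi>0 in \<open>auto simp: U_def\<close>)
  have "(\<forall>w\<in>W. blinfun_apply \<xi> w \<noteq> 0) \<longrightarrow> f \<xi> = num \<xi> / den \<xi>" if "\<xi> \<in> ball 0 r" for \<xi>
    using \<Phi>[OF that] gen[OF that] by (auto simp: \<Phi>_def field_simps)
  then have "\<forall>\<^sub>F \<xi> in nhds 0. (\<forall>w\<in>W. blinfun_apply \<xi> w \<noteq> 0) \<longrightarrow> f \<xi> = num \<xi> / den \<xi>"
    unfolding eventually_nhds_metric using r by (intro exI[of _ r]) (auto simp: dist_commute)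
  then show ?thesis unfolding mero_eq_def using W(1,2) by blast
qed

section \<open>Rational cones and the generating function of one cone\<close>

lemma dual_lattice_minus: "\<gamma> \<in> dual_lattice \<Lambda> \<Longrightarrow> - \<gamma> \<in> dual_lattice \<Lambda>"
  by (auto simp: dual_lattice_def blinfun.minus_left)

lemma rational_cone_shift:
  assumes "rational_cone \<Lambda> Z"
  shows "semi_rational_polyhedron \<Lambda> (shift s Z)"
proof -
  obtain M where M: "finite M" "M \<subseteq> dual_lattice \<Lambda>" "Z = {x. \<forall>\<mu>\<in>M. blinfun_apply \<mu> x \<le> 0}"
    using assms by (auto simp: rational_cone_def)
  have "shift s Z = {x. \<forall>(\<mu>, b)\<in>(\<lambda>\<mu>. (\<mu>, blinfun_apply \<mu> s)) ` M. blinfun_apply \<mu> x \<le> b}" (is "_ = ?R")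
  proof -
    have "x \<in> shift s Z \<longleftrightarrow> x - s \<in> Z" for x unfolding shift_def by (force simp: image_iff)
    then show ?thesis unfolding M(3) by (auto simp: blinfun.diff_right)
  qed
  then show ?thesis unfolding semi_rational_polyhedron_def using M
    by (intro exI[of _ "(\<lambda>\<mu>. (\<mu>, blinfun_apply \<mu> s)) ` M"]) (auto simp: image_image)
qed

text \<open>Positive integral multiples cut out the same half-spaces; the minus sign translates
  lower bounds into the upper bounds of \<open>rational_cone\<close>.\<close>

lemma rational_cone_of_functionals:
  assumes "finite J" "\<And>j. j \<in> J \<Longrightarrow> \<exists>N::nat. N > 0 \<and> of_nat N *\<^sub>R \<zeta> j \<in> dual_lattice \<Lambda>"
  shows "rational_cone \<Lambda> {x. \<forall>j\<in>J. 0 \<le> \<zeta> j x}"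
proof -
  obtain N :: "_ \<Rightarrow> nat" where N: "\<And>j. j \<in> J \<Longrightarrow> N j > 0 \<and> of_nat (N j) *\<^sub>R \<zeta> j \<in> dual_lattice \<Lambda>"
    using assms(2) by metis
  define M where "M = (\<lambda>j. - (of_nat (N j) *\<^sub>R \<zeta> j)) ` J"
  have pos: "0 \<le> of_nat (N j) * r \<longleftrightarrow> 0 \<le> r" if "j \<in> J" for j and r :: real
    using N[OF that] by (simp add: zero_le_mult_iff)
  have "{x. \<forall>j\<in>J. 0 \<le> \<zeta> j x} = {x. \<forall>\<mu>\<in>M. blinfun_apply \<mu> x \<le> 0}"
    using pos by (simp add: M_def blinfun.minus_left blinfun.scaleR_left)
  moreover have "finite M" "M \<subseteq> dual_lattice \<Lambda>"
    using N assms(1) by (auto simp: M_def intro: dual_lattice_minus)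
  ultimately show ?thesis unfolding rational_cone_def by blast
qed

context cone_data
begin

lemma \<zeta>_rational_all:
  assumes "j \<in> A \<union> B"
  shows "\<exists>N::nat. N > 0 \<and> of_nat N *\<^sub>R \<zeta> j \<in> dual_lattice \<Lambda>"
proof (cases "j \<in> A")
  case False
  then show ?thesis using assms \<zeta>_dual[of j] by (intro exI[of _ 1]) auto
qed (rule \<zeta>_rational)

lemma rational_cone_K: "rational_cone \<Lambda> K"
  unfolding K_def by (rule rational_cone_of_functionals) (auto intro: \<zeta>_rational_all)

lemma u_nonzero: "j \<in> A \<union> B \<Longrightarrow> u j \<noteq> 0"
  using dual_family_apply[OF dual, of j j] by (auto simp: blinfun.zero_right)

lemma generic_u: "generic (\<lambda>\<xi>. \<forall>j\<in>A \<union> B. blinfun_apply \<xi> (u j) \<noteq> 0)"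
  using u_nonzero by (intro generic_ball generic_nonzero) auto

text \<open>The sum evaluates \<open>S\<close> only on the open cone \<open>R\<close> of covectors
  with negative real part on all edges. Membership in \<open>mero_linear_poles\<close> is what
  allows the formula to be continued to generic \<xi> near 0.\<close>

lemma S_shift_K:
  assumes S: "intermediate_generating_function \<Lambda> L S"
  shows "mero_eq (S (shift s K)) (generating s)"
proof -
  define den where "den \<xi> = (\<Prod>b\<in>A. blinfun_apply \<xi> (u b)) * (\<Prod>v\<in>B. 1 - exp (blinfun_apply \<xi> (u v)))"
    for \<xi> :: "'a cdual"
  define num where "num \<xi> = of_real \<kappa> *
     (\<Prod>b\<in>A. (- 1) * exp (of_real (\<zeta> b s) * blinfun_apply \<xi> (u b))) *
     (\<Prod>v\<in>B. exp (of_int \<lceil>\<zeta> v s\<rceil> * blinfun_apply \<xi> (u v)))" for \<xi> :: "'a cdual"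
  have gen_eq: "generating s \<xi> = num \<xi> / den \<xi>" for \<xi>
    unfolding generating_def L_factor_def num_def den_def prod_dividef by simp
  define R where "R = (\<Inter>j\<in>A \<union> B. {\<xi> :: 'a cdual. Re (blinfun_apply \<xi> (u j)) < 0})"
  have p: "semi_rational_polyhedron \<Lambda> (shift s K)"
    by (rule rational_cone_shift[OF rational_cone_K])
  have "mero_eq (S (shift s K)) (\<lambda>\<xi>. num \<xi> / den \<xi>)"
  proof (rule mero_eq_quotient_of_open)
    show "S (shift s K) \<in> mero_linear_poles"
      using S p by (simp add: intermediate_generating_function_def)
    show "cdifferentiable_at num \<xi>" "cdifferentiable_at den \<xi>" for \<xi>
      unfolding num_def den_def by (intro cdifferentiable_mult cdifferentiable_prod
        cdifferentiable_const cdifferentiable_exp cdifferentiable_apply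
        cdifferentiable_diff)+
    \<comment> \<open>Near 0 the zeros of 1 - exp z at nonzero multiples of 2 pi i are out of reach,
      so the denominator vanishes only on the hyperplanes of the edges.\<close>
    have "generic (\<lambda>\<xi>. \<forall>j\<in>A \<union> B. norm (blinfun_apply \<xi> (u j)) < 1)"
    proof (intro generic_ball generic_eventually)
      fix j
      have "((\<lambda>\<xi> :: 'a cdual. norm (blinfun_apply \<xi> (u j))) \<longlongrightarrow> norm (blinfun_apply (0 :: 'a cdual) (u j))) (nhds 0)"
        by (intro tendsto_norm blinfun.tendsto tendsto_const filterlim_ident)
      then show "\<forall>\<^sub>F \<xi> :: 'a cdual in nhds 0. norm (blinfun_apply \<xi> (u j)) < 1"
        by (intro order_tendstoD(2)) (auto simp: blinfun.zero_left)
    qed auto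
    from generic_conj[OF this generic_u] show "generic (\<lambda>\<xi>. den \<xi> \<noteq> 0)"
    proof (rule generic_mono)
      fix \<xi> :: "'a cdual"
      assume *: "(\<forall>j\<in>A \<union> B. norm (blinfun_apply \<xi> (u j)) < 1) \<and> (\<forall>j\<in>A \<union> B. blinfun_apply \<xi> (u j) \<noteq> 0)"
      have "exp z \<noteq> 1" if "norm z < 1" "z \<noteq> 0" for z :: complex
      proof
        assume "exp z = 1"
        then obtain n :: int where n: "Re z = 0" "Im z = of_int (2 * n) * pi" by (auto simp: exp_eq_1)
        have "\<bar>of_int (2 * n) * pi\<bar> < 1" using that(1) abs_Im_le_cmod[of z] n(2) by linarith
        moreover have "\<bar>of_int (2 * n) * pi\<bar> \<ge> 1" if "n \<noteq> 0"
        proof -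
          have "1 \<le> \<bar>of_int n :: real\<bar>" using that by linarith
          then show ?thesis using pi_ge_two mult_mono[of 1 "\<bar>of_int (2*n) :: real\<bar>" 1 pi]
            by (simp add: abs_mult)
        qed
        ultimately have "n = 0" by linarith
        then show False using n that(2) by (simp add: complex_eq_iff)
      qed
      then show "den \<xi> \<noteq> 0" using * by (auto simp: den_def eq_commute[of 1])
    qed
    show "open R" unfolding R_def
      by (intro open_INT ballI open_Collect_less continuous_intros) auto
    show "R \<inter> ball 0 r \<noteq> {}" if r: "r > 0" for r
    proof -
      \<comment> \<open>The sum of the dual functionals is 1 on every edge, so its small negative
        multiples lie in \<open>R\<close>.\<close>
      define \<eta> where "\<eta> = (\<Sum>j\<in>A \<union> B. \<zeta> j)"
      have \<eta>: "blinfun_apply \<eta> (u j) = 1" if "j \<in> A \<union> B" for j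
      proof -
        have "blinfun_apply \<eta> (u j) = (\<Sum>i\<in>A \<union> B. if i = j then 1 else 0)"
          unfolding \<eta>_def blinfun.sum_left using that
          by (intro sum.cong) (auto simp: dual_family_apply[OF dual])
        then show ?thesis using that by (simp add: sum.delta)
      qed
      define \<theta> :: "'a cdual" where "\<theta> = Blinfun (\<lambda>x. of_real (blinfun_apply \<eta> x))"
      have \<theta>: "blinfun_apply \<theta> x = of_real (blinfun_apply \<eta> x)" for x
        unfolding \<theta>_def
        by (subst bounded_linear_Blinfun_apply)
           (auto intro!: bounded_linear_compose[OF bounded_linear_of_real] blinfun.bounded_linear_right)
      define n where "n = norm \<theta> + 1"
      define t where "t = r / (2 * n)"
      have n: "n > 0" "norm \<theta> \<le> n" by (simp_all add: n_def add_nonneg_pos)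
      then have t: "t > 0" using r by (simp add: t_def)
      have "norm (- t *\<^sub>R \<theta>) < r"
      proof -
        have "t * norm \<theta> \<le> t * n" using t n by simp
        also have "\<dots> = r / 2" unfolding t_def using n by simp
        finally show ?thesis using t r by simp
      qed
      moreover have "- t *\<^sub>R \<theta> \<in> R" unfolding R_def
        using t by (auto simp: blinfun.minus_left blinfun.scaleR_left \<theta> \<eta>)
      ultimately have "- t *\<^sub>R \<theta> \<in> R \<inter> ball 0 r" by simp
      then show ?thesis by blast
    qed
    have "mero_eq (S (shift s K)) (\<lambda>\<xi>. if intermediate_sum_converges \<Lambda> L (shift s K) \<xi>
                            then intermediate_sum \<Lambda> L (shift s K) \<xi> else S (shift s K) \<xi>)"
      using S p unfolding intermediate_generating_function_def by blast
    then show "generic (\<lambda>\<xi>. \<xi> \<in> R \<longrightarrow> S (shift s K) \<xi> = num \<xi> / den \<xi>)"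
      unfolding mero_eq_iff_generic
    proof (rule generic_mono, intro impI)
      fix \<xi> assume eq: "S (shift s K) \<xi> = (if intermediate_sum_converges \<Lambda> L (shift s K) \<xi>
          then intermediate_sum \<Lambda> L (shift s K) \<xi> else S (shift s K) \<xi>)" and "\<xi> \<in> R"
      then have "Re (blinfun_apply \<xi> (u j)) < 0" if "j \<in> A \<union> B" for j
        using that by (auto simp: R_def)
      then show "S (shift s K) \<xi> = num \<xi> / den \<xi>"
        using intermediate_sum[of \<xi> s] eq by (simp add: gen_eq)
    qed
  qed
  then show ?thesis by (simp add: gen_eq[abs_def] gen_eq)
qed

end

section \<open>Laurent expansions\<close>

text \<open>The inverted series is (1 - exp z) / z, so these are the coefficients of z / (1 - exp
  z), that is -B_n / n! with Bernoulli numbers normalised by B_1 = -1/2.\<close>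

definition exp_quotient_coeff :: "nat \<Rightarrow> complex" where
  "exp_quotient_coeff = fps_nth (inverse (Abs_fps (\<lambda>n. - 1 / fact (Suc n))))"

text \<open>The expansion of \<open>z / (1 - exp z)\<close> at \<open>z = x \<tau>\<close>, as a power series in \<open>\<tau>\<close>.\<close>

definition exp_quotient_fps :: "complex \<Rightarrow> complex fps" where
  "exp_quotient_fps x = Abs_fps (\<lambda>n. x ^ n * exp_quotient_coeff n)"

lemma exp_quotient_coeff_0: "exp_quotient_coeff 0 = - 1"
  by (simp add: exp_quotient_coeff_def)

lemma exp_quotient_fps_mult:
  "exp_quotient_fps x * (1 - fps_exp x) = fps_X * fps_const x"
proof -
  define Q where "Q = Abs_fps (\<lambda>n. - 1 / fact (Suc n) :: complex)"
  \<comment> \<open>Substituting x z for z multiplies the n-th coefficient of a product by x^n, so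
    the rescaled series stay inverse to each other; this covers x = 0 as well.\<close>
  define Qx where "Qx = Abs_fps (\<lambda>n. x ^ n * fps_nth Q n)"
  have e: "1 - fps_exp x = fps_X * (fps_const x * Qx)"
  proof (rule fps_ext)
    fix n show "fps_nth (1 - fps_exp x) n = fps_nth (fps_X * (fps_const x * Qx)) n"
      by (cases n) (auto simp: Qx_def Q_def distrib_right)
  qed
  have "exp_quotient_fps x * Qx = 1"
  proof (rule fps_ext)
    fix n
    have "inverse Q * Q = 1" by (rule inverse_mult_eq_1) (simp add: Q_def)
    then have "(\<Sum>i=0..n. exp_quotient_coeff i * fps_nth Q (n - i)) = fps_nth 1 n"
      unfolding exp_quotient_coeff_def Q_def[symmetric] fps_mult_nth[symmetric] by simp
    moreover have "fps_nth (exp_quotient_fps x * Qx) n =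
        (\<Sum>i=0..n. x ^ n * (exp_quotient_coeff i * fps_nth Q (n - i)))"
      unfolding fps_mult_nth
      by (intro sum.cong) (auto simp: exp_quotient_fps_def Qx_def mult_ac simp flip: power_add)
    ultimately have "fps_nth (exp_quotient_fps x * Qx) n = x ^ n * fps_nth 1 n"
      by (simp add: sum_distrib_left[symmetric])
    then show "fps_nth (exp_quotient_fps x * Qx) n = fps_nth 1 n" by (cases n) auto
  qed
  moreover have "exp_quotient_fps x * (1 - fps_exp x) = fps_X * fps_const x * (exp_quotient_fps x * Qx)"
    unfolding e by (simp only: mult_ac)
  ultimately show ?thesis by simp
qed

lemma fls_shift_fps_X_mult: "fls_shift 1 (fps_to_fls (fps_X * f)) = fps_to_fls (f :: complex fps)"
proof (rule fls_eqI)
  fix n :: int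
  have "nat (n + 1) = Suc (nat n)" if "n \<ge> 0" using that by simp
  then show "fls_nth (fls_shift 1 (fps_to_fls (fps_X * f))) n = fls_nth (fps_to_fls f) n"
    by (cases "n = -1") auto
qed

text \<open>The candidate is verified by multiplying back with the denominator, which is nonzero
  because its coefficient of degree 1 is -x. The shift by 1 records the simple pole.\<close>

lemma has_laurent_expansion_exp_quotient:
  fixes x c :: complex
  assumes "x \<noteq> 0"
  shows "(\<lambda>\<tau>. exp (c * (\<tau> * x)) / (1 - exp (\<tau> * x))) has_laurent_expansion
     fls_shift 1 (fps_to_fls (fps_const (1 / x) * (fps_exp (c * x) * exp_quotient_fps x)))"
    (is "_ has_laurent_expansion ?R")
proof -
  have nz: "fps_to_fls (1 - fps_exp x) \<noteq> 0"
  proof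
    assume "fps_to_fls (1 - fps_exp x) = 0"
    then have "fls_nth (fps_to_fls (1 - fps_exp x)) 1 = 0" by (simp only: fls_zero_nth)
    then show False using assms by simp
  qed
  have "?R * fps_to_fls (1 - fps_exp x) = fls_shift 1 (fps_to_fls
      (fps_const (1 / x) * (fps_exp (c * x) * exp_quotient_fps x) * (1 - fps_exp x)))"
    by (simp only: fls_shifted_times_simps fls_times_fps_to_fls)
  also have "fps_const (1 / x) * (fps_exp (c * x) * exp_quotient_fps x) * (1 - fps_exp x) =
     fps_const (1 / x) * fps_exp (c * x) * (exp_quotient_fps x * (1 - fps_exp x))"
    by (simp only: mult_ac)
  also have "\<dots> = fps_X * ((fps_const (1 / x) * fps_const x) * fps_exp (c * x))"
    unfolding exp_quotient_fps_mult by (simp only: mult_ac)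
  also have "fps_const (1 / x) * fps_const x = 1" using assms by simp
  finally have eq: "?R * fps_to_fls (1 - fps_exp x) = fps_to_fls (fps_exp (c * x))"
    by (simp add: fls_shift_fps_X_mult)
  have "(\<lambda>\<tau>. exp ((c * x) * \<tau>) / (1 - exp (x * \<tau>))) has_laurent_expansion
      fps_to_fls (fps_exp (c * x)) / fps_to_fls (1 - fps_exp x)"
    by (intro has_laurent_expansion_divide has_laurent_expansion_fps has_fps_expansion_exp
        has_fps_expansion_diff has_fps_expansion_1)
  also have "fps_to_fls (fps_exp (c * x)) / fps_to_fls (1 - fps_exp x) = ?R"
    unfolding eq[symmetric] using nz by (rule nonzero_mult_div_cancel_right)
  finally show ?thesis by (simp add: mult_ac)
qed

lemma has_laurent_expansion_prod_shift:
  assumes "finite I" "\<And>i. i \<in> I \<Longrightarrow> f i has_laurent_expansion fls_shift 1 (fps_to_fls (F i))"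
  shows "(\<lambda>\<tau>. \<Prod>i\<in>I. f i \<tau>) has_laurent_expansion fls_shift (int (card I)) (fps_to_fls (\<Prod>i\<in>I. F i))"
  using assms
proof (induction I rule: finite_induct)
  case (insert i I)
  have "(\<lambda>\<tau>. f i \<tau> * (\<Prod>i\<in>I. f i \<tau>)) has_laurent_expansion
     fls_shift 1 (fps_to_fls (F i)) * fls_shift (int (card I)) (fps_to_fls (\<Prod>i\<in>I. F i))"
    by (intro has_laurent_expansion_mult insert) auto
  then show ?case using insert(1,2)
    by (simp add: fls_times_both_shifted_simp fls_times_fps_to_fls add.commute)
qed auto

lemma hom_component_eq:
  "(\<lambda>\<tau>. f (cscale \<tau> \<xi>)) has_laurent_expansion F \<Longrightarrow> hom_component m f \<xi> = fls_nth F m"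
  by (simp add: hom_component_def laurent_expansion_0_eqI)

lemma neg_frac_eq_ceiling: "frac (- t) = of_int \<lceil>t\<rceil> - (t :: real)"
  by (simp add: frac_def ceiling_def)

section \<open>The Laurent series of one cone\<close>

context cone_data
begin

definition M_num :: "'a cdual \<Rightarrow> complex" where
  "M_num \<xi> = of_real \<kappa> * (- 1) ^ card A / (\<Prod>j\<in>A \<union> B. blinfun_apply \<xi> (u j))"

text \<open>A series in \<tau> along the line through \<xi>. Its n-th coefficient is homogeneous of
  degree n in \<xi> and contains products of at most n fractional parts; this coupling produces the
  bound m + d.\<close>

definition M_fps :: "'a \<Rightarrow> 'a cdual \<Rightarrow> complex fps" where
  "M_fps s \<xi> = (\<Prod>v\<in>B. fps_exp (of_real (frac (- \<zeta> v s)) * blinfun_apply \<xi> (u v)) *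
     exp_quotient_fps (blinfun_apply \<xi> (u v)))"

text \<open>Write <\<xi>,s> in edge coordinates. Along L the exponential cancels the start of each
  half-line integral completely; in the \<open>B\<close> directions it leaves the distance from the
  coordinate up to its ceiling, which is \<open>frac\<close> of the negated coordinate.\<close>

lemma exp_neg_generating:
  assumes "\<And>j. j \<in> A \<union> B \<Longrightarrow> blinfun_apply \<xi> (u j) \<noteq> 0"
  shows "exp (- blinfun_apply \<xi> s) * generating s \<xi> = of_real \<kappa> * (\<Prod>b\<in>A. - 1 / blinfun_apply \<xi> (u b)) *
     (\<Prod>v\<in>B. exp (of_real (frac (- \<zeta> v s)) * blinfun_apply \<xi> (u v)) /
        (1 - exp (blinfun_apply \<xi> (u v))))"
proof -
  have "blinfun_apply \<xi> s = (\<Sum>b\<in>A. of_real (\<zeta> b s) * blinfun_apply \<xi> (u b)) +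
       (\<Sum>v\<in>B. of_real (\<zeta> v s) * blinfun_apply \<xi> (u v))"
    by (subst expand[of s])
       (simp only: blinfun.add_right blinfun_sum_right blinfun.scaleR_right scaleR_conv_of_real)
  then have e: "exp (- blinfun_apply \<xi> s) =
     (\<Prod>b\<in>A. exp (- (of_real (\<zeta> b s) * blinfun_apply \<xi> (u b)))) *
     (\<Prod>v\<in>B. exp (- (of_real (\<zeta> v s) * blinfun_apply \<xi> (u v))))"
    by (simp add: exp_sum exp_diff exp_minus divide_inverse flip: prod_inversef)
  have 1: "(\<Prod>b\<in>A. exp (- (of_real (\<zeta> b s) * blinfun_apply \<xi> (u b)))) *
    (\<Prod>b\<in>A. - exp (of_real (\<zeta> b s) * blinfun_apply \<xi> (u b)) / blinfun_apply \<xi> (u b)) =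
    (\<Prod>b\<in>A. - 1 / blinfun_apply \<xi> (u b))"
    unfolding prod.distrib[symmetric]
    by (intro prod.cong refl) (simp flip: exp_add)
  have 2: "(\<Prod>v\<in>B. exp (- (of_real (\<zeta> v s) * blinfun_apply \<xi> (u v)))) *
     (\<Prod>v\<in>B. exp (of_int \<lceil>\<zeta> v s\<rceil> * blinfun_apply \<xi> (u v)) / (1 - exp (blinfun_apply \<xi> (u v)))) =
     (\<Prod>v\<in>B. exp (of_real (frac (- \<zeta> v s)) * blinfun_apply \<xi> (u v)) /
        (1 - exp (blinfun_apply \<xi> (u v))))"
    unfolding prod.distrib[symmetric]
    by (intro prod.cong refl) (simp add: neg_frac_eq_ceiling algebra_simps flip: exp_add)
  show ?thesis unfolding e generating_def L_factor_def 1[symmetric] 2[symmetric] by (simp only: mult_ac)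
qed

text \<open>Each label gives a factor with a simple pole; their number is the dimension by
  \<open>dual_family_card\<close>, which is the total shift.\<close>

lemma has_laurent_expansion_generating:
  assumes nz: "\<And>j. j \<in> A \<union> B \<Longrightarrow> blinfun_apply \<xi> (u j) \<noteq> 0"
  shows "(\<lambda>\<tau>. exp (- blinfun_apply (cscale \<tau> \<xi>) s) * generating s (cscale \<tau> \<xi>)) has_laurent_expansion
     fls_shift (int DIM('a)) (fps_to_fls (fps_const (M_num \<xi>) * M_fps s \<xi>))"
proof -
  define x where "x j = blinfun_apply \<xi> (u j)" for j
  define cc where "cc v = complex_of_real (frac (- \<zeta> v s))" for v
  have A: "(\<lambda>\<tau>. \<Prod>b\<in>A. - 1 / (\<tau> * x b)) has_laurent_expansion
     fls_shift (int (card A)) (fps_to_fls (\<Prod>b\<in>A. fps_const (- 1 / x b)))"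
  proof (intro has_laurent_expansion_prod_shift finite_A)
    fix b assume "b \<in> A"
    then have "(\<lambda>\<tau>. (- 1 / x b) * inverse \<tau>) has_laurent_expansion fls_const (- 1 / x b) * inverse fls_X"
      by (intro has_laurent_expansion_mult has_laurent_expansion_const has_laurent_expansion_inverse
         has_laurent_expansion_fps_X)
    also have "fls_const (- 1 / x b) * inverse fls_X = fls_shift 1 (fps_to_fls (fps_const (- 1 / x b)))"
      by (simp add: fls_inverse_X fls_X_inv_times_conv_shift)
    finally show "(\<lambda>\<tau>. - 1 / (\<tau> * x b)) has_laurent_expansion fls_shift 1 (fps_to_fls (fps_const (- 1 / x b)))"
      by (simp add: field_simps)
  qed
  have B: "(\<lambda>\<tau>. \<Prod>v\<in>B. exp (cc v * (\<tau> * x v)) / (1 - exp (\<tau> * x v))) has_laurent_expansion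
     fls_shift (int (card B)) (fps_to_fls
       (\<Prod>v\<in>B. fps_const (1 / x v) * (fps_exp (cc v * x v) * exp_quotient_fps (x v))))"
    using nz by (intro has_laurent_expansion_prod_shift has_laurent_expansion_exp_quotient finite_B)
                (auto simp: x_def)
  have card: "int (card A) + int (card B) = int DIM('a)"
    using dual_family_card[OF dual] disjoint by (simp add: card_Un_disjoint)
  have "(\<lambda>\<tau>. of_real \<kappa> * ((\<Prod>b\<in>A. - 1 / (\<tau> * x b)) * (\<Prod>v\<in>B. exp (cc v * (\<tau> * x v)) / (1 - exp (\<tau> * x v)))))
     has_laurent_expansion fls_const (of_real \<kappa>) * (fls_shift (int (card A)) (fps_to_fls (\<Prod>b\<in>A. fps_const (- 1 / x b))) *
       fls_shift (int (card B)) (fps_to_fls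
       (\<Prod>v\<in>B. fps_const (1 / x v) * (fps_exp (cc v * x v) * exp_quotient_fps (x v)))))"
    by (intro has_laurent_expansion_mult has_laurent_expansion_const A B)
  also have "\<dots> = fls_shift (int DIM('a)) (fps_to_fls (fps_const (of_real \<kappa>) * ((\<Prod>b\<in>A. fps_const (- 1 / x b)) *
       (\<Prod>v\<in>B. fps_const (1 / x v) * (fps_exp (cc v * x v) * exp_quotient_fps (x v))))))"
    unfolding fls_times_both_shifted_simp card fls_shifted_times_simps fls_times_fps_to_fls
    by (simp add: fps_const_to_fls flip: card)
  also have "fps_const (of_real \<kappa>) * ((\<Prod>b\<in>A. fps_const (- 1 / x b)) *
       (\<Prod>v\<in>B. fps_const (1 / x v) * (fps_exp (cc v * x v) * exp_quotient_fps (x v)))) =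
       fps_const (M_num \<xi>) * M_fps s \<xi>"
  proof -
    have pc: "(\<Prod>i\<in>I. fps_const (f i)) = fps_const (\<Prod>i\<in>I. f i :: complex)" if "finite I" for I :: "'a set" and f
      using that by (induction I rule: finite_induct) (auto simp: fps_const_mult)
    have "(\<Prod>b\<in>A. - 1 / x b) * (\<Prod>v\<in>B. 1 / x v) = (- 1) ^ card A / (\<Prod>j\<in>A \<union> B. x j)"
    proof -
      have "(\<Prod>b\<in>A. - 1 / x b) = (- 1) ^ card A / (\<Prod>b\<in>A. x b)"
        by (subst prod_dividef) simp
      moreover have "(\<Prod>v\<in>B. 1 / x v) = 1 / (\<Prod>v\<in>B. x v)"
        by (subst prod_dividef) simp
      ultimately show ?thesis using disjoint by (simp add: prod.union_disjoint)
    qed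
    then have "fps_const (M_num \<xi>) = fps_const (of_real \<kappa>) * (fps_const (\<Prod>b\<in>A. - 1 / x b) * fps_const (\<Prod>v\<in>B. 1 / x v))"
      by (simp add: M_num_def x_def fps_const_mult)
    then show ?thesis unfolding M_fps_def prod.distrib pc[OF finite_A] pc[OF finite_B] x_def cc_def
      by (simp only: mult_ac)
  qed
  finally have main: "(\<lambda>\<tau>. of_real \<kappa> * ((\<Prod>b\<in>A. - 1 / (\<tau> * x b)) *
      (\<Prod>v\<in>B. exp (cc v * (\<tau> * x v)) / (1 - exp (\<tau> * x v))))) has_laurent_expansion
     fls_shift (int DIM('a)) (fps_to_fls (fps_const (M_num \<xi>) * M_fps s \<xi>))" .
  have "\<forall>\<^sub>F \<tau> in at 0. of_real \<kappa> * ((\<Prod>b\<in>A. - 1 / (\<tau> * x b)) *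
      (\<Prod>v\<in>B. exp (cc v * (\<tau> * x v)) / (1 - exp (\<tau> * x v)))) =
      exp (- blinfun_apply (cscale \<tau> \<xi>) s) * generating s (cscale \<tau> \<xi>)"
  proof -
    have "\<forall>\<^sub>F \<tau> in at (0::complex). \<tau> \<noteq> 0" by (auto simp: eventually_at_filter)
    then show ?thesis
    proof eventually_elim
      case (elim \<tau>)
      have "blinfun_apply (cscale \<tau> \<xi>) (u j) \<noteq> 0" if "j \<in> A \<union> B" for j
        using nz[OF that] elim by simp
      from exp_neg_generating[OF this] show ?case
        by (simp add: x_def cc_def mult.assoc)
    qed
  qed
  from has_laurent_expansion_cong[OF this refl] main show ?thesis by blast
qed

text \<open>Every factor starts with \<open>exp_quotient_coeff 0\<close>, which is -1, and
  fractional parts enter only in higher degrees. This is why the lowest component is independent of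
  \<open>s\<close>.\<close>

lemma M_fps_0: "fps_nth (M_fps s \<xi>) 0 = (- 1) ^ card B"
proof -
  have "fps_nth (\<Prod>v\<in>I. f v) 0 = (\<Prod>v\<in>I. fps_nth (f v) 0)" for f :: "'a \<Rightarrow> complex fps" and I
    by (induction I rule: infinite_finite_induct) auto
  then show ?thesis unfolding M_fps_def by (simp add: exp_quotient_fps_def exp_quotient_coeff_0)
qed

end

section \<open>Tensor products of function spaces\<close>

text \<open>The function spaces are defined by sums over initial segments of the naturals; this
  admits sums over arbitrary finite sets, such as products and disjoint unions of index
  sets.\<close>

lemma sum_over_nat_index:
  fixes I :: "'i set"
  assumes "finite I"
  obtains h :: "nat \<Rightarrow> 'i" where "\<And>i. i < card I \<Longrightarrow> h i \<in> I"
    "\<And>G :: 'i \<Rightarrow> 'b::comm_monoid_add. (\<Sum>i\<in>I. G i) = (\<Sum>i<card I. G (h i))"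
proof -
  obtain h where h: "bij_betw h {..<card I} I"
    using ex_bij_betw_nat_finite[OF assms] by (auto simp: atLeast0LessThan)
  show ?thesis
    by (rule that[of h]) (use h in \<open>auto simp: bij_betw_def\<close>, rule sum.reindex_bij_betw[OF h, symmetric])
qed

lemma tensorI:
  assumes "finite I" "\<And>i. i \<in> I \<Longrightarrow> f i \<in> X \<and> g i \<in> Y"
    and F: "\<And>s \<xi>. F s \<xi> = (\<Sum>i\<in>I. of_real (f i s) * g i \<xi>)"
  shows "F \<in> tensor X Y"
proof -
  obtain h where h: "\<And>i. i < card I \<Longrightarrow> h i \<in> I"
    and sum: "\<And>G :: _ \<Rightarrow> complex. (\<Sum>i\<in>I. G i) = (\<Sum>i<card I. G (h i))"
    using sum_over_nat_index[OF assms(1)] by metis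
  have "F = (\<lambda>s \<xi>. \<Sum>i<card I. of_real (f (h i) s) * g (h i) \<xi>)"
    unfolding fun_eq_iff F by (intro allI sum)
  moreover have "\<forall>i<card I. f (h i) \<in> X \<and> g (h i) \<in> Y"
    using h assms(2) by blast
  ultimately show ?thesis unfolding tensor_def
    by (auto intro!: exI[of _ "card I"] exI[of _ "\<lambda>i. f (h i)"] exI[of _ "\<lambda>i. g (h i)"])
qed

lemma tensor_induct [consumes 1, case_names zero add]:
  assumes "F \<in> tensor X Y" and 0: "P (\<lambda>s \<xi>. 0)"
    and add: "\<And>f g G. f \<in> X \<Longrightarrow> g \<in> Y \<Longrightarrow> P G \<Longrightarrow> P (\<lambda>s \<xi>. G s \<xi> + of_real (f s) * g \<xi>)"
  shows "P F"
proof -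
  obtain n :: nat and f g where n: "\<forall>i<n. f i \<in> X \<and> g i \<in> Y"
    and F: "F = (\<lambda>s \<xi>. \<Sum>i<n. of_real (f i s) * g i \<xi>)"
    using assms(1) unfolding tensor_def by auto
  show ?thesis unfolding F using n by (induction n) (simp_all add: 0 add)
qed

lemma tensor_single: "f \<in> X \<Longrightarrow> g \<in> Y \<Longrightarrow> (\<lambda>s \<xi>. of_real (f s) * g \<xi>) \<in> tensor X Y"
  by (rule tensorI[of "{()}" "\<lambda>_. f" _ "\<lambda>_. g"]) auto

lemma tensor_zero: "(\<lambda>s \<xi>. 0) \<in> tensor X Y"
  by (rule tensorI[of "{} :: nat set"]) auto

lemma tensor_add:
  assumes "F \<in> tensor X Y" "F' \<in> tensor X Y"
  shows "(\<lambda>s \<xi>. F s \<xi> + F' s \<xi>) \<in> tensor X Y"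
proof -
  obtain n n' :: nat and f f' g g' where "\<forall>i<n. f i \<in> X \<and> g i \<in> Y" "\<forall>i<n'. f' i \<in> X \<and> g' i \<in> Y"
    "F = (\<lambda>s \<xi>. \<Sum>i<n. of_real (f i s) * g i \<xi>)" "F' = (\<lambda>s \<xi>. \<Sum>i<n'. of_real (f' i s) * g' i \<xi>)"
    using assms unfolding tensor_def by auto
  then show ?thesis
    by (intro tensorI[of "{..<n} <+> {..<n'}" "case_sum f f'" _ "case_sum g g'"]) (auto simp: sum.Plus)
qed

lemma tensor_sum:
  assumes "finite I" "\<And>i. i \<in> I \<Longrightarrow> F i \<in> tensor X Y"
  shows "(\<lambda>s \<xi>. \<Sum>i\<in>I. F i s \<xi>) \<in> tensor X Y"
  using assms by (induction I rule: finite_induct) (auto intro: tensor_zero tensor_add)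

lemma tensor_mult:
  assumes F: "F \<in> tensor X Y" and F': "F' \<in> tensor X' Y'"
    and X: "\<And>f f'. f \<in> X \<Longrightarrow> f' \<in> X' \<Longrightarrow> (\<lambda>s. f s * f' s) \<in> X''"
    and Y: "\<And>g g'. g \<in> Y \<Longrightarrow> g' \<in> Y' \<Longrightarrow> (\<lambda>\<xi>. g \<xi> * g' \<xi>) \<in> Y''"
  shows "(\<lambda>s \<xi>. F s \<xi> * F' s \<xi>) \<in> tensor X'' Y''"
proof -
  have single: "(\<lambda>s \<xi>. of_real (f s) * g \<xi> * F' s \<xi>) \<in> tensor X'' Y''" if "f \<in> X" "g \<in> Y" for f g
    using F'
  proof (induction rule: tensor_induct)
    case (add f' g' G)
    from tensor_add[OF add(3) tensor_single[OF X[OF that(1) add(1)] Y[OF that(2) add(2)]]]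
    show ?case by (simp add: algebra_simps)
  qed (simp add: tensor_zero)
  show ?thesis using F
    by (induction rule: tensor_induct) (simp_all add: tensor_zero ring_distribs tensor_add single)
qed

lemma tensor_mono: "F \<in> tensor X Y \<Longrightarrow> X \<subseteq> X' \<Longrightarrow> F \<in> tensor X' Y"
  unfolding tensor_def by blast

lemma tensor_map:
  assumes F: "F \<in> tensor X Y" and h: "\<And>g. g \<in> Y \<Longrightarrow> (\<lambda>\<xi>. h \<xi> * g \<xi>) \<in> Y'"
  shows "(\<lambda>s \<xi>. h \<xi> * F s \<xi>) \<in> tensor X Y'"
  using F
proof (induction rule: tensor_induct)
  case (add f g G)
  from tensor_add[OF add(3) tensor_single[OF add(1) h[OF add(2)]]] show ?case
    by (simp add: algebra_simps)
qed (simp add: tensor_zero)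

section \<open>Step-polynomials, homogeneous rational functions and quasi-polynomials\<close>

lemma step_polyI:
  assumes "finite I" "\<And>i. i \<in> I \<Longrightarrow> set (hs i) \<subseteq> \<Psi> \<and> int (length (hs i)) \<le> k"
    and f: "\<And>s. f s = (\<Sum>i\<in>I. a i * (\<Prod>\<eta>\<leftarrow>hs i. frac (blinfun_apply \<eta> s)))"
  shows "f \<in> step_poly \<Psi> k"
proof -
  obtain h where h: "\<And>i. i < card I \<Longrightarrow> h i \<in> I"
    and sum: "\<And>G :: _ \<Rightarrow> real. (\<Sum>i\<in>I. G i) = (\<Sum>i<card I. G (h i))"
    using sum_over_nat_index[OF assms(1)] by metis
  have "f = (\<lambda>s. \<Sum>i<card I. a (h i) * (\<Prod>\<eta>\<leftarrow>hs (h i). frac (blinfun_apply \<eta> s)))"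
    unfolding fun_eq_iff f by (intro allI sum)
  moreover have "\<forall>i<card I. set (hs (h i)) \<subseteq> \<Psi> \<and> int (length (hs (h i))) \<le> k"
    using h assms(2) by blast
  ultimately show ?thesis unfolding step_poly_def
    by (auto intro!: exI[of _ "card I"] exI[of _ "\<lambda>i. a (h i)"] exI[of _ "\<lambda>i. hs (h i)"])
qed

lemma step_poly_mult:
  assumes "f \<in> step_poly \<Psi> k" "g \<in> step_poly \<Psi> l"
  shows "(\<lambda>s. f s * g s) \<in> step_poly \<Psi> (k + l)"
proof -
  obtain n :: nat and a hs where 1: "\<And>i. i < n \<Longrightarrow> set (hs i) \<subseteq> \<Psi> \<and> int (length (hs i)) \<le> k"
    "f = (\<lambda>s. \<Sum>i<n. a i * (\<Prod>\<eta>\<leftarrow>hs i. frac (blinfun_apply \<eta> s)))"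
    using assms(1) unfolding step_poly_def by auto
  obtain n' :: nat and a' hs' where 2: "\<And>i. i < n' \<Longrightarrow> set (hs' i) \<subseteq> \<Psi> \<and> int (length (hs' i)) \<le> l"
    "g = (\<lambda>s. \<Sum>i<n'. a' i * (\<Prod>\<eta>\<leftarrow>hs' i. frac (blinfun_apply \<eta> s)))"
    using assms(2) unfolding step_poly_def by auto
  show ?thesis
  proof (rule step_polyI[of "{..<n} \<times> {..<n'}" "\<lambda>(i, j). hs i @ hs' j" _ _ _ "\<lambda>(i, j). a i * a' j"])
    show "f s * g s = (\<Sum>i\<in>{..<n} \<times> {..<n'}. (case i of (i, j) \<Rightarrow> a i * a' j) *
         (\<Prod>\<eta>\<leftarrow>(case i of (i, j) \<Rightarrow> hs i @ hs' j). frac (blinfun_apply \<eta> s)))" for s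
      unfolding 1(2) 2(2) sum_product sum.cartesian_product by (intro sum.cong) (auto simp: mult_ac)
  next
    fix ij assume "ij \<in> {..<n} \<times> {..<n'}"
    then obtain i j where "ij = (i, j)" "i < n" "j < n'" by auto
    then show "set (case ij of (i, j) \<Rightarrow> hs i @ hs' j) \<subseteq> \<Psi> \<and>
        int (length (case ij of (i, j) \<Rightarrow> hs i @ hs' j)) \<le> k + l"
      using 1(1)[of i] 2(1)[of j] by simp
  qed auto
qed

lemma step_poly_mono:
  assumes "k \<le> l"
  shows "step_poly \<Psi> k \<subseteq> step_poly \<Psi> l"
proof
  fix f assume "f \<in> step_poly \<Psi> k"
  then obtain n :: nat and a hs where 1: "\<And>i. i < n \<Longrightarrow> set (hs i) \<subseteq> \<Psi> \<and> int (length (hs i)) \<le> k"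
    "f = (\<lambda>s. \<Sum>i<n. a i * (\<Prod>\<eta>\<leftarrow>hs i. frac (blinfun_apply \<eta> s)))"
    unfolding step_poly_def by auto
  show "f \<in> step_poly \<Psi> l"
  proof (rule step_polyI[of "{..<n}" hs _ _ _ a])
    show "set (hs i) \<subseteq> \<Psi> \<and> int (length (hs i)) \<le> l" if "i \<in> {..<n}" for i
      using 1(1)[of i] that assms by simp
  qed (simp_all add: 1(2))
qed

lemma step_poly_const: "(\<lambda>_. c) \<in> step_poly \<Psi> 0"
  by (rule step_polyI[of "{()}" "\<lambda>_. []" _ _ _ "\<lambda>_. c"]) auto

lemma step_poly_frac_power:
  assumes "\<eta> \<in> \<Psi>"
  shows "(\<lambda>s. frac (blinfun_apply \<eta> s) ^ n) \<in> step_poly \<Psi> (int n)"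
proof (induction n)
  case (Suc n)
  have "(\<lambda>s. frac (blinfun_apply \<eta> s)) \<in> step_poly \<Psi> 1"
    by (rule step_polyI[of "{()}" "\<lambda>_. [\<eta>]" _ _ _ "\<lambda>_. 1"]) (use assms in auto)
  from step_poly_mult[OF this Suc] show ?case by simp
qed (simp add: step_poly_const)

lemma hom_cpolynomial_mult:
  "hom_cpolynomial k P \<Longrightarrow> hom_cpolynomial l Q \<Longrightarrow> hom_cpolynomial (k + l) (\<lambda>\<xi>. P \<xi> * Q \<xi>)"
  unfolding hom_cpolynomial_def by (auto intro: cpolynomial.mult simp: power_int_add mult_ac)

lemma hom_cpolynomial_const: "hom_cpolynomial 0 (\<lambda>_. c)"
  unfolding hom_cpolynomial_def by (auto intro: cpolynomial.const)

lemma hom_cpolynomial_apply: "hom_cpolynomial 1 (\<lambda>\<xi>. blinfun_apply \<xi> w)"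
  unfolding hom_cpolynomial_def by (auto intro: cpolynomial.pairing)

lemma hom_cpolynomial_power: "hom_cpolynomial (int n) (\<lambda>\<xi>. blinfun_apply \<xi> w ^ n)"
proof (induction n)
  case (Suc n)
  from hom_cpolynomial_mult[OF hom_cpolynomial_apply[of w] Suc] show ?case by simp
qed (simp add: hom_cpolynomial_const)

lemma hom_rational_mult:
  assumes "hom_cpolynomial k Q" "g \<in> hom_rational m"
  shows "(\<lambda>\<xi>. Q \<xi> * g \<xi>) \<in> hom_rational (m + k)"
proof -
  obtain P ws where P: "0 \<notin> set ws" "hom_cpolynomial (m + int (length ws)) P"
    "g = (\<lambda>\<xi>. P \<xi> / (\<Prod>w\<leftarrow>ws. blinfun_apply \<xi> w))"
    using assms(2) unfolding hom_rational_def by auto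
  from hom_cpolynomial_mult[OF assms(1) P(2)] show ?thesis unfolding hom_rational_def P(3) using P(1)
    by (auto intro!: exI[of _ "\<lambda>\<xi>. Q \<xi> * P \<xi>"] exI[of _ ws] simp: add_ac)
qed

lemma hom_rational_quotient:
  assumes "finite J" "\<And>j. j \<in> J \<Longrightarrow> u j \<noteq> 0" "hom_cpolynomial (m + int (card J)) P"
  shows "(\<lambda>\<xi>. P \<xi> / (\<Prod>j\<in>J. blinfun_apply \<xi> (u j))) \<in> hom_rational m"
proof -
  obtain xs where xs: "set xs = J" "distinct xs" using finite_distinct_list[OF assms(1)] by auto
  have "(\<Prod>w\<leftarrow>map u xs. blinfun_apply \<xi> w) = (\<Prod>j\<in>J. blinfun_apply \<xi> (u j))" for \<xi> :: "'b cdual"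
    using prod.distinct_set_conv_list[OF xs(2), of "\<lambda>j. blinfun_apply \<xi> (u j)"] xs(1) by (simp add: o_def)
  moreover have "length (map u xs) = card J" using xs distinct_card by fastforce
  ultimately show ?thesis unfolding hom_rational_def using assms xs
    by (intro CollectI exI[of _ P] exI[of _ "map u xs"]) auto
qed

lemma quasi_polyI:
  assumes "finite I" "\<And>i. i \<in> I \<Longrightarrow> \<exists>k r. f i \<in> step_poly \<Psi> k \<and> hom_polynomial r (p i) \<and> k + int r \<le> q"
    and h: "\<And>s. h s = (\<Sum>i\<in>I. f i s * p i s)"
  shows "h \<in> quasi_poly \<Psi> q"
proof -
  obtain e where e: "\<And>i. i < card I \<Longrightarrow> e i \<in> I"
    and sum: "\<And>G :: _ \<Rightarrow> real. (\<Sum>i\<in>I. G i) = (\<Sum>i<card I. G (e i))"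
    using sum_over_nat_index[OF assms(1)] by metis
  have "h = (\<lambda>s. \<Sum>i<card I. f (e i) s * p (e i) s)"
    unfolding fun_eq_iff h by (intro allI sum)
  moreover have "\<forall>i<card I. \<exists>k r. f (e i) \<in> step_poly \<Psi> k \<and> hom_polynomial r (p (e i)) \<and> k + int r \<le> q"
    using e assms(2) by blast
  ultimately show ?thesis unfolding quasi_poly_def
    by (intro CollectI exI[of _ "card I"] exI[of _ "\<lambda>i. f (e i)"] exI[of _ "\<lambda>i. p (e i)"]) auto
qed

lemma step_poly_subset_quasi_poly: "step_poly \<Psi> k \<subseteq> quasi_poly \<Psi> k"
proof
  fix f assume f: "f \<in> step_poly \<Psi> k"
  have "hom_polynomial 0 (\<lambda>_. 1)" unfolding hom_polynomial_def by auto
  then show "f \<in> quasi_poly \<Psi> k"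
    using f by (intro quasi_polyI[of "{()}" "\<lambda>_. f" _ "\<lambda>_ _. 1"]) force+
qed

lemma quasi_poly_mult_coord:
  assumes "h \<in> quasi_poly \<Psi> q"
  shows "(\<lambda>s. (s \<bullet> b) * h s) \<in> quasi_poly \<Psi> (q + 1)"
proof -
  obtain n :: nat and f p where 1: "\<And>i. i < n \<Longrightarrow> \<exists>k r. f i \<in> step_poly \<Psi> k \<and> hom_polynomial r (p i) \<and> k + int r \<le> q"
    "h = (\<lambda>s. \<Sum>i<n. f i s * p i s)"
    using assms unfolding quasi_poly_def by auto
  show ?thesis
  proof (rule quasi_polyI[of "{..<n}" f _ "\<lambda>i s. (s \<bullet> b) * p i s"])
    fix i assume "i \<in> {..<n}"
    then obtain k r where kr: "f i \<in> step_poly \<Psi> k" "hom_polynomial r (p i)" "k + int r \<le> q"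
      using 1(1) by blast
    have "real_polynomial_function (\<lambda>s. s \<bullet> b)"
      by (intro real_polynomial_function.intros bounded_linear_inner_left)
    then have "hom_polynomial (Suc r) (\<lambda>s. (s \<bullet> b) * p i s)"
      using kr(2) unfolding hom_polynomial_def by (auto intro: real_polynomial_function.intros)
    then show "\<exists>k r. f i \<in> step_poly \<Psi> k \<and> hom_polynomial r (\<lambda>s. (s \<bullet> b) * p i s) \<and> k + int r \<le> q + 1"
      using kr by (intro exI[of _ k] exI[of _ "Suc r"]) auto
  qed (auto simp: 1(2) sum_distrib_left mult_ac)
qed

text \<open>The pairing becomes a finite tensor after expanding \<open>s\<close> in a basis: each
  summand is a linear form in \<open>s\<close> times a linear form in \<xi>, so both degrees rise by
  one.\<close>

lemma tensor_mult_pairing: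
  fixes F :: "'a::euclidean_space \<Rightarrow> 'a cdual \<Rightarrow> complex"
  assumes "F \<in> tensor (quasi_poly \<Psi> q) (hom_rational m)"
  shows "(\<lambda>s \<xi>. blinfun_apply \<xi> s * F s \<xi>) \<in> tensor (quasi_poly \<Psi> (q + 1)) (hom_rational (m + 1))"
proof -
  have pair: "blinfun_apply \<xi> s = (\<Sum>b\<in>Basis. of_real (s \<bullet> b) * blinfun_apply \<xi> b)" for \<xi> :: "'a cdual" and s
    by (subst euclidean_representation[of s, symmetric])
       (simp only: blinfun_sum_right blinfun.scaleR_right scaleR_conv_of_real)
  have "blinfun_apply \<xi> s * F s \<xi> = (\<Sum>b\<in>Basis. (of_real (s \<bullet> b) * blinfun_apply \<xi> b) * F s \<xi>)" for \<xi> s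
    by (subst pair) (rule sum_distrib_right)
  then have eq: "(\<lambda>s \<xi>. blinfun_apply \<xi> s * F s \<xi>) =
    (\<lambda>s \<xi>. \<Sum>b\<in>Basis. (of_real (s \<bullet> b) * blinfun_apply \<xi> b) * F s \<xi>)"
    by (simp only:)
  show ?thesis unfolding eq
  proof (intro tensor_sum finite_Basis)
    fix b :: 'a
    have "(\<lambda>s \<xi>. of_real (s \<bullet> b) * blinfun_apply \<xi> b) \<in>
       tensor {\<lambda>s. s \<bullet> b} {\<lambda>\<xi> :: 'a cdual. blinfun_apply \<xi> b}"
      by (rule tensor_single) auto
    then show "(\<lambda>s \<xi>. (of_real (s \<bullet> b) * blinfun_apply \<xi> b) * F s \<xi>) \<in>
        tensor (quasi_poly \<Psi> (q + 1)) (hom_rational (m + 1))"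
      by (rule tensor_mult[OF _ assms])
         (auto intro: quasi_poly_mult_coord hom_rational_mult hom_cpolynomial_apply)
  qed
qed

lemma tensor_mult_pairing_power:
  assumes "F \<in> tensor (quasi_poly \<Psi> q) (hom_rational m)"
  shows "(\<lambda>s \<xi>. blinfun_apply \<xi> s ^ r * F s \<xi>) \<in>
           tensor (quasi_poly \<Psi> (q + int r)) (hom_rational (m + int r))"
proof (induction r)
  case (Suc r)
  from tensor_mult_pairing[OF this] show ?case by (simp add: add_ac mult_ac)
qed (use assms in simp)

section \<open>Tensor form of the components of one cone\<close>

context cone_data
begin

text \<open>The number of fractional parts and the degree in \<xi> both add up in Cauchy products,
  so induction over \<open>B\<close> reduces the claim to a single factor.\<close>

lemma M_fps_tensor:
  assumes \<Psi>: "\<And>v. v \<in> B \<Longrightarrow> - \<zeta> v \<in> \<Psi>"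
  shows "(\<lambda>s \<xi>. fps_nth (M_fps s \<xi>) n) \<in> tensor (step_poly \<Psi> (int n)) {P. hom_cpolynomial (int n) P}"
proof -
  have "(\<lambda>s \<xi>. fps_nth (\<Prod>v\<in>I. fps_exp (of_real (frac (- \<zeta> v s)) * blinfun_apply \<xi> (u v)) *
     exp_quotient_fps (blinfun_apply \<xi> (u v))) n) \<in> tensor (step_poly \<Psi> (int n)) {P. hom_cpolynomial (int n) P}"
    if "finite I" "I \<subseteq> B" for I
    using that
  proof (induction I arbitrary: n rule: finite_induct)
    case empty
    show ?case
    proof (cases n)
      case 0
      have "(\<lambda>s :: 'a. \<lambda>\<xi> :: 'a cdual. of_real 1 * 1) \<in> tensor (step_poly \<Psi> 0) {P. hom_cpolynomial 0 P}"
        by (rule tensor_single) (auto intro: step_poly_const hom_cpolynomial_const)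
      then show ?thesis using 0 by simp
    next
      case (Suc k)
      then show ?thesis by (simp add: tensor_zero)
    qed
  next
    case (insert v I)
    define E where "E s \<xi> = fps_exp (of_real (frac (- \<zeta> v s)) * blinfun_apply \<xi> (u v)) *
      exp_quotient_fps (blinfun_apply \<xi> (u v))" for s and \<xi> :: "'a cdual"
    define G where "G s \<xi> = (\<Prod>v\<in>I. fps_exp (of_real (frac (- \<zeta> v s)) * blinfun_apply \<xi> (u v)) *
      exp_quotient_fps (blinfun_apply \<xi> (u v)))" for s and \<xi> :: "'a cdual"
    have E: "(\<lambda>s \<xi>. fps_nth (E s \<xi>) k) \<in> tensor (step_poly \<Psi> (int k)) {P. hom_cpolynomial (int k) P}" for k
    proof -
      \<comment> \<open>In the Cauchy product of the exponential with the quotient series, the i-th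
        term carries i copies of one fractional part, while the powers of <\<xi>,u_v> from both
        series always combine to k.\<close>
      have "(\<lambda>s \<xi>. \<Sum>i\<in>{0..k}. of_real (frac (blinfun_apply (- \<zeta> v) s) ^ i) *
          (exp_quotient_coeff (k - i) / fact i * blinfun_apply \<xi> (u v) ^ k))
         \<in> tensor (step_poly \<Psi> (int k)) {P. hom_cpolynomial (int k) P}"
      proof (intro tensor_sum finite_atLeastAtMost tensor_single)
        fix i assume "i \<in> {0..k}"
        then show "(\<lambda>s. frac (blinfun_apply (- \<zeta> v) s) ^ i) \<in> step_poly \<Psi> (int k)"
          using step_poly_frac_power[OF \<Psi>, of v i] step_poly_mono[of "int i" "int k" \<Psi>] insert by auto
        show "(\<lambda>\<xi>. exp_quotient_coeff (k - i) / fact i * blinfun_apply \<xi> (u v) ^ k) \<in> {P. hom_cpolynomial (int k) P}"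
          using hom_cpolynomial_mult[OF hom_cpolynomial_const[of "exp_quotient_coeff (k - i) / fact i"]
              hom_cpolynomial_power[of k "u v"]] by simp
      qed
      also have "(\<lambda>s \<xi>. \<Sum>i\<in>{0..k}. of_real (frac (blinfun_apply (- \<zeta> v) s) ^ i) *
          (exp_quotient_coeff (k - i) / fact i * blinfun_apply \<xi> (u v) ^ k)) = (\<lambda>s \<xi>. fps_nth (E s \<xi>) k)"
        unfolding E_def fps_mult_nth fun_eq_iff
        by (intro allI sum.cong)
           (auto simp: exp_quotient_fps_def power_mult_distrib blinfun.minus_left simp flip: power_add)
      finally show ?thesis .
    qed
    have G: "(\<lambda>s \<xi>. fps_nth (G s \<xi>) k) \<in> tensor (step_poly \<Psi> (int k)) {P. hom_cpolynomial (int k) P}" for k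
      unfolding G_def using insert by auto
    have "(\<lambda>s \<xi>. fps_nth (E s \<xi> * G s \<xi>) n) \<in> tensor (step_poly \<Psi> (int n)) {P. hom_cpolynomial (int n) P}"
      unfolding fps_mult_nth
    proof (intro tensor_sum finite_atLeastAtMost)
      fix i assume "i \<in> {0..n}"
      then have n: "int n = int i + int (n - i)" by auto
      show "(\<lambda>s \<xi>. fps_nth (E s \<xi>) i * fps_nth (G s \<xi>) (n - i))
          \<in> tensor (step_poly \<Psi> (int n)) {P. hom_cpolynomial (int n) P}"
        unfolding n by (rule tensor_mult[OF E G]) (auto intro: step_poly_mult hom_cpolynomial_mult)
    qed
    then show ?case using insert(1,2) by (simp add: E_def G_def)
  qed
  from this[OF finite_B] show ?thesis by (simp add: M_fps_def)
qed

text \<open>Division by the d linear forms in \<open>M_num\<close> lowers the degree in \<xi> from m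
  + d to m, but leaves the bound m + d on the number of fractional parts.\<close>

lemma M_component_tensor:
  assumes \<Psi>: "\<And>v. v \<in> B \<Longrightarrow> - \<zeta> v \<in> \<Psi>" and m: "0 \<le> m + int DIM('a)"
  shows "(\<lambda>s \<xi>. M_num \<xi> * fps_nth (M_fps s \<xi>) (nat (m + int DIM('a)))) \<in>
     tensor (step_poly \<Psi> (m + int DIM('a))) (hom_rational m)"
proof (rule tensor_map)
  show "(\<lambda>s \<xi>. fps_nth (M_fps s \<xi>) (nat (m + int DIM('a)))) \<in>
     tensor (step_poly \<Psi> (m + int DIM('a))) {P. hom_cpolynomial (m + int DIM('a)) P}"
    using M_fps_tensor[OF \<Psi>, of "nat (m + int DIM('a))"] m by simp
  fix P :: "'a cdual \<Rightarrow> complex" assume "P \<in> {P. hom_cpolynomial (m + int DIM('a)) P}"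
  then have "hom_cpolynomial (m + int (card (A \<union> B))) (\<lambda>\<xi>. (of_real \<kappa> * (- 1) ^ card A) * P \<xi>)"
    using hom_cpolynomial_mult[OF hom_cpolynomial_const, of _ P] dual_family_card[OF dual] by auto
  from hom_rational_quotient[OF _ u_nonzero this]
  show "(\<lambda>\<xi>. M_num \<xi> * P \<xi>) \<in> hom_rational m" by (simp add: M_num_def)
qed

end

section \<open>Rationality and valuations\<close>

text \<open>Real independence implies independence over the rationals, and \<open>E\<close> has as
  many elements as the lattice basis, so \<open>E\<close> also spans \<Lambda> over the rationals.
  The dual functional is therefore rational on \<Lambda>, and N is a common denominator of its
  values on \<open>G\<close>.\<close>

lemma dual_family_rational:
  fixes E :: "'a::euclidean_space set"
  assumes G: "lattice_basis \<Lambda> UNIV G" and E: "E \<subseteq> \<Lambda>" "independent E" "span E = UNIV"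
    and dual: "dual_family E (\<lambda>x. x) \<epsilon>" and e: "e \<in> E"
  shows "\<exists>N::nat. N > 0 \<and> of_nat N *\<^sub>R \<epsilon> e \<in> dual_lattice \<Lambda>"
proof -
  interpret Q: vector_space "\<lambda>(q::rat) (x::'a). (of_rat q :: real) *\<^sub>R x"
    by unfold_locales (auto simp: algebra_simps of_rat_add of_rat_mult)
  have Gi: "independent G" "span G = UNIV" using G by (auto simp: lattice_basis_def)
  have fin: "finite E" "finite G" using E(2) Gi(1) by (auto intro: independent_imp_finite)
  have cards: "card E = card G"
    using E(2,3) Gi by (metis dim_eq_card_independent dim_span)
  have span_le: "Q.span X \<subseteq> span X" for X
    by (rule Q.span_minimal) (auto intro!: Q.subspaceI intro: span_base span_zero span_add span_scale)
  have "e \<notin> Q.span (E - {e})" if "e \<in> E" for e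
    using that E(2) span_le[of "E - {e}"] by (auto simp: dependent_def)
  then have Qi: "Q.independent E" by (auto simp: Q.dependent_def)
  have \<Lambda>_span: "\<Lambda> \<subseteq> Q.span G"
  proof
    fix x assume "x \<in> \<Lambda>"
    then obtain k where k: "x = (\<Sum>b\<in>G. of_int (k b) *\<^sub>R b)" using G by (auto simp: lattice_basis_def)
    have "(\<Sum>b\<in>G. (of_rat (of_int (k b)) :: real) *\<^sub>R b) \<in> Q.span G"
      by (intro Q.span_sum Q.span_scale Q.span_base)
    then show "x \<in> Q.span G" using k by simp
  qed
  \<comment> \<open>Otherwise \<open>E\<close> and \<open>b\<close> together would be too many
    independent vectors in the rational span of \<open>G\<close>.\<close>
  have GE: "b \<in> Q.span E" if b: "b \<in> G" for b
  proof (rule ccontr)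
    assume n: "b \<notin> Q.span E"
    then have "Q.independent (insert b E)" "b \<notin> E" using Qi Q.span_base by (auto simp: Q.independent_insert)
    moreover have "insert b E \<subseteq> Q.span G" using E(1) \<Lambda>_span b Q.span_base by auto
    ultimately have "card (insert b E) \<le> card G"
      using Q.independent_span_bound[OF fin(2)] by blast
    then show False using \<open>b \<notin> E\<close> fin cards by simp
  qed
  have "Q.span E \<subseteq> {x. \<epsilon> e x \<in> \<rat>}"
    by (rule Q.span_minimal)
       (use e in \<open>auto intro!: Q.subspaceI simp: dual_family_apply[OF dual] blinfun.zero_right
          blinfun.add_right blinfun.scaleR_right\<close>)
  then have rat: "\<epsilon> e b \<in> \<rat>" if "b \<in> G" for b using GE that by auto
  have "\<exists>n::nat. n > 0 \<and> of_nat n * \<epsilon> e b \<in> \<int>" if b: "b \<in> G" for b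
  proof -
    obtain p :: int and q :: int where "q > 0" "\<epsilon> e b = of_int p / of_int q"
      using rat[OF b] by (auto elim!: Rats_cases')
    then show ?thesis by (intro exI[of _ "nat q"]) auto
  qed
  then obtain d :: "'a \<Rightarrow> nat" where d: "\<And>b. b \<in> G \<Longrightarrow> d b > 0 \<and> of_nat (d b) * \<epsilon> e b \<in> \<int>"
    by metis
  define N where "N = (\<Prod>b\<in>G. d b)"
  have N: "of_nat N * \<epsilon> e b \<in> \<int>" if "b \<in> G" for b
  proof -
    have "real N * \<epsilon> e b = of_nat (\<Prod>b\<in>G - {b}. d b) * (of_nat (d b) * \<epsilon> e b)"
      unfolding N_def using fin that by (simp add: prod.remove mult_ac)
    then show ?thesis using d[OF that] by (metis Ints_mult Ints_of_nat)
  qed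
  have "of_nat N *\<^sub>R \<epsilon> e \<in> dual_lattice \<Lambda>" unfolding dual_lattice_def
  proof (intro CollectI ballI)
    fix x assume "x \<in> \<Lambda>"
    then obtain k where k: "x = (\<Sum>b\<in>G. of_int (k b) *\<^sub>R b)" using G by (auto simp: lattice_basis_def)
    have "blinfun_apply (of_nat N *\<^sub>R \<epsilon> e) x = (\<Sum>b\<in>G. of_int (k b) * (of_nat N * \<epsilon> e b))"
      unfolding k by (simp add: blinfun.scaleR_left blinfun_sum_right blinfun.scaleR_right sum_distrib_left mult_ac)
    also have "\<dots> \<in> \<int>" by (intro Ints_sum Ints_mult[OF Ints_of_int N])
    finally show "blinfun_apply (of_nat N *\<^sub>R \<epsilon> e) x \<in> \<int>" .
  qed
  moreover have "N > 0" unfolding N_def using d by (simp add: prod_pos)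
  ultimately show ?thesis by blast
qed

lemma rational_cone_Int:
  assumes "rational_cone \<Lambda> X" "rational_cone \<Lambda> Y"
  shows "rational_cone \<Lambda> (X \<inter> Y)"
proof -
  obtain M M' where "finite M" "M \<subseteq> dual_lattice \<Lambda>" "X = {x. \<forall>\<mu>\<in>M. blinfun_apply \<mu> x \<le> 0}"
    "finite M'" "M' \<subseteq> dual_lattice \<Lambda>" "Y = {x. \<forall>\<mu>\<in>M'. blinfun_apply \<mu> x \<le> 0}"
    using assms by (auto simp: rational_cone_def)
  then show ?thesis unfolding rational_cone_def by (intro exI[of _ "M \<union> M'"]) auto
qed

lemma nonneg_combination_in_convex_cone_hull:
  assumes "\<And>v. v \<in> S \<Longrightarrow> 0 \<le> c v"
  shows "(\<Sum>v\<in>S. c v *\<^sub>R v) \<in> convex_cone hull S"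
proof -
  have "(\<Sum>v\<in>I. c v *\<^sub>R v) \<in> convex_cone hull S" if "I \<subseteq> S" for I
    using that assms
    by (induction I rule: infinite_finite_induct)
       (auto simp: convex_cone_hull_contains_0 intro!: convex_cone_hull_add convex_cone_hull_mul intro: hull_inc)
  then show ?thesis by blast
qed

lemma convex_cone_hull_functional_nonneg:
  fixes f :: "'a::euclidean_space \<Rightarrow>\<^sub>L real"
  assumes "x \<in> convex_cone hull S" "\<And>v. v \<in> S \<Longrightarrow> 0 \<le> blinfun_apply f v"
  shows "0 \<le> blinfun_apply f x"
proof -
  have "convex_cone hull S \<subseteq> {x. 0 \<le> blinfun_apply f x}"
    by (rule hull_minimal)
       (use assms(2) in \<open>auto simp: convex_cone_iff blinfun.zero_right blinfun.add_right blinfun.scaleR_right\<close>)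
  then show ?thesis using assms(1) by auto
qed

lemma simplicial_cone_eq:
  assumes "dual_family E (\<lambda>x. x) \<epsilon>"
  shows "convex_cone hull E = {x. \<forall>e\<in>E. 0 \<le> \<epsilon> e x}"
proof (intro equalityI subsetI)
  fix x assume "x \<in> convex_cone hull E"
  then show "x \<in> {x. \<forall>e\<in>E. 0 \<le> \<epsilon> e x}"
    by (auto intro: convex_cone_hull_functional_nonneg simp: dual_family_apply[OF assms])
next
  fix x assume "x \<in> {x. \<forall>e\<in>E. 0 \<le> \<epsilon> e x}"
  then show "x \<in> convex_cone hull E"
    using nonneg_combination_in_convex_cone_hull[of E "\<lambda>e. \<epsilon> e x"]
    by (simp add: dual_family_expand[OF assms])
qed

text \<open>If an edge has a positive coefficient in a point \<open>x\<close> of the face, then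
  \<open>x\<close> is the midpoint of twice this component and twice the rest. The face property
  puts the edge into L, so only edges in L occur in points of the face.\<close>

lemma span_face_of_simplicial_cone:
  fixes E :: "'a::euclidean_space set"
  assumes dual: "dual_family E (\<lambda>x. x) \<epsilon>" and F: "F face_of (convex_cone hull E)" "span F = L"
  shows "span (E \<inter> L) = L"
proof
  have subL: "subspace L" using F(2) subspace_span[of F] by simp
  show "span (E \<inter> L) \<subseteq> L" using subL by (intro span_minimal) auto
  have "F \<subseteq> span (E \<inter> L)"
  proof
    fix x assume x: "x \<in> F"
    then have xK: "x \<in> convex_cone hull E" using F(1) face_of_imp_subset by blast
    then have nonneg: "0 \<le> \<epsilon> e x" if "e \<in> E" for e
      using that by (simp add: simplicial_cone_eq[OF dual])
    have "e \<in> L" if e: "e \<in> E" "\<epsilon> e x \<noteq> 0" for e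
    proof -
      define c where "c = \<epsilon> e x"
      have c: "c > 0" using e nonneg[OF e(1)] by (simp add: c_def)
      define p where "p = (2 * c) *\<^sub>R e"
      define q where "q = 2 *\<^sub>R (\<Sum>e'\<in>E - {e}. \<epsilon> e' x *\<^sub>R e')"
      have pq: "p + q = 2 *\<^sub>R x"
        unfolding p_def q_def c_def
        by (subst (3) dual_family_expand[OF dual, of x, symmetric])
           (use e dual_family_finite[OF dual] in \<open>simp add: sum.remove[of E e] scaleR_add_right\<close>)
      have pK: "p \<in> convex_cone hull E" unfolding p_def
        using c e by (intro convex_cone_hull_mul hull_inc) auto
      have "(\<Sum>e'\<in>E - {e}. \<epsilon> e' x *\<^sub>R e') \<in> convex_cone hull (E - {e})"
        using nonneg by (intro nonneg_combination_in_convex_cone_hull) auto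
      then have qK: "q \<in> convex_cone hull E" unfolding q_def
        using hull_mono[of "E - {e}" E convex_cone] by (intro convex_cone_hull_mul) auto
      have "p \<in> F"
      \<comment> \<open>Coinciding endpoints give an empty open segment, but then \<open>p\<close>
        is \<open>x\<close> itself.\<close>
      proof (cases "p = q")
        case True
        then have "p = x" using pq by (simp flip: scaleR_2)
        then show ?thesis using x by simp
      next
        case False
        have "x = (1 - 1 / 2) *\<^sub>R p + (1 / 2 :: real) *\<^sub>R q"
          using arg_cong[OF pq, of "\<lambda>y. (1 / 2 :: real) *\<^sub>R y"] by (simp add: scaleR_add_right)
        then have "x \<in> open_segment p q"
          using False unfolding in_segment by (intro conjI exI[of _ "1 / 2 :: real"]) auto
        then show ?thesis using F(1) pK qK x by (auto simp: face_of_def)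
      qed
      then have "p \<in> L" using F(2) span_base by auto
      then have "(1 / (2 * c)) *\<^sub>R p \<in> L" by (rule subspace_scale[OF subL])
      then show ?thesis using c by (simp add: p_def)
    qed
    then have "(\<Sum>e\<in>E. \<epsilon> e x *\<^sub>R e) = (\<Sum>e\<in>E \<inter> L. \<epsilon> e x *\<^sub>R e)"
      using dual_family_finite[OF dual] by (intro sum.mono_neutral_right) auto
    also have "\<dots> \<in> span (E \<inter> L)" by (intro span_sum span_scale span_base)
    finally show "x \<in> span (E \<inter> L)" by (simp add: dual_family_expand[OF dual])
  qed
  then show "L \<subseteq> span (E \<inter> L)" using F(2) span_minimal[OF _ subspace_span] by blast
qed

lemma quot_lattice_basis_disjoint:
  assumes "quot_lattice_basis \<Lambda> L B" "b \<in> B"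
  shows "b \<notin> L"
proof
  assume "b \<in> L"
  have fin: "finite B" using assms(1) by (simp add: quot_lattice_basis_def)
  have "(\<Sum>x\<in>B. (if x = b then 1 else 0) *\<^sub>R x) = (\<Sum>x\<in>B. if x = b then x else 0)"
    by (intro sum.cong) auto
  also have "\<dots> = b" using fin assms(2) by (simp add: sum.delta')
  finally have in_L: "(\<Sum>x\<in>B. (if x = b then 1 else 0) *\<^sub>R x) \<in> L" using \<open>b \<in> L\<close> by simp
  have zero: "\<forall>x\<in>B. a x = 0" if "(\<Sum>x\<in>B. a x *\<^sub>R x) \<in> L" for a
    using assms(1) that unfolding quot_lattice_basis_def by blast
  have "\<forall>x\<in>B. (if x = b then 1 else 0 :: real) = 0" by (rule zero[OF in_L])
  then show False using assms(2) by auto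
qed

text \<open>Subtracting the integral combination of \<open>B\<close> with the same image in V/L
  leaves a vector of \<open>L \<inter> \<Lambda>\<close>, which \<open>H\<close> expands
  integrally.\<close>

lemma lattice_basis_Un_quot:
  fixes \<Lambda> :: "'a::euclidean_space set"
  assumes G: "lattice_basis \<Lambda> UNIV G" and H: "lattice_basis (L \<inter> \<Lambda>) L H"
    and B: "quot_lattice_basis \<Lambda> L B"
  shows "lattice_basis \<Lambda> UNIV (H \<union> B)" "H \<inter> B = {}"
proof -
  have subL: "subspace L" using H subspace_span[of H] by (simp add: lattice_basis_def)
  have HL: "H \<subseteq> L \<inter> \<Lambda>" using H by (rule lattice_basis_subset)
  have fin: "finite H" "finite B"
    using H B by (auto simp: lattice_basis_def quot_lattice_basis_def intro: independent_imp_finite)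
  show disj: "H \<inter> B = {}" using HL quot_lattice_basis_disjoint[OF B] by blast
  have BL: "B \<subseteq> \<Lambda>" using B by (simp add: quot_lattice_basis_def)
  have ind: "independent (H \<union> B)"
  proof (rule independent_if_scalars_zero)
    fix f x assume 0: "(\<Sum>x\<in>H \<union> B. f x *\<^sub>R x) = 0" and x: "x \<in> H \<union> B"
    have s: "(\<Sum>x\<in>B. f x *\<^sub>R x) = - (\<Sum>x\<in>H. f x *\<^sub>R x)"
      using 0 fin disj by (simp add: sum.union_disjoint eq_neg_iff_add_eq_0 add.commute)
    have "(\<Sum>x\<in>H. f x *\<^sub>R x) \<in> L"
      using HL by (intro subspace_sum[OF subL] subspace_scale[OF subL]) auto
    then have "(\<Sum>x\<in>B. f x *\<^sub>R x) \<in> L" unfolding s by (rule subspace_neg[OF subL])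
    then have fB: "\<forall>b\<in>B. f b = 0" using B unfolding quot_lattice_basis_def by blast
    then have "(\<Sum>x\<in>H. f x *\<^sub>R x) = 0" using s by simp
    then have "\<forall>h\<in>H. f h = 0"
      using H fin(1) independentD[of H H f] by (auto simp: lattice_basis_def)
    then show "f x = 0" using fB x by blast
  qed (use fin in auto)
  have mem: "\<exists>k. x = (\<Sum>b\<in>H \<union> B. of_int (k b) *\<^sub>R b)" if x: "x \<in> \<Lambda>" for x
  proof -
    obtain k where k: "x - (\<Sum>b\<in>B. of_int (k b) *\<^sub>R b) \<in> L"
      using B x by (auto simp: quot_lattice_basis_def)
    have "(\<Sum>b\<in>B. of_int (k b) *\<^sub>R b) \<in> \<Lambda>"
      using BL by (intro lattice_basis_sum[OF G]) auto
    then have "x - (\<Sum>b\<in>B. of_int (k b) *\<^sub>R b) \<in> L \<inter> \<Lambda>"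
      using k x lattice_basis_diff[OF G] by auto
    then obtain l where l: "x - (\<Sum>b\<in>B. of_int (k b) *\<^sub>R b) = (\<Sum>b\<in>H. of_int (l b) *\<^sub>R b)"
      using H by (auto simp: lattice_basis_def)
    have "(\<Sum>b\<in>H. of_int (if b \<in> B then k b else l b) *\<^sub>R b) = (\<Sum>b\<in>H. of_int (l b) *\<^sub>R b)"
      using disj by (intro sum.cong) auto
    moreover have "(\<Sum>b\<in>B. of_int (if b \<in> B then k b else l b) *\<^sub>R b) = (\<Sum>b\<in>B. of_int (k b) *\<^sub>R b)"
      by (intro sum.cong) auto
    ultimately have "x = (\<Sum>b\<in>H \<union> B. of_int (if b \<in> B then k b else l b) *\<^sub>R b)"
      using l fin disj by (simp add: sum.union_disjoint diff_eq_eq)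
    then show ?thesis by (intro exI[of _ "\<lambda>b. if b \<in> B then k b else l b"])
  qed
  have "span (H \<union> B) = UNIV"
  proof -
    have "\<Lambda> \<subseteq> span (H \<union> B)"
    proof
      fix x assume "x \<in> \<Lambda>"
      then obtain k where "x = (\<Sum>b\<in>H \<union> B. of_int (k b) *\<^sub>R b)" using mem by blast
      then show "x \<in> span (H \<union> B)" by (simp only:) (intro span_sum span_scale span_base)
    qed
    then have "span G \<subseteq> span (H \<union> B)"
      using lattice_basis_subset[OF G] by (intro span_minimal) auto
    then show ?thesis using G by (auto simp: lattice_basis_def)
  qed
  moreover have "(\<Sum>b\<in>H \<union> B. of_int (k b) *\<^sub>R b) \<in> \<Lambda>" for k
    using BL HL by (intro lattice_basis_sum[OF G]) auto
  ultimately show "lattice_basis \<Lambda> UNIV (H \<union> B)"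
    unfolding lattice_basis_def using ind mem by blast
qed

text \<open>Take the functionals dual to \<open>H \<union> B\<close>. Those labelled by
  \<open>B\<close> vanish on \<open>H\<close>, hence on L, and they are integral because
  \<open>H \<union> B\<close> generates \<Lambda>.\<close>

lemma quot_dual_exists:
  fixes \<Lambda> :: "'a::euclidean_space set"
  assumes G: "lattice_basis \<Lambda> UNIV G" and H: "lattice_basis (L \<inter> \<Lambda>) L H"
    and B: "quot_lattice_basis \<Lambda> L B"
  shows "\<exists>\<eta>. (\<forall>v\<in>B. \<eta> v \<in> dual_lattice \<Lambda> \<inter> annihilator L) \<and>
    (\<forall>v\<in>B. \<forall>w\<in>B. \<eta> v w = (if v = w then 1 else 0)) \<and>
    (\<forall>x. x - (\<Sum>v\<in>B. \<eta> v x *\<^sub>R v) \<in> L)"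
proof -
  note HB = lattice_basis_Un_quot[OF assms]
  have subL: "subspace L" using H subspace_span[of H] by (simp add: lattice_basis_def)
  have HL: "H \<subseteq> L \<inter> \<Lambda>" using H by (rule lattice_basis_subset)
  obtain \<eta> where \<eta>: "dual_family (H \<union> B) (\<lambda>x. x) \<eta>"
    using dual_family_exists[of "H \<union> B"] HB(1) by (auto simp: lattice_basis_def)
  have "\<eta> v \<in> dual_lattice \<Lambda>" if "v \<in> B" for v
    using lattice_basis_mem_iff[OF HB(1) \<eta>] that by (auto simp: dual_lattice_def)
  moreover have "\<eta> v \<in> annihilator L" if "v \<in> B" for v
    using dual_family_vanishes[OF \<eta>, of H v] H HB(2) that by (auto simp: annihilator_def lattice_basis_def)
  moreover have "x - (\<Sum>v\<in>B. \<eta> v x *\<^sub>R v) \<in> L" for x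
  proof -
    have "x = (\<Sum>v\<in>H. \<eta> v x *\<^sub>R v) + (\<Sum>v\<in>B. \<eta> v x *\<^sub>R v)"
      using dual_family_expand[OF \<eta>, of x] HB(2) dual_family_finite[OF \<eta>]
      by (simp add: sum.union_disjoint)
    then have "x - (\<Sum>v\<in>B. \<eta> v x *\<^sub>R v) = (\<Sum>v\<in>H. \<eta> v x *\<^sub>R v)"
      by (simp add: diff_eq_eq)
    also have "\<dots> \<in> L" using HL by (intro subspace_sum[OF subL] subspace_scale[OF subL]) auto
    finally show ?thesis .
  qed
  ultimately show ?thesis using dual_family_apply[OF \<eta>] by (intro exI[of _ \<eta>]) auto
qed

text \<open>The valuation property is stated for sets of polyhedra, whereas here several indices may
  give the same polyhedron; their coefficients are collected in \<open>b\<close>.\<close>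

lemma valuation_family:
  assumes S: "intermediate_generating_function \<Lambda> L S" and fin: "finite J"
    and p: "\<And>j. j \<in> J \<Longrightarrow> semi_rational_polyhedron \<Lambda> (p j)"
    and rel: "\<And>x. (\<Sum>j\<in>J. a j * indicator (p j) x) = (0 :: real)"
  shows "mero_eq (\<lambda>\<xi>. \<Sum>j\<in>J. of_real (a j) * S (p j) \<xi>) (\<lambda>_. 0)"
proof -
  define b where "b q = (\<Sum>j\<in>{j \<in> J. p j = q}. a j)" for q
  have "(\<Sum>q\<in>p ` J. b q * indicator q x) = (\<Sum>j\<in>J. a j * indicator (p j) x)" for x
    unfolding b_def sum_distrib_right sum.image_gen[OF fin, of "\<lambda>j. a j * indicator (p j) x" p]
    by (intro sum.cong) auto
  then have "mero_eq (\<lambda>\<xi>. \<Sum>q\<in>p ` J. of_real (b q) * S q \<xi>) (\<lambda>_. 0)"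
    using S fin p rel unfolding intermediate_generating_function_def by auto
  moreover have "(\<Sum>q\<in>p ` J. of_real (b q) * S q \<xi>) = (\<Sum>j\<in>J. of_real (a j) * S (p j) \<xi>)" for \<xi>
    unfolding b_def of_real_sum sum_distrib_right sum.image_gen[OF fin, of "\<lambda>j. of_real (a j) * S (p j) \<xi>" p]
    by (intro sum.cong) auto
  ultimately show ?thesis by simp
qed

lemma indicator_shift: "indicator (shift s p) x = indicator p (x - s)"
proof -
  have "x \<in> shift s p \<longleftrightarrow> x - s \<in> p" unfolding shift_def by (force simp: image_iff)
  then show ?thesis by (simp add: indicator_def)
qed

lemma contains_line_shift:
  assumes "contains_line Z"
  shows "contains_line (shift s Z)"
proof -
  obtain x v where "v \<noteq> 0" "\<And>t. x + t *\<^sub>R v \<in> Z" using assms by (auto simp: contains_line_def)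
  then show ?thesis unfolding contains_line_def shift_def
    by (intro exI[of _ "s + x"] exI[of _ v]) (auto simp: image_iff add.assoc)
qed

text \<open>Translation by \<open>s\<close> preserves linear relations between indicators and the
  presence of lines, and polyhedra with lines have valuation zero.\<close>

lemma valuation_mod_lines:
  assumes S: "intermediate_generating_function \<Lambda> L S" and fin: "finite J"
    and p0: "rational_cone \<Lambda> p0" and p: "\<And>j. j \<in> J \<Longrightarrow> rational_cone \<Lambda> (p j)"
    and cong: "cong_mod_indicators {Z. rational_cone \<Lambda> Z \<and> contains_line Z}
          (indicator p0) (\<lambda>x. \<Sum>j\<in>J. a j * indicator (p j) x)"
  shows "mero_eq (S (shift s p0)) (\<lambda>\<xi>. \<Sum>j\<in>J. of_real (a j) * S (shift s (p j)) \<xi>)"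
proof -
  obtain C b where C: "finite C" "\<And>z. z \<in> C \<Longrightarrow> rational_cone \<Lambda> z \<and> contains_line z"
    "\<And>x. indicator p0 x = (\<Sum>j\<in>J. a j * indicator (p j) x) + (\<Sum>z\<in>C. b z * indicator z x)"
    using cong unfolding cong_mod_indicators_def by blast
  \<comment> \<open>The relation with all terms on one side: \<open>None\<close> stands for the cone
    itself, with coefficient -1, \<open>Inl\<close> for the pieces and \<open>Inr\<close> for the
    cones with lines.\<close>
  define I where "I = insert None (Some ` (J <+> C))"
  define q where "q = case_option (shift s p0) (case_sum (\<lambda>j. shift s (p j)) (shift s))"
  define e where "e = case_option (- 1) (case_sum a b)"
  have I_sum: "sum g I = g None + (\<Sum>j\<in>J. g (Some (Inl j))) + (\<Sum>z\<in>C. g (Some (Inr z)))" for g :: "_ \<Rightarrow> 'm::comm_monoid_add"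
    unfolding I_def using fin C(1) by (simp add: sum.reindex sum.Plus add.assoc)
  have "mero_eq (\<lambda>\<xi>. \<Sum>i\<in>I. of_real (e i) * S (q i) \<xi>) (\<lambda>_. 0)"
  proof (rule valuation_family[OF S])
    show "finite I" using fin C(1) by (simp add: I_def)
    show "semi_rational_polyhedron \<Lambda> (q i)" if "i \<in> I" for i
      using that p0 p C(2) by (auto simp: I_def q_def intro!: rational_cone_shift)
    show "(\<Sum>i\<in>I. e i * indicator (q i) x) = 0" for x
      unfolding I_sum using C(3)[of "x - s"] by (simp add: e_def q_def indicator_shift)
  qed
  then have 1: "generic (\<lambda>\<xi>. (\<Sum>i\<in>I. of_real (e i) * S (q i) \<xi>) = 0)"
    by (simp add: mero_eq_iff_generic)
  have 2: "generic (\<lambda>\<xi>. \<forall>z\<in>C. S (shift s z) \<xi> = 0)"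
  proof (intro generic_ball C(1))
    fix z assume "z \<in> C"
    then have "semi_rational_polyhedron \<Lambda> (shift s z)" "contains_line (shift s z)"
      using C(2) by (auto intro: rational_cone_shift contains_line_shift)
    then have "mero_eq (S (shift s z)) (\<lambda>_. 0)"
      using S unfolding intermediate_generating_function_def by blast
    then show "generic (\<lambda>\<xi>. S (shift s z) \<xi> = 0)" by (simp add: mero_eq_iff_generic)
  qed
  show ?thesis unfolding mero_eq_iff_generic
  proof (rule generic_mono[OF generic_conj[OF 1 2]])
    fix \<xi> assume *: "(\<Sum>i\<in>I. of_real (e i) * S (q i) \<xi>) = 0 \<and> (\<forall>z\<in>C. S (shift s z) \<xi> = 0)"
    then have z: "(\<Sum>z\<in>C. of_real (b z) * S (shift s z) \<xi>) = 0" by (intro sum.neutral) auto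
    have "(\<Sum>j\<in>J. of_real (a j) * S (shift s (p j)) \<xi>) - S (shift s p0) \<xi> +
        (\<Sum>z\<in>C. of_real (b z) * S (shift s z) \<xi>) = 0"
      using conjunct1[OF *] by (simp add: I_sum e_def q_def)
    then show "S (shift s p0) \<xi> = (\<Sum>j\<in>J. of_real (a j) * S (shift s (p j)) \<xi>)"
      unfolding z by simp
  qed
qed

section \<open>Decomposition into unimodular cones\<close>

text \<open>The edges outside L give way to lifts of the unimodular generators, while the edges in L
  keep their functionals. That \<zeta> equals \<epsilon> on \<open>A\<close> for every
  \<open>B\<close> later yields one set of inequalities common to all pieces.\<close>

lemma cone_data_exists:
  fixes \<Lambda> :: "'a::euclidean_space set"
  assumes G: "lattice_basis \<Lambda> UNIV G" and H: "lattice_basis (L \<inter> \<Lambda>) L H"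
    and B: "quot_lattice_basis \<Lambda> L B"
    and dualE: "dual_family E (\<lambda>x. x) \<epsilon>" and E: "E \<subseteq> \<Lambda>" "independent E" "span E = UNIV"
    and A: "A = E \<inter> L" "span A = L"
    and \<kappa>: "\<kappa> > 0" "cell_measure (SOME G. lattice_basis (L \<inter> \<Lambda>) L G) (\<lambda>x. x) =
           density (cell_measure A (\<lambda>x. x)) (\<lambda>_. ennreal \<kappa>)"
  shows "\<exists>u \<zeta>. cone_data \<Lambda> L A B u \<zeta> \<kappa> \<and> (\<forall>v\<in>B. - \<zeta> v \<in> cone_covectors \<Lambda> L B) \<and>
    (\<forall>b\<in>A. \<zeta> b = \<epsilon> b)"
proof -
  have subL: "subspace L" using H subspace_span[of H] by (simp add: lattice_basis_def)
  obtain \<eta> where \<eta>': "(\<forall>v\<in>B. \<eta> v \<in> dual_lattice \<Lambda> \<inter> annihilator L) \<and>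
    (\<forall>v\<in>B. \<forall>w\<in>B. \<eta> v w = (if v = w then 1 else 0)) \<and>
    (\<forall>x. x - (\<Sum>v\<in>B. \<eta> v x *\<^sub>R v) \<in> L)"
    using quot_dual_exists[OF G H B] by (rule exE)
  have \<eta>: "\<And>v. v \<in> B \<Longrightarrow> \<eta> v \<in> dual_lattice \<Lambda> \<inter> annihilator L"
    "\<And>v w. v \<in> B \<Longrightarrow> w \<in> B \<Longrightarrow> \<eta> v w = (if v = w then 1 else 0)"
    "\<And>x. x - (\<Sum>v\<in>B. \<eta> v x *\<^sub>R v) \<in> L"
    using \<eta>' by simp_all
  have \<eta>L: "\<eta> v x = 0" if "v \<in> B" "x \<in> L" for v x
    using \<eta>(1)[OF that(1)] that(2) by (auto simp: annihilator_def)
  have BL: "b \<notin> L" if "b \<in> B" for b using quot_lattice_basis_disjoint[OF B that] .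
  have disj: "A \<inter> B = {}" using BL A(1) by auto
  have fin: "finite E" "finite A" "finite B"
    using dual_family_finite[OF dualE] A(1) B by (auto simp: quot_lattice_basis_def)
  \<comment> \<open>The projection along L onto the span of the edges outside L. Lifts made with it
    have vanishing \<open>A\<close>-coordinates, so \<epsilon> remains dual to the edges in
    \<open>A\<close>.\<close>
  define \<pi> where "\<pi> x = (\<Sum>e\<in>E - A. \<epsilon> e x *\<^sub>R e)" for x
  have split: "x = (\<Sum>e\<in>A. \<epsilon> e x *\<^sub>R e) + \<pi> x" for x
    using dual_family_expand[OF dualE, of x] fin A(1) unfolding \<pi>_def
    by (subst (asm) sum.subset_diff[of A E]) (auto simp: add.commute)
  have sumA_L: "(\<Sum>e\<in>A. c e *\<^sub>R e) \<in> L" for c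
    using A(1) by (intro subspace_sum[OF subL] subspace_scale[OF subL]) auto
  have \<pi>_diff: "\<pi> x - x \<in> L" for x
  proof -
    have "\<pi> x - x = - (\<Sum>e\<in>A. \<epsilon> e x *\<^sub>R e)"
      by (subst (2) split[of x]) simp
    then show ?thesis using subspace_neg[OF subL sumA_L] by simp
  qed
  have \<epsilon>_L: "\<epsilon> e x = 0" if "e \<in> E - A" "x \<in> L" for e x
    using dual_family_vanishes[OF dualE _ that(1), of x] that(2) A by simp
  have \<pi>_cong: "\<pi> x = \<pi> y" if "x - y \<in> L" for x y
    unfolding \<pi>_def using \<epsilon>_L[OF _ that] by (intro sum.cong) (auto simp: blinfun.diff_right)
  have \<pi>_sum: "\<pi> (\<Sum>v\<in>B. c v *\<^sub>R v) = (\<Sum>v\<in>B. c v *\<^sub>R \<pi> v)" for c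
    unfolding \<pi>_def blinfun_sum_right blinfun.scaleR_right scaleR_sum_left scaleR_sum_right
    by (subst sum.swap) simp
  have \<epsilon>_\<pi>: "\<epsilon> e (\<pi> x) = 0" if "e \<in> A" for e x
    unfolding \<pi>_def using that A(1) by (subst dual_family_coeff[OF dualE]) auto
  define u where "u j = (if j \<in> B then \<pi> j else j)" for j
  define \<zeta> where "\<zeta> j = (if j \<in> B then \<eta> j else \<epsilon> j)" for j
  have uA: "u b = b" "\<zeta> b = \<epsilon> b" if "b \<in> A" for b using disj that by (auto simp: u_def \<zeta>_def)
  have dual: "dual_family (A \<union> B) u \<zeta>" unfolding dual_family_def
  proof (intro conjI ballI allI)
    fix i j assume ij: "i \<in> A \<union> B" "j \<in> A \<union> B"
    have "\<eta> i (\<pi> j) = \<eta> i j" if "i \<in> B"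
      using \<eta>L[OF that \<pi>_diff[of j]] by (simp add: blinfun.diff_right)
    then show "\<zeta> i (u j) = (if i = j then 1 else 0)"
      using ij disj A(1) by (auto simp: u_def \<zeta>_def \<eta> \<epsilon>_\<pi> \<eta>L dual_family_apply[OF dualE])
  next
    fix x
    have "\<pi> x = (\<Sum>v\<in>B. \<eta> v x *\<^sub>R \<pi> v)"
      using \<pi>_cong[OF \<eta>(3)[of x]] by (simp add: \<pi>_sum)
    then have "x = (\<Sum>e\<in>A. \<epsilon> e x *\<^sub>R e) + (\<Sum>v\<in>B. \<eta> v x *\<^sub>R \<pi> v)"
      using split[of x] by simp
    also have "(\<Sum>e\<in>A. \<epsilon> e x *\<^sub>R e) = (\<Sum>e\<in>A. \<zeta> e x *\<^sub>R u e)"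
      using uA by simp
    also have "(\<Sum>v\<in>B. \<eta> v x *\<^sub>R \<pi> v) = (\<Sum>v\<in>B. \<zeta> v x *\<^sub>R u v)"
      by (simp add: u_def \<zeta>_def)
    finally show "x = (\<Sum>j\<in>A \<union> B. \<zeta> j x *\<^sub>R u j)"
      using fin disj by (simp add: sum.union_disjoint)
  qed (use fin in simp)
  have "cell_measure A u = cell_measure A (\<lambda>x. x)"
    unfolding cell_measure_def using uA by simp
  then have "cone_data \<Lambda> L A B u \<zeta> \<kappa>"
    using dual disj subL A(1) uA B \<kappa> \<eta>(1) G dual_family_rational[OF G E dualE]
    by unfold_locales (auto simp: lattice_in_def u_def \<zeta>_def \<pi>_diff)
  moreover have "- \<zeta> v \<in> cone_covectors \<Lambda> L B" if "v \<in> B" for v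
    unfolding cone_covectors_def using that \<eta>(1)[OF that] \<eta>(2)[OF that]
    by (auto simp: \<zeta>_def intro!: exI[of _ "\<eta> v"] bexI[of _ v])
  ultimately show ?thesis using uA(2) by blast
qed

lemma mem_qproj_image_iff:
  assumes "subspace L"
  shows "qproj L x \<in> qproj L ` X \<longleftrightarrow> (\<exists>y\<in>X. x - y \<in> L)"
  by (auto simp: image_iff qproj_eq_iff[OF assms])

lemma quot_rational_cone_lift:
  assumes "subspace L" "quot_rational_cone \<Lambda> L z"
  shows "rational_cone \<Lambda> {x. qproj L x \<in> z}"
proof -
  obtain M where M: "finite M" "M \<subseteq> dual_lattice \<Lambda> \<inter> annihilator L"
    "z = qproj L ` {x. \<forall>\<mu>\<in>M. blinfun_apply \<mu> x \<le> 0}"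
    using assms(2) by (auto simp: quot_rational_cone_def)
  have "blinfun_apply \<mu> x = blinfun_apply \<mu> y" if "\<mu> \<in> M" "x - y \<in> L" for \<mu> x y
    using M(2) that by (force simp: annihilator_def blinfun.diff_right)
  then have "{x. qproj L x \<in> z} = {x. \<forall>\<mu>\<in>M. blinfun_apply \<mu> x \<le> 0}"
    unfolding M(3) mem_qproj_image_iff[OF assms(1)] using subspace_0[OF assms(1)] by force
  then show ?thesis unfolding rational_cone_def using M by auto
qed

text \<open>The coordinates of \<open>K\<close> outside \<open>A\<close> factor through V/L, so
  \<open>K\<close> is the preimage of its projection, cut down by the inequalities on
  \<open>A\<close>. The relation in V/L thus becomes one in V after multiplication by the indicator
  of \<open>X0\<close>. The subspace \<open>L'\<close> is arbitrary because the same pieces must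
  serve for S^L and for the integral.\<close>

lemma simplicial_cone_decomposition:
  fixes \<Lambda> :: "'a::euclidean_space set" and B :: "nat \<Rightarrow> 'a set"
  assumes \<Lambda>: "lattice_in \<Lambda> UNIV" and L: "rational_subspace \<Lambda> L"
    and K: "simplicial_full_cone \<Lambda> K" and F: "F face_of K" "span F = L"
    and B: "\<And>j. j < N \<Longrightarrow> quot_lattice_basis \<Lambda> L (B j)"
    and cong: "cong_mod_indicators {Z. quot_rational_cone \<Lambda> L Z \<and> quot_contains_line L Z}
             (indicator (qproj L ` K))
             (\<lambda>x. \<Sum>j<N. \<delta> j * indicator (qproj L ` (convex_cone hull B j)) x)"
  shows "\<exists>A u \<zeta> \<kappa>. (\<forall>j<N. cone_data \<Lambda> L A (B j) (u j) (\<zeta> j) \<kappa> \<and>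
       (\<forall>v\<in>B j. - \<zeta> j v \<in> cone_covectors \<Lambda> L (B j))) \<and> rational_cone \<Lambda> K \<and>
     (\<forall>L' S s. intermediate_generating_function \<Lambda> L' S \<longrightarrow>
        mero_eq (S (shift s K)) (\<lambda>\<xi>. \<Sum>j<N. of_real (\<delta> j) * S (shift s (cone_data.K A (B j) (\<zeta> j))) \<xi>))"
proof -
  obtain G where G: "lattice_basis \<Lambda> UNIV G" using \<Lambda> by (auto simp: lattice_in_def)
  obtain H where H: "lattice_basis (L \<inter> \<Lambda>) L H"
    using L by (auto simp: rational_subspace_def lattice_in_def)
  have subL: "subspace L" using L by (simp add: rational_subspace_def)
  obtain E where E: "E \<subseteq> \<Lambda>" "independent E" "span E = UNIV" "K = convex_cone hull E"
    using K by (auto simp: simplicial_full_cone_def)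
  obtain \<epsilon> where \<epsilon>: "dual_family E (\<lambda>x. x) \<epsilon>" using dual_family_exists[OF E(2,3)] by blast
  define A where "A = E \<inter> L"
  have spA: "span A = L" unfolding A_def
    using span_face_of_simplicial_cone[OF \<epsilon>] F E(4) by blast
  have finE: "finite E" using \<epsilon> by (rule dual_family_finite)
  define H' where "H' = (SOME G. lattice_basis (L \<inter> \<Lambda>) L G)"
  have "lattice_basis (L \<inter> \<Lambda>) L H'" unfolding H'_def using H by (rule someI)
  then have "independent H'" "span H' = span A" using spA by (auto simp: lattice_basis_def)
  moreover have "independent A" using E(2) by (rule independent_mono) (auto simp: A_def)
  ultimately obtain \<kappa> where \<kappa>: "\<kappa> > 0" "cell_measure H' (\<lambda>x. x) =
           density (cell_measure A (\<lambda>x. x)) (\<lambda>_. ennreal \<kappa>)"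
    using cell_measure_proportional by blast
  have "\<exists>u \<zeta>. cone_data \<Lambda> L A (B j) u \<zeta> \<kappa> \<and> (\<forall>v\<in>B j. - \<zeta> v \<in> cone_covectors \<Lambda> L (B j)) \<and>
    (\<forall>b\<in>A. \<zeta> b = \<epsilon> b)" if "j < N" for j
    by (rule cone_data_exists[OF G H B[OF that] \<epsilon> E(1-3) A_def spA \<kappa>[unfolded H'_def]])
  then obtain u \<zeta> where data: "\<And>j. j < N \<Longrightarrow> cone_data \<Lambda> L A (B j) (u j) (\<zeta> j) \<kappa>"
    and cov: "\<And>j v. j < N \<Longrightarrow> v \<in> B j \<Longrightarrow> - \<zeta> j v \<in> cone_covectors \<Lambda> L (B j)"
    and \<zeta>A: "\<And>j b. j < N \<Longrightarrow> b \<in> A \<Longrightarrow> \<zeta> j b = \<epsilon> b"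
    by metis
  have Keq: "K = {x. \<forall>e\<in>E. 0 \<le> \<epsilon> e x}" using E(4) simplicial_cone_eq[OF \<epsilon>] by simp
  have ratE: "\<exists>N::nat. N > 0 \<and> of_nat N *\<^sub>R \<epsilon> e \<in> dual_lattice \<Lambda>" if "e \<in> E" for e
    using dual_family_rational[OF G E(1-3) \<epsilon> that] .
  have ratK: "rational_cone \<Lambda> K" unfolding Keq using finE ratE by (rule rational_cone_of_functionals)
  define X0 where "X0 = {x. \<forall>b\<in>A. 0 \<le> \<epsilon> b x}"
  have ratX0: "rational_cone \<Lambda> X0"
    unfolding X0_def by (rule rational_cone_of_functionals) (use finE ratE in \<open>auto simp: A_def\<close>)
  have \<epsilon>_L: "\<epsilon> e x = 0" if "e \<in> E - A" "x \<in> L" for e x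
    using dual_family_vanishes[OF \<epsilon> _ that(1), of x] that(2) spA by (simp add: A_def)
  have K_iff: "x \<in> K \<longleftrightarrow> x \<in> X0 \<and> qproj L x \<in> qproj L ` K" for x
  proof
    assume "x \<in> K"
    then show "x \<in> X0 \<and> qproj L x \<in> qproj L ` K" by (auto simp: X0_def Keq A_def)
  next
    assume x: "x \<in> X0 \<and> qproj L x \<in> qproj L ` K"
    then obtain k where k: "k \<in> K" "x - k \<in> L" by (auto simp: mem_qproj_image_iff[OF subL])
    have "\<epsilon> e x = \<epsilon> e k" if "e \<in> E - A" for e
      using \<epsilon>_L[OF that k(2)] by (simp add: blinfun.diff_right)
    then have "0 \<le> \<epsilon> e x" if "e \<in> E" for e
      using x k(1) that by (cases "e \<in> A") (auto simp: Keq X0_def)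
    then show "x \<in> K" by (simp add: Keq)
  qed
  have Kj_iff: "x \<in> cone_data.K A (B j) (\<zeta> j) \<longleftrightarrow> x \<in> X0 \<and> qproj L x \<in> qproj L ` (convex_cone hull B j)"
    if j: "j < N" for x j
  proof -
    interpret cone_data \<Lambda> L A "B j" "u j" "\<zeta> j" \<kappa> by (rule data[OF j])
    have "qproj L x \<in> qproj L ` (convex_cone hull B j) \<longleftrightarrow> (\<forall>v\<in>B j. 0 \<le> \<zeta> j v x)"
      unfolding mem_qproj_image_iff[OF subL]
    proof
      assume "\<exists>y\<in>convex_cone hull B j. x - y \<in> L"
      then obtain y where y: "y \<in> convex_cone hull B j" "x - y \<in> L" by blast
      show "\<forall>v\<in>B j. 0 \<le> \<zeta> j v x"
      proof
        fix v assume v: "v \<in> B j"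
        have "0 \<le> \<zeta> j v y"
          using y(1) by (rule convex_cone_hull_functional_nonneg) (simp add: \<zeta>_B v)
        then show "0 \<le> \<zeta> j v x" using \<zeta>_cong[OF v y(2)] by simp
      qed
    next
      assume *: "\<forall>v\<in>B j. 0 \<le> \<zeta> j v x"
      define y where "y = (\<Sum>v\<in>B j. \<zeta> j v x *\<^sub>R v)"
      have "y \<in> convex_cone hull B j"
        unfolding y_def using * by (intro nonneg_combination_in_convex_cone_hull) auto
      moreover have "x - y \<in> L"
      proof -
        have "x - y = (\<Sum>b\<in>A. \<zeta> j b x *\<^sub>R u j b) +
           (\<Sum>v\<in>B j. \<zeta> j v x *\<^sub>R (u j v - v))"
          unfolding y_def by (subst expand[of x]) (simp add: scaleR_diff_right sum_subtractf)
        also have "\<dots> \<in> L"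
          by (intro subspace_add[OF subL] subspace_sum[OF subL] subspace_scale[OF subL] u_in u_lift)
        finally show ?thesis .
      qed
      ultimately show "\<exists>y\<in>convex_cone hull B j. x - y \<in> L" by blast
    qed
    then show ?thesis
      unfolding K_def X0_def ball_Un mem_Collect_eq using \<zeta>A[OF j] by simp
  qed
  obtain C b where C: "finite C" "\<And>z. z \<in> C \<Longrightarrow> quot_rational_cone \<Lambda> L z \<and> quot_contains_line L z"
    "\<And>X. indicator (qproj L ` K) X = (\<Sum>j<N. \<delta> j * indicator (qproj L ` (convex_cone hull B j)) X) +
       (\<Sum>z\<in>C. b z * indicator z X)"
    using cong unfolding cong_mod_indicators_def by blast
  define Z where "Z z = {x. qproj L x \<in> z} \<inter> X0" for z
  have ratZ: "rational_cone \<Lambda> (Z z)" if "z \<in> C" for z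
    unfolding Z_def using quot_rational_cone_lift[OF subL] C(2)[OF that] ratX0
    by (intro rational_cone_Int) auto
  have lineZ: "contains_line (Z z)" if zC: "z \<in> C" for z
  proof -
    obtain x v where xv: "v \<notin> L" "\<And>t. qproj L (x + t *\<^sub>R v) \<in> z"
      using C(2)[OF zC] by (auto simp: quot_contains_line_def)
    \<comment> \<open>The line is lifted with all \<open>A\<close>-coordinates removed, so it
      satisfies the inequalities of \<open>X0\<close> with equality; its direction is congruent to
      \<open>v\<close> modulo L and hence nonzero.\<close>
    define \<pi> where "\<pi> x = x - (\<Sum>e\<in>A. \<epsilon> e x *\<^sub>R e)" for x
    have sumA: "(\<Sum>e\<in>A. c e *\<^sub>R e) \<in> L" for c
      by (intro subspace_sum[OF subL] subspace_scale[OF subL]) (auto simp: A_def)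
    have \<epsilon>_\<pi>: "\<epsilon> b (\<pi> x) = 0" if "b \<in> A" for b x
      unfolding \<pi>_def blinfun.diff_right using that
      by (subst dual_family_coeff[OF \<epsilon>]) (auto simp: A_def)
    have "\<pi> x + t *\<^sub>R \<pi> v \<in> Z z" for t
    proof -
      have "(x + t *\<^sub>R v) - (\<pi> x + t *\<^sub>R \<pi> v) =
        (\<Sum>e\<in>A. \<epsilon> e x *\<^sub>R e) + t *\<^sub>R (\<Sum>e\<in>A. \<epsilon> e v *\<^sub>R e)"
        by (simp add: \<pi>_def algebra_simps)
      also have "\<dots> \<in> L" by (intro subspace_add[OF subL] subspace_scale[OF subL] sumA)
      finally have "qproj L (\<pi> x + t *\<^sub>R \<pi> v) = qproj L (x + t *\<^sub>R v)"
        using qproj_eq_iff[OF subL] by metis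
      then show ?thesis using xv(2)[of t] \<epsilon>_\<pi>
        by (simp add: Z_def X0_def blinfun.add_right blinfun.scaleR_right)
    qed
    moreover have "v - \<pi> v \<in> L" using sumA by (simp add: \<pi>_def)
    then have "\<pi> v \<noteq> 0" using xv(1) by auto
    ultimately show ?thesis unfolding contains_line_def by blast
  qed
  have "mero_eq (S (shift s K)) (\<lambda>\<xi>. \<Sum>j<N. of_real (\<delta> j) * S (shift s (cone_data.K A (B j) (\<zeta> j))) \<xi>)"
    if S: "intermediate_generating_function \<Lambda> L' S" for L' S s
  proof (rule valuation_mod_lines[OF S _ ratK])
    show "rational_cone \<Lambda> (cone_data.K A (B j) (\<zeta> j))" if "j \<in> {..<N}" for j
      using cone_data.rational_cone_K[OF data] that by auto
    \<comment> \<open>Distinct quotient cones may have the same set \<open>Z z\<close>, so their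
      coefficients are added.\<close>
    define b' where "b' q = (\<Sum>z\<in>{z \<in> C. Z z = q}. b z)" for q
    have "indicator K x = (\<Sum>j<N. \<delta> j * indicator (cone_data.K A (B j) (\<zeta> j)) x) +
       (\<Sum>q\<in>Z ` C. b' q * indicator q x)" for x
    proof -
      have "(\<Sum>q\<in>Z ` C. b' q * indicator q x) = (\<Sum>z\<in>C. b z * indicator (Z z) x)"
        unfolding b'_def sum_distrib_right sum.image_gen[OF C(1), of "\<lambda>z. b z * indicator (Z z) x" Z]
        by (intro sum.cong) auto
      also have "\<dots> = indicator X0 x * (\<Sum>z\<in>C. b z * indicator z (qproj L x))"
        unfolding sum_distrib_left by (intro sum.cong) (auto simp: Z_def indicator_def)
      finally have 1: "(\<Sum>q\<in>Z ` C. b' q * indicator q x) = \<dots>" .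
      have 2: "(\<Sum>j<N. \<delta> j * indicator (cone_data.K A (B j) (\<zeta> j)) x) =
        indicator X0 x * (\<Sum>j<N. \<delta> j * indicator (qproj L ` (convex_cone hull B j)) (qproj L x))"
        unfolding sum_distrib_left using Kj_iff by (intro sum.cong) (auto simp: indicator_def)
      have "indicator K x = indicator X0 x * (indicator (qproj L ` K) (qproj L x) :: real)"
        using K_iff[of x] by (simp add: indicator_def)
      then show ?thesis unfolding 1 2 C(3) by (simp add: ring_distribs)
    qed
    then show "cong_mod_indicators {Z. rational_cone \<Lambda> Z \<and> contains_line Z} (indicator K)
       (\<lambda>x. \<Sum>j<N. \<delta> j * indicator (cone_data.K A (B j) (\<zeta> j)) x)"
      unfolding cong_mod_indicators_def using C(1) ratZ lineZ
      by (intro exI[of _ "Z ` C"] exI[of _ b']) auto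
  qed simp
  then show ?thesis using data cov ratK by (intro exI[of _ A] exI[of _ u] exI[of _ \<zeta>] exI[of _ \<kappa>]) blast
qed

text \<open>The fundamental parallelepipeds of \<open>\<Lambda>\<close> and of \<open>L \<inter> \<Lambda>\<close> are compared through the basis
  \<open>H \<union> B\<close> of \<open>\<Lambda>\<close>, and shearing \<open>B\<close> to \<open>u ` B\<close> along \<open>L\<close> preserves volume; hence the
  constant is the same for the full integral.\<close>

lemma (in cone_data) cone_data_UNIV:
  assumes H: "lattice_in (L \<inter> \<Lambda>) L"
  shows "cone_data \<Lambda> UNIV (A \<union> B) {} u \<zeta> \<kappa>"
proof
  obtain G0 where G0: "lattice_basis \<Lambda> UNIV G0" using lattice by (auto simp: lattice_in_def)
  define H' where "H' = (SOME G. lattice_basis (L \<inter> \<Lambda>) L G)"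
  have H': "lattice_basis (L \<inter> \<Lambda>) L H'"
    unfolding H'_def using H by (auto simp: lattice_in_def intro: someI)
  note HB = lattice_basis_Un_quot[OF G0 H' quot_basis]
  have finH: "finite H'" using H' by (auto simp: lattice_basis_def intro: independent_imp_finite)
  define G1 where "G1 = (SOME G. lattice_basis (UNIV \<inter> \<Lambda>) UNIV G)"
  have "lattice_basis (UNIV \<inter> \<Lambda>) UNIV G1" unfolding G1_def by (rule someI[of _ G0]) (simp add: G0)
  then have "cell_measure G1 (\<lambda>x. x) = cell_measure (H' \<union> B) (\<lambda>x. x)"
    using cell_measure_lattice_basis[OF _ HB(1)] by simp
  also have "\<dots> = density (cell_measure (A \<union> B) u) (\<lambda>_. ennreal \<kappa>)"
  proof (rule measure_eqI)
    fix X assume "X \<in> sets (cell_measure (H' \<union> B) (\<lambda>x. x))"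
    then have X [measurable]: "X \<in> sets borel" by simp
    define f :: "'a \<Rightarrow> ennreal" where "f = indicator X"
    have f [measurable]: "f \<in> borel_measurable borel" by (simp add: f_def)
    define g where "g y = (\<integral>\<^sup>+x. f (x + y) \<partial>cell_measure A u)" for y
    have g [measurable]: "g \<in> borel_measurable borel"
      using measurable_nn_integral_cell[OF finite_A f, of "\<lambda>x. x" borel]
      by (simp add: g_def[abs_def])
    \<comment> \<open>The inner integral depends only on the coset modulo L, so each
      \<open>v\<close> in the outer integral may be exchanged for \<open>u v\<close>.\<close>
    have g_shift: "g (y + l) = g y" if "l \<in> L" for y l
    proof -
      have "l = (\<Sum>b\<in>A. \<zeta> b l *\<^sub>R u b)"
      proof -
        have "\<zeta> v l = 0" if "v \<in> B" for v
          using \<zeta>_ann[OF that] \<open>l \<in> L\<close> by (simp add: annihilator_def)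
        then show ?thesis by (subst expand[of l]) simp
      qed
      also have "\<dots> \<in> span (u ` A)" by (intro span_sum span_scale span_base imageI)
      finally have "l \<in> span (u ` A)" .
      from nn_integral_cell_translate[OF finite_A this, of "\<lambda>x. f (x + y)"]
      show ?thesis by (simp add: g_def add_ac)
    qed
    have "emeasure (cell_measure (H' \<union> B) (\<lambda>x. x)) X =
      (\<integral>\<^sup>+x. f x \<partial>cell_measure (H' \<union> B) (\<lambda>x. x))"
      by (simp add: f_def)
    also have "\<dots> = (\<integral>\<^sup>+y. (\<integral>\<^sup>+x. f (x + y) \<partial>cell_measure H' (\<lambda>x. x)) \<partial>cell_measure B (\<lambda>x. x))"
      using finH HB(2) f by (intro nn_integral_cell_Un) auto
    also have "\<dots> = (\<integral>\<^sup>+y. ennreal \<kappa> * g y \<partial>cell_measure B (\<lambda>x. x))"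
      unfolding \<kappa>[folded H'_def] g_def by (simp add: nn_integral_density nn_integral_cmult)
    also have "\<dots> = ennreal \<kappa> * (\<integral>\<^sup>+y. g y \<partial>cell_measure B (\<lambda>x. x))"
      by (rule nn_integral_cmult) simp
    also have "(\<integral>\<^sup>+y. g y \<partial>cell_measure B (\<lambda>x. x)) =
      (\<integral>\<^sup>+a. g (\<Sum>v\<in>B. a v *\<^sub>R v) \<partial>Pi\<^sub>M B (\<lambda>_. lborel))"
      by (rule nn_integral_cell) simp
    also have "\<dots> = (\<integral>\<^sup>+a. g (\<Sum>v\<in>B. a v *\<^sub>R u v) \<partial>Pi\<^sub>M B (\<lambda>_. lborel))"
    proof (intro nn_integral_cong)
      fix a :: "'a \<Rightarrow> real"
      have "(\<Sum>v\<in>B. a v *\<^sub>R u v) = (\<Sum>v\<in>B. a v *\<^sub>R v) + (\<Sum>v\<in>B. a v *\<^sub>R (u v - v))"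
        by (simp add: scaleR_diff_right sum_subtractf)
      moreover have "(\<Sum>v\<in>B. a v *\<^sub>R (u v - v)) \<in> L"
        by (intro subspace_sum[OF subspace] subspace_scale[OF subspace] u_lift)
      ultimately show "g (\<Sum>v\<in>B. a v *\<^sub>R v) = g (\<Sum>v\<in>B. a v *\<^sub>R u v)" by (simp add: g_shift)
    qed
    also have "\<dots> = (\<integral>\<^sup>+y. g y \<partial>cell_measure B u)"
      by (rule nn_integral_cell[symmetric]) simp
    also have "\<dots> = (\<integral>\<^sup>+x. f x \<partial>cell_measure (A \<union> B) u)"
      unfolding g_def using disjoint f by (intro nn_integral_cell_Un[symmetric]) auto
    also have "ennreal \<kappa> * \<dots> = emeasure (density (cell_measure (A \<union> B) u) (\<lambda>_. ennreal \<kappa>)) X"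
      by (simp add: f_def emeasure_density nn_integral_cmult_indicator)
    finally show "emeasure (cell_measure (H' \<union> B) (\<lambda>x. x)) X =
      emeasure (density (cell_measure (A \<union> B) u) (\<lambda>_. ennreal \<kappa>)) X" .
  qed simp
  finally show "cell_measure (SOME G. lattice_basis (UNIV \<inter> \<Lambda>) UNIV G) (\<lambda>x. x) =
           density (cell_measure (A \<union> B) u) (\<lambda>_. ennreal \<kappa>)"
    unfolding G1_def .
\<comment> \<open>The quotient by the whole space is trivial and has the empty basis: all edges
  become directions of integration.\<close>
qed (use lattice dual \<kappa>_pos \<zeta>_rational_all in \<open>auto simp: quot_lattice_basis_def\<close>)

section \<open>Homogeneous components\<close>

text \<open>Both levels of the construction are flattened into one index set. The pieces depend
  neither on \<open>s\<close> nor on the valuation, so one decomposition serves all shifts as well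
  as \<open>S\<close> and \<open>I\<close>.\<close>

lemma covector_decomposition:
  fixes \<Lambda> :: "'a::euclidean_space set"
  assumes \<Lambda>: "lattice_in \<Lambda> UNIV" and c: "rational_cone \<Lambda> c" and L: "rational_subspace \<Lambda> L"
    and \<Psi>: "constructed_covectors \<Lambda> L c \<Psi>"
  shows "\<exists>(T :: (nat \<times> nat) set) a A B u \<zeta> \<kappa>. finite T \<and>
    (\<forall>t\<in>T. cone_data \<Lambda> L (A t) (B t) (u t) (\<zeta> t) (\<kappa> t) \<and> (\<forall>v\<in>B t. - \<zeta> t v \<in> \<Psi>)) \<and>
    (\<forall>L' S s. intermediate_generating_function \<Lambda> L' S \<longrightarrow>
       mero_eq (S (shift s c)) (\<lambda>\<xi>. \<Sum>t\<in>T. of_real (a t) * S (shift s (cone_data.K (A t) (B t) (\<zeta> t))) \<xi>))"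
  using \<Psi> unfolding constructed_covectors_def
proof (elim exE conjE, goal_cases)
  case (1 n \<epsilon> K N \<delta> B)
  have K: "simplicial_full_cone \<Lambda> (K i) \<and> (\<exists>F. F face_of K i \<and> span F = L)" if "i < n" for i
    using 1(1) that by blast
  note c_cong = 1(2)
  have B: "quot_lattice_basis \<Lambda> L (B i j)" if "i < n" "j < N i" for i j
    using 1(3) that by blast
  have K_cong: "cong_mod_indicators {Z. quot_rational_cone \<Lambda> L Z \<and> quot_contains_line L Z}
             (indicator (qproj L ` K i))
             (\<lambda>x. \<Sum>j<N i. \<delta> i j * indicator (qproj L ` (convex_cone hull B i j)) x)" if "i < n" for i
    using 1(3) that by blast
  note \<Psi>_eq = 1(4)
  define P where "P i A u \<zeta> \<kappa> \<longleftrightarrow> (\<forall>j<N i. cone_data \<Lambda> L A (B i j) (u j) (\<zeta> j) \<kappa> \<and>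
       (\<forall>v\<in>B i j. - \<zeta> j v \<in> cone_covectors \<Lambda> L (B i j))) \<and> rational_cone \<Lambda> (K i) \<and>
     (\<forall>L' S s. intermediate_generating_function \<Lambda> L' S \<longrightarrow>
        mero_eq (S (shift s (K i))) (\<lambda>\<xi>. \<Sum>j<N i. of_real (\<delta> i j) * S (shift s (cone_data.K A (B i j) (\<zeta> j))) \<xi>))"
    for i A u \<zeta> \<kappa>
  have "\<exists>A u \<zeta> \<kappa>. P i A u \<zeta> \<kappa>" if i: "i < n" for i
  proof -
    obtain F where "F face_of K i" "span F = L" using K[OF i] by blast
    then show ?thesis unfolding P_def
      using simplicial_cone_decomposition[OF \<Lambda> L, of "K i" F "N i" "B i" "\<delta> i"] K[OF i] B[OF i] K_cong[OF i]
      by blast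
  qed
  then obtain A u \<zeta> \<kappa> where P: "\<And>i. i < n \<Longrightarrow> P i (A i) (u i) (\<zeta> i) (\<kappa> i)"
    by metis
  define T where "T = (SIGMA i:{..<n}. {..<N i})"
  define a where "a t = \<epsilon> (fst t) * \<delta> (fst t) (snd t)" for t
  have "mero_eq (S (shift s c)) (\<lambda>\<xi>. \<Sum>t\<in>T. of_real (a t) *
      S (shift s (cone_data.K (A (fst t)) (B (fst t) (snd t)) (\<zeta> (fst t) (snd t)))) \<xi>)"
    if S: "intermediate_generating_function \<Lambda> L' S" for L' S s
  proof -
    have "mero_eq (S (shift s c)) (\<lambda>\<xi>. \<Sum>i<n. of_real (\<epsilon> i) * S (shift s (K i)) \<xi>)"
      using P by (intro valuation_mod_lines[OF S _ c _ c_cong]) (auto simp: P_def)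
    also have "mero_eq \<dots> (\<lambda>\<xi>. \<Sum>i<n. of_real (\<epsilon> i) *
        (\<Sum>j<N i. of_real (\<delta> i j) * S (shift s (cone_data.K (A i) (B i j) (\<zeta> i j))) \<xi>))"
      using P S unfolding P_def by (intro mero_eq_sum) blast
    also have "(\<lambda>\<xi>. \<Sum>i<n. of_real (\<epsilon> i) *
        (\<Sum>j<N i. of_real (\<delta> i j) * S (shift s (cone_data.K (A i) (B i j) (\<zeta> i j))) \<xi>)) =
      (\<lambda>\<xi>. \<Sum>t\<in>T. of_real (a t) *
        S (shift s (cone_data.K (A (fst t)) (B (fst t) (snd t)) (\<zeta> (fst t) (snd t)))) \<xi>)"
      unfolding T_def a_def sum_distrib_left by (subst sum.Sigma) (auto simp: split_def mult_ac)
    finally show ?thesis .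
  qed
  moreover have "cone_data \<Lambda> L (A (fst t)) (B (fst t) (snd t)) (u (fst t) (snd t)) (\<zeta> (fst t) (snd t)) (\<kappa> (fst t)) \<and>
      (\<forall>v\<in>B (fst t) (snd t). - \<zeta> (fst t) (snd t) v \<in> \<Psi>)" if "t \<in> T" for t
  proof -
    have t: "fst t < n" "snd t < N (fst t)" using that by (auto simp: T_def)
    then show ?thesis using P[OF t(1)] unfolding P_def \<Psi>_eq by blast
  qed
  moreover have "finite T" by (simp add: T_def)
  ultimately show ?case
    by (intro exI[of _ T] exI[of _ a] exI[of _ "\<lambda>t. A (fst t)"] exI[of _ "\<lambda>t. B (fst t) (snd t)"]
        exI[of _ "\<lambda>t. u (fst t) (snd t)"] exI[of _ "\<lambda>t. \<zeta> (fst t) (snd t)"] exI[of _ "\<lambda>t. \<kappa> (fst t)"]) blast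
qed

lemma (in cone_data) generating_UNIV:
  assumes "lattice_in (L \<inter> \<Lambda>) L"
  shows "cone_data.K (A \<union> B) {} \<zeta> = K"
    and "cone_data.generating (A \<union> B) {} u \<zeta> \<kappa> 0 \<xi> = M_num \<xi> * fps_nth (M_fps s \<xi>) 0"
proof -
  interpret full: cone_data \<Lambda> UNIV "A \<union> B" "{}" u \<zeta> \<kappa>
    by (rule cone_data_UNIV[OF assms])
  show "full.K = K" by (simp add: K_def full.K_def)
  have "full.generating 0 \<xi> = of_real \<kappa> * (\<Prod>j\<in>A \<union> B. - 1 / blinfun_apply \<xi> (u j))"
    by (simp add: full.generating_def full.L_factor_def blinfun.zero_right)
  also have "\<dots> = of_real \<kappa> * ((- 1) ^ card (A \<union> B) / (\<Prod>j\<in>A \<union> B. blinfun_apply \<xi> (u j)))"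
    by (subst prod_dividef) simp
  also have "\<dots> = M_num \<xi> * fps_nth (M_fps s \<xi>) 0"
    using disjoint by (simp add: M_num_def M_fps_0 card_Un_disjoint power_add)
  finally show "full.generating 0 \<xi> = M_num \<xi> * fps_nth (M_fps s \<xi>) 0" .
qed

lemma hom_rational_cmult: "g \<in> hom_rational m \<Longrightarrow> (\<lambda>\<xi>. c * g \<xi>) \<in> hom_rational m"
  using hom_rational_mult[OF hom_cpolynomial_const, of g m c] by simp

lemma has_laurent_expansion_sum_shift:
  assumes "finite T" "\<And>t. t \<in> T \<Longrightarrow> f t has_laurent_expansion fls_shift d (fps_to_fls (F t))"
  shows "(\<lambda>\<tau>. \<Sum>t\<in>T. c t * f t \<tau>) has_laurent_expansion
           fls_shift d (fps_to_fls (\<Sum>t\<in>T. fps_const (c t) * F t))"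
  using assms
proof (induction T rule: finite_induct)
  case (insert t T)
  have "(\<lambda>\<tau>. c t * f t \<tau> + (\<Sum>t\<in>T. c t * f t \<tau>)) has_laurent_expansion
     fls_const (c t) * fls_shift d (fps_to_fls (F t)) + fls_shift d (fps_to_fls (\<Sum>t\<in>T. fps_const (c t) * F t))"
    using insert by (intro has_laurent_expansion_add has_laurent_expansion_cmult_left) auto
  also have "\<dots> = fls_shift d (fps_to_fls (fps_const (c t) * F t + (\<Sum>t\<in>T. fps_const (c t) * F t)))"
    by (rule fls_eqI) (simp add: fls_times_fps_to_fls fls_shifted_times_simps flip: fps_const_to_fls)
  finally show ?case using insert(1,2) by simp
qed simp

theorem theorem24:
  fixes \<Lambda> L c :: "'a::euclidean_space set"
    and \<Psi> :: "('a \<Rightarrow>\<^sub>L real) set"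
    and S I :: "'a set \<Rightarrow> 'a cdual \<Rightarrow> complex"
    and m :: int
  assumes "lattice_in \<Lambda> UNIV"
    and "rational_cone \<Lambda> c" and "aff_dim c = int DIM('a)"
    and "rational_subspace \<Lambda> L"
    and "constructed_covectors \<Lambda> L c \<Psi>"
    and "intermediate_generating_function \<Lambda> L S"
    and "intermediate_generating_function \<Lambda> UNIV I"
  shows
    "(\<exists>F \<in> tensor (step_poly \<Psi> (m + int DIM('a))) (hom_rational m).
        \<forall>s. mero_eq (hom_component m (M_fun S s c)) (F s)) \<and>
     (\<exists>F \<in> tensor (quasi_poly \<Psi> (m + int DIM('a))) (hom_rational m).
        \<forall>s. mero_eq (hom_component m (S (shift s c))) (F s)) \<and>
     (\<forall>s. mero_eq (hom_component m (S (shift s c)))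
        (\<lambda>\<xi>. \<Sum>r\<in>{r::nat. int r \<le> m + int DIM('a)}.
               blinfun_apply \<xi> s ^ r / fact r * hom_component (m - int r) (M_fun S s c) \<xi>)) \<and>
     (\<forall>s. (\<forall>k < - int DIM('a). mero_eq (hom_component k (S (shift s c))) (\<lambda>_. 0)) \<and>
          mero_eq (hom_component (- int DIM('a)) (S (shift s c))) (I c) \<and>
          mero_eq (hom_component (- int DIM('a)) (M_fun S s c)) (I c))"
proof -
  note \<Lambda> = assms(1) and c = assms(2) and L = assms(4) and S = assms(6) and I = assms(7)
  define d where "d = int DIM('a)"
  have HL: "lattice_in (L \<inter> \<Lambda>) L" using L by (simp add: rational_subspace_def)
  obtain T :: "(nat \<times> nat) set" and a A B u \<zeta> \<kappa> where T: "finite T"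
    and data: "\<And>t. t \<in> T \<Longrightarrow> cone_data \<Lambda> L (A t) (B t) (u t) (\<zeta> t) (\<kappa> t)"
    and \<Psi>: "\<And>t v. t \<in> T \<Longrightarrow> v \<in> B t \<Longrightarrow> - \<zeta> t v \<in> \<Psi>"
    and val: "\<And>L' S s. intermediate_generating_function \<Lambda> L' S \<Longrightarrow>
       mero_eq (S (shift s c)) (\<lambda>\<xi>. \<Sum>t\<in>T. of_real (a t) * S (shift s (cone_data.K (A t) (B t) (\<zeta> t))) \<xi>)"
    using covector_decomposition[OF \<Lambda> c L assms(5)] by blast
  define gen where "gen t = cone_data.generating (A t) (B t) (u t) (\<zeta> t) (\<kappa> t)" for t
  define num where "num t = cone_data.M_num (A t) (B t) (u t) (\<kappa> t)" for t
  define ser where "ser t = cone_data.M_fps (B t) (u t) (\<zeta> t)" for t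
  \<comment> \<open>Multiplied by \<tau>^(-d), this is the Laurent series of M along the line
    through \<xi>.\<close>
  define R where "R s \<xi> = (\<Sum>t\<in>T. fps_const (of_real (a t)) * (fps_const (num t \<xi>) * ser t s \<xi>))" for s \<xi>
  \<comment> \<open>The representative of the component that is defined for all s and \<xi>. The
    case distinction matters: \<open>nat\<close> would send a negative index to 0 and return the
    lowest coefficient.\<close>
  define C where "C m s \<xi> = (if m + d < 0 then 0 else fps_nth (R s \<xi>) (nat (m + d)))" for m s \<xi>
  have R_nth: "fps_nth (R s \<xi>) k = (\<Sum>t\<in>T. of_real (a t) * (num t \<xi> * fps_nth (ser t s \<xi>) k))" for s \<xi> k
    by (simp add: R_def fps_sum_nth)

  have S_eq: "mero_eq (S (shift s c)) (\<lambda>\<xi>. \<Sum>t\<in>T. of_real (a t) * gen t s \<xi>)" for s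
    by (rule mero_eq_trans[OF val[OF S] mero_eq_sum])
       (auto simp: gen_def intro!: cone_data.S_shift_K[OF data S])
  have M_laurent: "generic (\<lambda>\<xi>. (\<lambda>\<tau>. M_fun S s c (cscale \<tau> \<xi>)) has_laurent_expansion
      fls_shift d (fps_to_fls (R s \<xi>)))" for s
  proof -
    have 1: "generic (\<lambda>\<xi>. \<forall>\<^sub>F \<tau> in at 0. S (shift s c) (cscale \<tau> \<xi>) =
        (\<Sum>t\<in>T. of_real (a t) * gen t s (cscale \<tau> \<xi>)))"
      by (rule generic_scale) (use S_eq[of s] in \<open>simp add: mero_eq_iff_generic\<close>)
    have 2: "generic (\<lambda>\<xi>. \<forall>t\<in>T. \<forall>j\<in>A t \<union> B t. blinfun_apply \<xi> (u t j) \<noteq> 0)"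
      using T by (intro generic_ball cone_data.generic_u[OF data]) auto
    show ?thesis
    proof (rule generic_mono[OF generic_conj[OF 1 2]], elim conjE)
      fix \<xi> :: "'a cdual"
      assume ev: "\<forall>\<^sub>F \<tau> in at 0. S (shift s c) (cscale \<tau> \<xi>) = (\<Sum>t\<in>T. of_real (a t) * gen t s (cscale \<tau> \<xi>))"
        and nz: "\<forall>t\<in>T. \<forall>j\<in>A t \<union> B t. blinfun_apply \<xi> (u t j) \<noteq> 0"
      have "(\<lambda>\<tau>. \<Sum>t\<in>T. of_real (a t) * (exp (- blinfun_apply (cscale \<tau> \<xi>) s) * gen t s (cscale \<tau> \<xi>)))
         has_laurent_expansion fls_shift d (fps_to_fls (R s \<xi>))"
        unfolding R_def d_def
      proof (rule has_laurent_expansion_sum_shift[OF T])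
        fix t assume t: "t \<in> T"
        show "(\<lambda>\<tau>. exp (- blinfun_apply (cscale \<tau> \<xi>) s) * gen t s (cscale \<tau> \<xi>)) has_laurent_expansion
           fls_shift (int DIM('a)) (fps_to_fls (fps_const (num t \<xi>) * ser t s \<xi>))"
          unfolding gen_def num_def ser_def
          by (rule cone_data.has_laurent_expansion_generating[OF data[OF t]]) (use nz t in blast)
      qed
      moreover have ev': "\<forall>\<^sub>F \<tau> in at 0. (\<Sum>t\<in>T. of_real (a t) * (exp (- blinfun_apply (cscale \<tau> \<xi>) s) * gen t s (cscale \<tau> \<xi>))) =
          M_fun S s c (cscale \<tau> \<xi>)"
        using ev by eventually_elim (simp add: M_fun_def sum_distrib_left mult_ac)
      ultimately show "(\<lambda>\<tau>. M_fun S s c (cscale \<tau> \<xi>)) has_laurent_expansion fls_shift d (fps_to_fls (R s \<xi>))"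
        using has_laurent_expansion_cong[OF ev' refl] by blast
    qed
  qed
  have M_comp: "generic (\<lambda>\<xi>. \<forall>m. hom_component m (M_fun S s c) \<xi> = C m s \<xi>)" for s
    by (rule generic_mono[OF M_laurent[of s]]) (auto simp: hom_component_eq C_def)
  \<comment> \<open>S arises from M by the factor exp(<\<xi>,s>), which along the line is an
    exponential series in \<tau>. The Cauchy product stops at r = m + d because M has no terms below
    degree -d.\<close>
  have S_comp: "generic (\<lambda>\<xi>. \<forall>m. hom_component m (S (shift s c)) \<xi> =
      (\<Sum>r\<in>{r::nat. int r \<le> m + d}. blinfun_apply \<xi> s ^ r / fact r * C (m - int r) s \<xi>))" for s
  proof (rule generic_mono[OF M_laurent[of s]], rule allI)
    fix \<xi> :: "'a cdual" and m :: int
    assume "(\<lambda>\<tau>. M_fun S s c (cscale \<tau> \<xi>)) has_laurent_expansion fls_shift d (fps_to_fls (R s \<xi>))"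
    then have "(\<lambda>\<tau>. exp (blinfun_apply \<xi> s * \<tau>) * M_fun S s c (cscale \<tau> \<xi>)) has_laurent_expansion
       fps_to_fls (fps_exp (blinfun_apply \<xi> s)) * fls_shift d (fps_to_fls (R s \<xi>))"
      by (intro has_laurent_expansion_mult has_laurent_expansion_fps has_fps_expansion_exp)
    also have "(\<lambda>\<tau>. exp (blinfun_apply \<xi> s * \<tau>) * M_fun S s c (cscale \<tau> \<xi>)) = (\<lambda>\<tau>. S (shift s c) (cscale \<tau> \<xi>))"
    proof -
      have "exp x * (exp (- x) * y) = y" for x y :: complex by (simp add: exp_minus)
      then show ?thesis
        by (simp only: M_fun_def cscale_apply mult.commute[of "blinfun_apply \<xi> s"])
    qed
    also have "fps_to_fls (fps_exp (blinfun_apply \<xi> s)) * fls_shift d (fps_to_fls (R s \<xi>)) =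
       fls_shift d (fps_to_fls (fps_exp (blinfun_apply \<xi> s) * R s \<xi>))"
      by (simp only: fls_shifted_times_simps fls_times_fps_to_fls)
    finally have comp: "hom_component m (S (shift s c)) \<xi> =
        (if m + d < 0 then 0 else fps_nth (fps_exp (blinfun_apply \<xi> s) * R s \<xi>) (nat (m + d)))"
      by (simp add: hom_component_eq)
    show "hom_component m (S (shift s c)) \<xi> =
      (\<Sum>r\<in>{r::nat. int r \<le> m + d}. blinfun_apply \<xi> s ^ r / fact r * C (m - int r) s \<xi>)"
    proof (cases "m + d < 0")
      case True
      then have "{r::nat. int r \<le> m + d} = {}" by auto
      then show ?thesis using comp True by (simp only: sum.empty if_True)
    next
      case False
      then have "{r::nat. int r \<le> m + d} = {0..nat (m + d)}" by auto
      moreover have "C (m - int r) s \<xi> = fps_nth (R s \<xi>) (nat (m + d) - r)" if "r \<in> {0..nat (m + d)}" for r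
      proof -
        have "nat (m - int r + d) = nat (m + d) - r" "\<not> m - int r + d < 0" using that False by auto
        then show ?thesis by (simp only: C_def if_False)
      qed
      ultimately show ?thesis using comp False by (simp add: fps_mult_nth)
    qed
  qed

  have C_tensor: "C m \<in> tensor (step_poly \<Psi> (m + d)) (hom_rational m)" for m
  proof (cases "m + d < 0")
    case True
    then have "C m = (\<lambda>s \<xi>. 0)" by (simp add: C_def fun_eq_iff)
    then show ?thesis by (simp add: tensor_zero)
  next
    case False
    have "(\<lambda>s \<xi>. \<Sum>t\<in>T. of_real (a t) * (num t \<xi> * fps_nth (ser t s \<xi>) (nat (m + d))))
       \<in> tensor (step_poly \<Psi> (m + d)) (hom_rational m)"
    proof (rule tensor_sum[OF T])
      fix t assume t: "t \<in> T"
      show "(\<lambda>s \<xi>. of_real (a t) * (num t \<xi> * fps_nth (ser t s \<xi>) (nat (m + d))))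
         \<in> tensor (step_poly \<Psi> (m + d)) (hom_rational m)"
      proof (rule tensor_map)
        show "(\<lambda>s \<xi>. num t \<xi> * fps_nth (ser t s \<xi>) (nat (m + d))) \<in> tensor (step_poly \<Psi> (m + d)) (hom_rational m)"
          unfolding num_def ser_def d_def
          by (rule cone_data.M_component_tensor[OF data[OF t]]) (use \<Psi>[OF t] False in \<open>auto simp: d_def\<close>)
      qed (rule hom_rational_cmult)
    qed
    also have "(\<lambda>s \<xi>. \<Sum>t\<in>T. of_real (a t) * (num t \<xi> * fps_nth (ser t s \<xi>) (nat (m + d)))) = C m"
      using False by (simp add: C_def R_nth fun_eq_iff)
    finally show ?thesis .
  qed
  define D where "D s \<xi> = (\<Sum>r\<in>{r::nat. int r \<le> m + d}. blinfun_apply \<xi> s ^ r / fact r * C (m - int r) s \<xi>)" for s \<xi>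
  \<comment> \<open>The r-th power of the pairing raises the degree of the component from m - r to m
    and the quasi-polynomial degree by r, so all summands lie in the same space.\<close>
  have D_tensor: "D \<in> tensor (quasi_poly \<Psi> (m + d)) (hom_rational m)"
  proof -
    have "{r::nat. int r \<le> m + d} \<subseteq> {..nat (m + d)}" by auto
    then have fin: "finite {r::nat. int r \<le> m + d}" by (rule finite_subset) simp
    have "(\<lambda>s \<xi>. \<Sum>r\<in>{r::nat. int r \<le> m + d}. 1 / fact r * (blinfun_apply \<xi> s ^ r * C (m - int r) s \<xi>))
       \<in> tensor (quasi_poly \<Psi> (m + d)) (hom_rational m)"
    proof (rule tensor_sum[OF fin])
      fix r
      have "C (m - int r) \<in> tensor (quasi_poly \<Psi> (m - int r + d)) (hom_rational (m - int r))"
        using C_tensor step_poly_subset_quasi_poly by (rule tensor_mono)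
      from tensor_mult_pairing_power[OF this, of r]
      have "(\<lambda>s \<xi>. blinfun_apply \<xi> s ^ r * C (m - int r) s \<xi>) \<in> tensor (quasi_poly \<Psi> (m + d)) (hom_rational m)"
        by (simp add: algebra_simps)
      then show "(\<lambda>s \<xi>. 1 / fact r * (blinfun_apply \<xi> s ^ r * C (m - int r) s \<xi>))
         \<in> tensor (quasi_poly \<Psi> (m + d)) (hom_rational m)"
        by (rule tensor_map) (rule hom_rational_cmult)
    qed
    then show ?thesis by (simp add: D_def[abs_def])
  qed

  have I_eq: "mero_eq (I c) (C (- d) s)" for s
  proof -
    \<comment> \<open>The integral is evaluated at shift 0, but the lowest coefficient is taken at
      an arbitrary \<open>s\<close>; their agreement contains the independence of
      \<open>s\<close>.\<close>
    have "mero_eq (I (shift 0 c)) (\<lambda>\<xi>. \<Sum>t\<in>T. of_real (a t) * (num t \<xi> * fps_nth (ser t s \<xi>) 0))"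
    proof (rule mero_eq_trans[OF val[OF I] mero_eq_sum])
      fix t assume t: "t \<in> T"
      interpret cone_data \<Lambda> L "A t" "B t" "u t" "\<zeta> t" "\<kappa> t" by (rule data[OF t])
      have "mero_eq (I (shift 0 (cone_data.K (A t \<union> B t) {} (\<zeta> t))))
          (cone_data.generating (A t \<union> B t) {} (u t) (\<zeta> t) (\<kappa> t) 0)"
        by (rule cone_data.S_shift_K[OF cone_data_UNIV[OF HL] I])
      then show "mero_eq (I (shift 0 K)) (\<lambda>\<xi>. num t \<xi> * fps_nth (ser t s \<xi>) 0)"
        unfolding generating_UNIV(1)[OF HL] generating_UNIV(2)[OF HL, abs_def, of s] num_def ser_def
        by (simp add: generating_UNIV(2)[OF HL, of _ s, symmetric])
    qed
    moreover have "shift 0 c = c" by (simp add: shift_def)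
    ultimately show ?thesis by (simp add: C_def[abs_def] R_nth)
  qed
  have low: "mero_eq (hom_component (- d) (S (shift s c))) (I c)"
      "mero_eq (hom_component (- d) (M_fun S s c)) (I c)" for s
  proof -
    \<comment> \<open>In degree -d only r = 0 remains, so the factor exp(<\<xi>,s>) does not affect
      the lowest component.\<close>
    have "{r::nat. int r \<le> 0} = {0}" by auto
    then have "mero_eq (hom_component (- d) (S (shift s c))) (C (- d) s)"
      unfolding mero_eq_iff_generic
      by (intro generic_mono[OF S_comp[of s]]) (drule spec[of _ "- d"], simp)
    then show "mero_eq (hom_component (- d) (S (shift s c))) (I c)"
      using mero_eq_trans mero_eq_sym[OF I_eq] by blast
    have "mero_eq (hom_component (- d) (M_fun S s c)) (C (- d) s)"
      unfolding mero_eq_iff_generic by (rule generic_mono[OF M_comp[of s]]) simp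
    then show "mero_eq (hom_component (- d) (M_fun S s c)) (I c)"
      using mero_eq_trans mero_eq_sym[OF I_eq] by blast
  qed

  show ?thesis unfolding d_def[symmetric]
  proof (intro conjI allI impI)
    show "\<exists>F\<in>tensor (step_poly \<Psi> (m + d)) (hom_rational m). \<forall>s. mero_eq (hom_component m (M_fun S s c)) (F s)"
    proof (intro bexI[of _ "C m"] allI)
      show "mero_eq (hom_component m (M_fun S s c)) (C m s)" for s
        unfolding mero_eq_iff_generic by (rule generic_mono[OF M_comp[of s]]) simp
    qed (rule C_tensor)
    show "\<exists>F\<in>tensor (quasi_poly \<Psi> (m + d)) (hom_rational m). \<forall>s. mero_eq (hom_component m (S (shift s c))) (F s)"
    proof (intro bexI[of _ D] allI)
      show "mero_eq (hom_component m (S (shift s c))) (D s)" for s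
        unfolding mero_eq_iff_generic by (rule generic_mono[OF S_comp[of s]]) (simp add: D_def)
    qed (rule D_tensor)
    fix s
    show "mero_eq (hom_component m (S (shift s c))) (\<lambda>\<xi>. \<Sum>r\<in>{r::nat. int r \<le> m + d}.
               blinfun_apply \<xi> s ^ r / fact r * hom_component (m - int r) (M_fun S s c) \<xi>)"
      unfolding mero_eq_iff_generic by (rule generic_mono[OF generic_conj[OF S_comp[of s] M_comp[of s]]]) simp
    show "mero_eq (hom_component k (S (shift s c))) (\<lambda>_. 0)" if "k < - d" for k
    proof -
      have "{r::nat. int r \<le> k + d} = {}" using that by auto
      then show ?thesis unfolding mero_eq_iff_generic
        by (intro generic_mono[OF S_comp[of s]]) (drule spec[of _ k], simp)
    qed
    show "mero_eq (hom_component (- d) (S (shift s c))) (I c)" "mero_eq (hom_component (- d) (M_fun S s c)) (I c)"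
      by (rule low)+
  qed
qed

end
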